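(* Consider the system $$\frac{dx}{dt}=f(x)+\gamma g(x,\beta t,\alpha t),\qquad x\in\mathbb{R}^n, \qquad (\ast)$$ under the setting described in the context (in particular all critical points of $G_1$ are non-degenerate). For any $\epsilon>0$ and $\epsilon_1>0$ there exist positive $\gamma_1,\alpha_1$ and $\delta$ such that for all parameters $(\alpha,\beta,\gamma)$ satisfying $$\alpha\ge\alpha_1,\quad 0\le\gamma\le\gamma_1,\quad \gamma G_1^-<\beta-\beta_0<\gamma G_1^+,\quad \mathrm{dist}\left(\frac{\beta-\beta_0}{\gamma},S_1\right)\ge\epsilon$$ and for any solution $x(t)$ of system $(\ast)$ such that $\mathrm{dist}(x(t_0),\mathcal{T}_2)<\delta$ for a certain $t_0\in\mathbb{R}$, there exist $\sigma,T\in\mathbb{R}$ such that $$\inf_{\phi}\|x(t)-e^{A\phi}x_0(\beta t+\sigma)\|<\epsilon_1\quad\mbox{for all } t>T.$$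
   Context: Setting. $f:\mathbb{R}^n\to\mathbb{R}^n$ and $g:\mathbb{R}^n\times\mathbb{R}^2\to\mathbb{R}^n$ are $C^l$-smooth with $l>3$; $\alpha>0$, $\beta>0$, $\gamma\ge0$ are real parameters. $A$ is a non-zero real $n\times n$ matrix with $A^T=-A$ and $e^{2\pi A}=I$. For all $x\in\mathbb{R}^n$, $\xi,\psi,\varphi\in\mathbb{R}$: $f(e^{A\xi}x)=e^{A\xi}f(x)$; $g(x,\psi+2\pi,\varphi)=g(x,\psi,\varphi)=g(x,\psi,\varphi+2\pi)$; $g(e^{A\xi}x,\psi,\varphi+\xi)=e^{A\xi}g(x,\psi,\varphi)$. The unperturbed system $dx/dt=f(x)$ has an exponentially orbitally stable quasiperiodic solution $x(t)=e^{A\alpha_0t}x_0(\beta_0t)$, where $x_0:\mathbb{R}\to\mathbb{R}^n$ is $2\pi$-periodic and $\alpha_0>0$, $\beta_0>0$. The vectors $Ax_0(\psi)$ and $\frac{dx_0}{d\psi}(\psi)$ are linearly independent. The set $\mathcal{T}_2:=\{e^{A\varphi}x_0(\psi):\varphi,\psi\in\mathbb{R}\}\subset\mathbb{R}^n$ is a two-dimensional torus invariant under the unperturbed flow. The linear system $\beta_0\frac{dy}{d\psi}=(f'(x_0(\psi))-\alpha_0A)y$ has the two linearly independent $2\pi$-periodic solutions $q_1=\frac{dx_0}{d\psi}$, $q_2=Ax_0$. Exponential orbital stability means that the Floquet multiplier $1$ of this system has multiplicity two and all other multipliers have absolute value less than one. Let $p_1,p_2$ be the $2\pi$-periodic solutions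 of the adjoint system $\beta_0\frac{dz}{d\psi}=-(f'(x_0(\psi))^T+\alpha_0A)z$ with $p_j^T(\psi)q_k(\psi)=\delta_{jk}$ for $j,k=1,2$ and all $\psi$. Define $$g_1(x,\psi):=\frac1{2\pi}\int_0^{2\pi}g(x,\psi,\varphi)\,d\varphi,\qquad G_1(\psi):=\frac1{2\pi}\int_0^{2\pi}p_1^T(\psi+\theta)g_1(x_0(\psi+\theta),\theta)\,d\theta,$$ $G_1^+:=\max_{[0,2\pi]}G_1$, $G_1^-:=\min_{[0,2\pi]}G_1$. It is assumed that $G_1''(\psi)\ne0$ whenever $G_1'(\psi)=0$. $S_1:=\{G_1(\psi):\psi\in[0,2\pi),\ G_1'(\psi)=0\}$ is the (finite) set of singular values of $G_1$. *)

theory Defs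
  imports "HOL-Analysis.Analysis" "HOL-Computational_Algebra.Polynomial"
begin

(* C^k on the whole space. Between finite-dimensional spaces, continuity of all iterated
   directional derivatives of total derivatives is the usual notion. *)
primrec C_smooth :: "nat \<Rightarrow> ('a::real_normed_vector \<Rightarrow> 'b::real_normed_vector) \<Rightarrow> bool" where
  "C_smooth 0 f \<longleftrightarrow> continuous_on UNIV f"
| "C_smooth (Suc k) f \<longleftrightarrow>
     (\<forall>x. f differentiable (at x)) \<and> (\<forall>v. C_smooth k (\<lambda>x. frechet_derivative f (at x) v))"

(* The library's multiplication (and hence power) on type vec is componentwise, so powers
   with respect to matrix multiplication are introduced here; the library's exp does not
   apply to vec either. *)
primrec mpow :: "real^'n^'n \<Rightarrow> nat \<Rightarrow> real^'n^'n" where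
  "mpow A 0 = mat 1"
| "mpow A (Suc k) = A ** mpow A k"

definition mexp :: "real^'n^'n \<Rightarrow> real^'n^'n" where
  "mexp A = (\<Sum>k. (1 / fact k) *\<^sub>R mpow A k)"

definition torus2 :: "real^'n^'n \<Rightarrow> (real \<Rightarrow> real^'n) \<Rightarrow> (real^'n) set" where
  "torus2 A x0 = {mexp (\<phi> *\<^sub>R A) *v x0 \<psi> | \<phi> \<psi>. True}"

definition solution_on :: "(real \<Rightarrow> real^'n \<Rightarrow> real^'n) \<Rightarrow> real set \<Rightarrow> (real \<Rightarrow> real^'n) \<Rightarrow> bool" where
  "solution_on F J x \<longleftrightarrow>
     open J \<and> is_interval J \<and> (\<forall>t\<in>J. (x has_vector_derivative F t (x t)) (at t))"

(* Values of x outside J are irrelevant. *)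
definition maximal_solution :: "(real \<Rightarrow> real^'n \<Rightarrow> real^'n) \<Rightarrow> real set \<Rightarrow> (real \<Rightarrow> real^'n) \<Rightarrow> bool" where
  "maximal_solution F J x \<longleftrightarrow> solution_on F J x \<and>
     (\<forall>K y. solution_on F K y \<longrightarrow> J \<subseteq> K \<longrightarrow> (\<forall>t\<in>J. y t = x t) \<longrightarrow> K = J)"

(* Coefficient matrix of the linearization  \<beta>0 y' = (f'(x0(\<psi>)) - \<alpha>0 A) y,  solved for y'. *)
definition variational_matrix ::
  "(real^'n \<Rightarrow> real^'n) \<Rightarrow> real^'n^'n \<Rightarrow> real \<Rightarrow> real \<Rightarrow> (real \<Rightarrow> real^'n) \<Rightarrow> real \<Rightarrow> real^'n^'n" where
  "variational_matrix f A \<alpha>0 \<beta>0 x0 \<psi> = (1 / \<beta>0) *\<^sub>R (jacobian f (at (x0 \<psi>)) - \<alpha>0 *\<^sub>R A)"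

(* Coefficient matrix of  \<beta>0 z' = -(f'(x0(\<psi>))^T + \<alpha>0 A) z,  solved for z'. *)
definition adjoint_matrix ::
  "(real^'n \<Rightarrow> real^'n) \<Rightarrow> real^'n^'n \<Rightarrow> real \<Rightarrow> real \<Rightarrow> (real \<Rightarrow> real^'n) \<Rightarrow> real \<Rightarrow> real^'n^'n" where
  "adjoint_matrix f A \<alpha>0 \<beta>0 x0 \<psi> =
     - ((1 / \<beta>0) *\<^sub>R (transpose (jacobian f (at (x0 \<psi>))) + \<alpha>0 *\<^sub>R A))"

definition principal_fundamental_matrix ::
  "(real \<Rightarrow> real^'n^'n) \<Rightarrow> (real \<Rightarrow> real^'n^'n) \<Rightarrow> bool" where
  "principal_fundamental_matrix B Y \<longleftrightarrow>
     Y 0 = mat 1 \<and> (\<forall>\<psi>. (Y has_vector_derivative B \<psi> ** Y \<psi>) (at \<psi>))"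

(* det (z I - M) as a polynomial in z over the complex numbers: the determinant is taken
   of a matrix whose entries are polynomials. *)
definition charpoly :: "real^'n^'n \<Rightarrow> complex poly" where
  "charpoly M =
     det ((\<chi> i j. (if i = j then [:0, 1:] else 0) - [:complex_of_real (M $ i $ j):]) :: complex poly^'n^'n)"

(* The Floquet multipliers are the eigenvalues of the monodromy matrix Y (2 pi), counted
   with algebraic multiplicity. The principal fundamental matrix Y exists and is unique
   for continuous coefficients. *)
definition exponentially_orbitally_stable ::
  "(real^'n \<Rightarrow> real^'n) \<Rightarrow> real^'n^'n \<Rightarrow> real \<Rightarrow> real \<Rightarrow> (real \<Rightarrow> real^'n) \<Rightarrow> bool" where
  "exponentially_orbitally_stable f A \<alpha>0 \<beta>0 x0 \<longleftrightarrow>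
     (\<exists>Y. principal_fundamental_matrix (variational_matrix f A \<alpha>0 \<beta>0 x0) Y \<and>
          order 1 (charpoly (Y (2 * pi))) = 2 \<and>
          (\<forall>\<mu>. poly (charpoly (Y (2 * pi))) \<mu> = 0 \<longrightarrow> \<mu> \<noteq> 1 \<longrightarrow> cmod \<mu> < 1))"

definition g1 :: "((real^'n) \<times> real \<times> real \<Rightarrow> real^'n) \<Rightarrow> real^'n \<Rightarrow> real \<Rightarrow> real^'n" where
  "g1 g x \<psi> = (1 / (2 * pi)) *\<^sub>R integral {0..2 * pi} (\<lambda>\<phi>. g (x, \<psi>, \<phi>))"

definition G1 :: "((real^'n) \<times> real \<times> real \<Rightarrow> real^'n) \<Rightarrow> (real \<Rightarrow> real^'n) \<Rightarrow> (real \<Rightarrow> real^'n) \<Rightarrow> real \<Rightarrow> real" where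
  "G1 g x0 p1 \<psi> =
     (1 / (2 * pi)) * integral {0..2 * pi} (\<lambda>\<theta>. p1 (\<psi> + \<theta>) \<bullet> g1 g (x0 (\<psi> + \<theta>)) \<theta>)"

(* Sup and Inf are attained where these are used, G1 being continuous on a compact
   interval (Max and Min of the library are meaningful for finite sets only). *)
definition G1_plus :: "((real^'n) \<times> real \<times> real \<Rightarrow> real^'n) \<Rightarrow> (real \<Rightarrow> real^'n) \<Rightarrow> (real \<Rightarrow> real^'n) \<Rightarrow> real" where
  "G1_plus g x0 p1 = (SUP \<psi>\<in>{0..2 * pi}. G1 g x0 p1 \<psi>)"

definition G1_minus :: "((real^'n) \<times> real \<times> real \<Rightarrow> real^'n) \<Rightarrow> (real \<Rightarrow> real^'n) \<Rightarrow> (real \<Rightarrow> real^'n) \<Rightarrow> real" where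
  "G1_minus g x0 p1 = (INF \<psi>\<in>{0..2 * pi}. G1 g x0 p1 \<psi>)"

definition S1 :: "((real^'n) \<times> real \<times> real \<Rightarrow> real^'n) \<Rightarrow> (real \<Rightarrow> real^'n) \<Rightarrow> (real \<Rightarrow> real^'n) \<Rightarrow> real set" where
  "S1 g x0 p1 = {G1 g x0 p1 \<psi> | \<psi>. \<psi> \<in> {0..<2 * pi} \<and> deriv (G1 g x0 p1) \<psi> = 0}"

end

theory Submission
  imports Defs "HOL-Computational_Algebra.Fundamental_Theorem_Algebra"
begin

text \<open>Instead of an integral manifold, the proof uses a discrete sequence of phases. Over a fixed number
  \<open>m\<close> of unperturbed periods a solution is compared with \<open>e\<^sup>A\<^sup>\<phi> x0(\<psi>)\<close>, where \<open>\<psi>\<close> and \<open>\<phi>\<close> grow linearly;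
  then both phases are shifted by the components of the deviation along \<open>dx0/d\<psi>\<close> and \<open>A x0\<close>. By the
  condition on the Floquet multipliers, the remaining part of the deviation has contracted, so after
  a transient the deviation is of order \<open>\<gamma>\<close>. The phase difference \<open>\<sigma> = \<psi> - \<beta> t\<close> then satisfies
  \<open>\<sigma>\<^sub>k\<^sub>+\<^sub>1 - \<sigma>\<^sub>k = \<gamma> \<tau> (G1(\<sigma>\<^sub>k) - w + o(1))\<close> with \<open>w = (\<beta> - \<beta>0)/\<gamma>\<close>, by averaging over the fast phase \<open>\<alpha> t\<close>.
  Points at which \<open>G1\<close> is not close to \<open>w\<close> are one-way barriers for this recursion. As \<open>w\<close> is at
  distance \<open>\<epsilon>\<close> from the critical values, such points occur in every short interval and on both
  sides, so \<open>\<sigma>\<^sub>k\<close> is eventually trapped in a short interval; whether this lies near a stable or an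
  unstable root of \<open>G1 = w\<close> is irrelevant.\<close>

subsection \<open>Differential inequalities and continuation of solutions\<close>

text \<open>The obstacle is that a step moves the phase difference only by order \<gamma>, while the
  deviation is itself of order \<gamma>. Two facts bring the errors down to o(\<gamma>). The pairing
  of \<open>p1\<close> with the linearized flow is constant, so over a segment it changes by the
  integral of \<open>p1\<close> against the forcing alone; and a reset leaves of the
  \<open>p1\<close> component only a fraction \<eta>, so little is carried into the next segment. By
  equivariance the equation can be read in the frame rotated by -\<phi>, where \<alpha> enters only
  through the third argument of \<open>g\<close>, with speed \<alpha> - \<alpha>0; hence a large
  \<alpha> suffices for averaging. Over a whole number of periods the slow mean is exactly
  \<open>\<tau> * G\<close>, and the projections at both ends coincide. The constants come in the
  order \<tau>, \<open>C\<close>, then \<eta>, then the radius \<open>r\<close> and the bounds on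
  \<gamma> and \<alpha>, so that the admissible initial distance does not shrink with \<gamma>.
  Finally, the extreme values of \<open>G1\<close> are critical values, so \<open>w\<close> keeps
  distance \<epsilon> from them too; this yields barriers in both directions and keeps the phase
  difference bounded.\<close>

lemma has_vector_derivative_imp_norm_bound:
  fixes w :: "real \<Rightarrow> 'a::real_normed_vector"
  assumes "\<And>s. s \<in> {a..b} \<Longrightarrow> (w has_vector_derivative w' s) (at s within {a..b})"
    and "\<And>s. s \<in> {a..b} \<Longrightarrow> norm (w' s) \<le> B"
    and "s \<in> {a..b}" "t \<in> {a..b}"
  shows "norm (w s - w t) \<le> B * \<bar>s - t\<bar>"
proof -
  have "norm (w s - w t) \<le> B * norm (s - t)"
  proof (rule differentiable_bound[of "{a..b}" w "\<lambda>s h. h *\<^sub>R w' s"])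
    show "(w has_derivative (\<lambda>h. h *\<^sub>R w' x)) (at x within {a..b})" if "x \<in> {a..b}" for x
      using assms(1)[OF that] by (simp add: has_vector_derivative_def)
    show "onorm (\<lambda>h. h *\<^sub>R w' x) \<le> B" if "x \<in> {a..b}" for x
    proof (rule onorm_bound)
      show "0 \<le> B" using assms(2)[OF that] norm_ge_zero[of "w' x"] by linarith
      show "norm (h *\<^sub>R w' x) \<le> B * norm h" for h
        using mult_left_mono[OF assms(2)[OF that], of "\<bar>h\<bar>"] by (simp add: mult.commute)
    qed
  qed (use assms in auto)
  then show ?thesis by simp
qed

text \<open>With the integrating factor, exp (-c (s - a)) v - d (s - a) is nonincreasing, because
  the factor is at most 1. This coarse form avoids a division by \<open>c\<close>.\<close>

lemma gronwall_scalar: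
  fixes v :: "real \<Rightarrow> real"
  assumes dv: "\<And>s. s \<in> {a..b} \<Longrightarrow> (v has_real_derivative v' s) (at s within {a..b})"
    and bd: "\<And>s. s \<in> {a..b} \<Longrightarrow> v' s \<le> c * v s + d"
    and "0 \<le> c" "0 \<le> d" "s \<in> {a..b}"
  shows "v s \<le> exp (c * (s - a)) * (v a + d * (s - a))"
proof -
  define z where "z = (\<lambda>s. exp (- (c * (s - a))) * v s - d * (s - a))"
  have dz: "(z has_real_derivative exp (- (c * (s - a))) * (v' s - c * v s) - d) (at s within {a..b})"
    if "s \<in> {a..b}" for s
    unfolding z_def by (rule derivative_eq_intros dv[OF that] refl)+ (simp add: algebra_simps)
  have "z s \<le> z a"
  proof (cases "a < s")
    case True
    show ?thesis
    proof (rule DERIV_nonpos_imp_decreasing_open[OF less_imp_le[OF True]])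
      fix x assume x: "a < x" "x < s"
      then have xin: "x \<in> {a..b}" "x \<in> interior {a..b}" using assms(5) by auto
      have dzx: "(z has_real_derivative exp (- (c * (x - a))) * (v' x - c * v x) - d) (at x)"
        using dz[OF xin(1)] at_within_interior[OF xin(2)] by simp
      have "exp (- (c * (x - a))) * (v' x - c * v x) \<le> 1 * d"
      proof (cases "v' x - c * v x \<ge> 0")
        case True
        then show ?thesis using bd[OF xin(1)] x \<open>0 \<le> c\<close> by (intro mult_mono) auto
      next
        case False
        then show ?thesis using \<open>0 \<le> d\<close>
          by (auto intro: order_trans[OF mult_nonneg_nonpos])
      qed
      then have "exp (- (c * (x - a))) * (v' x - c * v x) - d \<le> 0" by linarith
      with dzx show "\<exists>y. (z has_real_derivative y) (at x) \<and> y \<le> 0" by blast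
    next
      have "continuous_on {a..b} z"
        by (rule DERIV_continuous_on) (rule dz)
      then show "continuous_on {a..s} z"
        by (rule continuous_on_subset) (use assms(5) in auto)
    qed
  next
    case False
    then show ?thesis using assms(5) by auto
  qed
  then have "exp (- (c * (s - a))) * v s \<le> v a + d * (s - a)" by (simp add: z_def)
  then have "exp (c * (s - a)) * (exp (- (c * (s - a))) * v s) \<le> exp (c * (s - a)) * (v a + d * (s - a))"
    by (rule mult_left_mono) simp
  then show ?thesis by (simp add: mult.assoc[symmetric] exp_add[symmetric])
qed

text \<open>The norm is not differentiable at 0, so the scalar inequality is applied to the squared
  norm, with 2 |w| q \<le> |w|^2 + q^2 for the mixed term. The rate p + 1 absorbs this and the
  linear factor s - a: the squared bound has rate (2 p + 1) + 1 = 2 (p + 1).\<close>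

lemma gronwall_norm:
  fixes w :: "real \<Rightarrow> 'a::real_inner"
  assumes dw: "\<And>s. s \<in> {a..b} \<Longrightarrow> (w has_vector_derivative w' s) (at s within {a..b})"
    and bd: "\<And>s. s \<in> {a..b} \<Longrightarrow> norm (w' s) \<le> p * norm (w s) + q"
    and "0 \<le> p" "0 \<le> q" "s \<in> {a..b}"
  shows "norm (w s) \<le> exp ((p + 1) * (s - a)) * (norm (w a) + q)"
proof -
  define v where "v = (\<lambda>s. w s \<bullet> w s)"
  have dv: "(v has_real_derivative 2 * (w s \<bullet> w' s)) (at s within {a..b})" if "s \<in> {a..b}" for s
  proof -
    have "(v has_derivative (\<lambda>h. w s \<bullet> (h *\<^sub>R w' s) + (h *\<^sub>R w' s) \<bullet> w s)) (at s within {a..b})"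
      unfolding v_def
      by (rule has_derivative_inner) (use dw[OF that] in \<open>auto simp: has_vector_derivative_def\<close>)
    then show ?thesis
      unfolding has_field_derivative_def
      by (rule has_derivative_eq_rhs) (auto simp: inner_commute)
  qed
  have bv: "2 * (w s \<bullet> w' s) \<le> (2 * p + 1) * v s + q\<^sup>2" if "s \<in> {a..b}" for s
  proof -
    have "w s \<bullet> w' s \<le> norm (w s) * norm (w' s)" by (rule norm_cauchy_schwarz)
    also have "\<dots> \<le> norm (w s) * (p * norm (w s) + q)"
      by (rule mult_left_mono[OF bd[OF that]]) simp
    finally have 1: "2 * (w s \<bullet> w' s) \<le> 2 * p * (norm (w s))\<^sup>2 + 2 * norm (w s) * q"
      by (simp add: algebra_simps power2_eq_square)
    have "2 * norm (w s) * q \<le> (norm (w s))\<^sup>2 + q\<^sup>2" by (rule sum_squares_bound)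
    with 1 show ?thesis by (simp add: v_def dot_square_norm algebra_simps)
  qed
  define \<tau> where "\<tau> = s - a"
  have \<tau>: "\<tau> \<ge> 0" using assms(5) by (simp add: \<tau>_def)
  have "v s \<le> exp ((2 * p + 1) * \<tau>) * (v a + q\<^sup>2 * \<tau>)"
    unfolding \<tau>_def using dv bv assms by (intro gronwall_scalar) auto
  also have "\<dots> \<le> exp ((2 * p + 1) * \<tau>) * (exp \<tau> * (norm (w a) + q)\<^sup>2)"
  proof (rule mult_left_mono)
    have "\<tau> \<le> exp \<tau>" using exp_ge_add_one_self[of \<tau>] by linarith
    then have "v a + q\<^sup>2 * \<tau> \<le> exp \<tau> * (norm (w a))\<^sup>2 + q\<^sup>2 * exp \<tau>"
      using \<tau> mult_right_mono[of 1 "exp \<tau>" "(norm (w a))\<^sup>2"]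
      by (intro add_mono mult_left_mono) (auto simp: v_def dot_square_norm)
    also have "\<dots> \<le> exp \<tau> * (norm (w a) + q)\<^sup>2"
      using assms(4) by (simp add: power2_sum algebra_simps)
    finally show "v a + q\<^sup>2 * \<tau> \<le> exp \<tau> * (norm (w a) + q)\<^sup>2" .
  qed simp
  also have "\<dots> = (exp ((p + 1) * \<tau>) * (norm (w a) + q))\<^sup>2"
  proof -
    have "exp ((2 * p + 1) * \<tau>) * exp \<tau> = exp ((p + 1) * \<tau>) * exp ((p + 1) * \<tau>)"
      unfolding exp_add[symmetric] by (simp add: algebra_simps)
    then show ?thesis unfolding power_mult_distrib power2_eq_square[of "exp _"] mult.assoc[symmetric] by simp
  qed
  finally show ?thesis
    unfolding v_def dot_square_norm \<tau>_def[symmetric]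
    by (rule power2_le_imp_le) (use assms(4) in simp)
qed

text \<open>At a first exit time the bound would still hold, although it lies below the threshold \<open>r\<close>.\<close>

lemma gronwall_no_exit:
  fixes h :: "real \<Rightarrow> 'a::real_inner"
  assumes dh: "\<And>s. s \<in> {0..S} \<Longrightarrow> (h has_vector_derivative h' s) (at s within {0..S})"
    and bd: "\<And>s. s \<in> {0..S} \<Longrightarrow> norm (h s) \<le> r \<Longrightarrow> norm (h' s) \<le> p * norm (h s) + b"
    and "0 \<le> p" "0 \<le> b" and small: "exp ((p + 1) * S) * (norm (h 0) + b) < r"
    and s: "s \<in> {0..S}"
  shows "norm (h s) \<le> exp ((p + 1) * S) * (norm (h 0) + b)"
proof -
  have gr: "norm (h u) \<le> exp ((p + 1) * S) * (norm (h 0) + b)"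
    if u: "u \<in> {0..S}" "\<And>v. v \<in> {0..u} \<Longrightarrow> norm (h v) \<le> r" for u
  proof -
    have "norm (h u) \<le> exp ((p + 1) * (u - 0)) * (norm (h 0) + b)"
    proof (rule gronwall_norm[where b = u])
      show "(h has_vector_derivative h' s) (at s within {0..u})" if "s \<in> {0..u}" for s
        by (rule has_vector_derivative_within_subset[OF dh]) (use that u in auto)
    qed (use assms u in auto)
    also have "\<dots> \<le> exp ((p + 1) * S) * (norm (h 0) + b)"
      using u \<open>0 \<le> p\<close> \<open>0 \<le> b\<close> by (intro mult_right_mono) (auto intro!: mult_left_mono)
    finally show ?thesis .
  qed
  have "norm (h v) \<le> r" if "v \<in> {0..S}" for v
  proof (rule ccontr)
    assume v: "\<not> norm (h v) \<le> r"
    have cont: "continuous_on {0..S} (\<lambda>s. norm (h s))"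
      by (intro continuous_on_norm continuous_on_vector_derivative[OF dh])
    define K where "K = {u \<in> {0..S}. r \<le> norm (h u)}"
    have "closed K" unfolding K_def
      by (rule continuous_on_closed_Collect_le[OF continuous_on_const cont closed_atLeastAtMost])
    then have cK: "compact K" unfolding compact_eq_bounded_closed
      by (auto intro: bounded_subset[of "{0..S}"] simp: K_def)
    have "K \<noteq> {}" using v that by (auto simp: K_def)
    from compact_attains_inf[OF cK this] obtain u where u: "u \<in> K" "\<And>w. w \<in> K \<Longrightarrow> u \<le> w" by auto
    have h0: "norm (h 0) < r"
    proof -
      have "1 * (norm (h 0) + b) \<le> exp ((p + 1) * S) * (norm (h 0) + b)"
        using s \<open>0 \<le> p\<close> \<open>0 \<le> b\<close> by (intro mult_right_mono) auto
      from le_less_trans[OF this small] show ?thesis using \<open>0 \<le> b\<close> by simp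
    qed
    \<comment> \<open>\<open>u\<close> is the first time with norm at least \<open>r\<close>. The
      intermediate value theorem gives a time at or before \<open>u\<close> with norm exactly
      \<open>r\<close>, and this can only be \<open>u\<close>. Thus the norm is at most
      \<open>r\<close> on all of \<open>{0..u}\<close>, and \<open>gr\<close> applies at
      \<open>u\<close>.\<close>
    have "\<exists>w\<ge>0. w \<le> u \<and> norm (h w) = r"
      by (rule IVT'[OF _ _ _ continuous_on_subset[OF cont]]) (use u h0 in \<open>auto simp: K_def\<close>)
    then obtain w where w: "0 \<le> w" "w \<le> u" "norm (h w) = r" by blast
    then have "w \<in> K" using u by (auto simp: K_def)
    then have ur: "norm (h u) = r" using u(2)[of w] w by auto
    have "norm (h w) \<le> r" if "w \<in> {0..u}" for w
    proof (cases "w = u")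
      case False
      then have "w \<notin> K" using u(2)[of w] that by auto
      then show ?thesis using that u by (auto simp: K_def)
    qed (simp add: ur)
    then have "norm (h u) \<le> exp ((p + 1) * S) * (norm (h 0) + b)" using u by (intro gr) (auto simp: K_def)
    then show False using small ur by simp
  qed
  then show ?thesis using s by (intro gr) auto
qed

text \<open>The step length depends on the starting point only through the bounds \<open>M\<close>
  and \<open>\<Lambda>\<close>. Where these are uniform, a continuation argument can start as close
  to the end of an interval as it likes.\<close>

lemma picard_lindelof:
  fixes F :: "real \<Rightarrow> 'a::euclidean_space \<Rightarrow> 'a"
  assumes cont: "continuous_on UNIV (\<lambda>(t, y). F t y)"
    and bound: "\<And>t y. t \<in> {t1 - d..t1 + d} \<Longrightarrow> norm (y - y1) \<le> 1 \<Longrightarrow> norm (F t y) \<le> M"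
    and lip: "\<And>t y z. t \<in> {t1 - d..t1 + d} \<Longrightarrow> norm (y - y1) \<le> 1 \<Longrightarrow> norm (z - y1) \<le> 1 \<Longrightarrow>
      norm (F t y - F t z) \<le> \<Lambda> * norm (y - z)"
    and d: "0 < d" "d * M \<le> 1" "d * \<Lambda> \<le> 1 / 2" and "0 \<le> \<Lambda>"
  obtains y where "y t1 = y1"
    "\<And>t. t \<in> {t1 - d<..<t1 + d} \<Longrightarrow> (y has_vector_derivative F t (y t)) (at t)"
    "\<And>t. norm (y t - y1) \<le> 1"
proof -
  define X :: "(real \<Rightarrow>\<^sub>C 'a) set" where "X = PiC UNIV (\<lambda>_. cball y1 1)"
  define I where "I = (\<lambda>(x :: real \<Rightarrow>\<^sub>C 'a) t. integral {t1 - d..t} (\<lambda>s. F s (x s)))"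
  \<comment> \<open>Clamping time to the interval makes every iterate a bounded continuous function
    on the whole line, so that the fixed point theorem applies in the complete space of such
    functions.\<close>
  define cl where "cl = (\<lambda>t. max (t1 - d) (min (t1 + d) t))"
  \<comment> \<open>An integral over \<open>{t1..t}\<close> would be 0 for t < t1; integrating from
    t1 - d and subtracting the value at \<open>t1\<close> gives the oriented integral.\<close>
  define T where "T = (\<lambda>x t. y1 + I x (cl t) - I x t1)"
  have XD: "norm (x s - y1) \<le> 1" if "x \<in> X" for x s
    using that by (auto simp: X_def mem_PiC_iff dist_norm norm_minus_commute)
  have cF: "continuous_on S (\<lambda>s. F s (x s))" for S and x :: "real \<Rightarrow>\<^sub>C 'a"
  proof -
    have "continuous_on S (\<lambda>s. (\<lambda>(t, y). F t y) (s, x s))"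
      by (rule continuous_on_compose2[OF cont]) (auto intro!: continuous_intros)
    then show ?thesis by simp
  qed
  have dI: "(I x has_vector_derivative F t (x t)) (at t within {t1 - d..t1 + d})"
    if "t \<in> {t1 - d..t1 + d}" for x t
    unfolding I_def by (rule integral_has_vector_derivative[OF cF that])
  have clin: "cl t \<in> {t1 - d..t1 + d}" for t using d by (auto simp: cl_def)
  have t1in: "t1 \<in> {t1 - d..t1 + d}" using d by auto
  have clb: "\<bar>cl t - t1\<bar> \<le> d" for t using clin[of t] by auto
  have cT: "continuous_on UNIV (T x)" for x
  proof -
    have "continuous_on {t1 - d..t1 + d} (I x)"
      using dI by (rule continuous_on_vector_derivative)
    then have "continuous_on UNIV (\<lambda>t. I x (cl t))"
    proof (rule continuous_on_compose2)
      show "continuous_on UNIV cl"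
        unfolding cl_def by (intro continuous_on_max continuous_on_min continuous_on_const continuous_on_id)
    qed (use clin in auto)
    then show ?thesis unfolding T_def by (intro continuous_intros)
  qed
  have M0: "0 \<le> M" using order_trans[OF norm_ge_zero bound[OF t1in, of y1]] by simp
  have bT: "norm (T x t - y1) \<le> 1" if "x \<in> X" for x t
  proof -
    have "norm (I x (cl t) - I x t1) \<le> M * \<bar>cl t - t1\<bar>"
      by (rule has_vector_derivative_imp_norm_bound[OF dI _ clin t1in]) (use bound XD that in auto)
    also have "\<dots> \<le> M * d" using clb M0 by (rule mult_left_mono)
    finally show ?thesis using d by (simp add: T_def mult.commute algebra_simps)
  qed
  have bcT: "T x \<in> bcontfun" if "x \<in> X" for x
  proof (rule bcontfun_normI[OF cT])
    show "norm (T x t) \<le> norm y1 + 1" for t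
      using bT[OF that, of t] norm_triangle_sub[of "T x t" y1] by simp
  qed
  have "\<exists>!x. x \<in> X \<and> Bcontfun (T x) = x"
  proof (rule Banach_fix[where c = "1/2"])
    show "complete X" unfolding X_def by (simp add: closed_PiC complete_eq_closed)
    have "const_bcontfun y1 \<in> X" by (simp add: X_def mem_PiC_iff const_bcontfun.rep_eq)
    then show "X \<noteq> {}" by blast
    show "(\<lambda>x. Bcontfun (T x)) ` X \<subseteq> X"
    proof (clarsimp)
      fix x assume "x \<in> X"
      then show "Bcontfun (T x) \<in> X"
        using bT[of x] by (auto simp: X_def mem_PiC_iff Bcontfun_inverse[OF bcT] dist_norm norm_minus_commute)
    qed
    fix x z assume xz: "x \<in> X" "z \<in> X"
    show "dist (Bcontfun (T x)) (Bcontfun (T z)) \<le> 1 / 2 * dist x z"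
    proof (rule dist_bound)
      fix t
      have "norm ((I x (cl t) - I z (cl t)) - (I x t1 - I z t1)) \<le> (\<Lambda> * dist x z) * \<bar>cl t - t1\<bar>"
      proof (rule has_vector_derivative_imp_norm_bound[where w = "\<lambda>t. I x t - I z t", OF _ _ clin t1in])
        fix s assume s: "s \<in> {t1 - d..t1 + d}"
        show "((\<lambda>t. I x t - I z t) has_vector_derivative F s (x s) - F s (z s)) (at s within {t1 - d..t1 + d})"
          by (rule has_vector_derivative_diff[OF dI[OF s] dI[OF s]])
        have "norm (F s (x s) - F s (z s)) \<le> \<Lambda> * norm (x s - z s)"
          using lip[OF s XD[OF xz(1)] XD[OF xz(2)]] .
        also have "\<dots> \<le> \<Lambda> * dist x z"
          using dist_bounded[of x s z] assms(7) by (intro mult_left_mono) (auto simp: dist_norm)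
        finally show "norm (F s (x s) - F s (z s)) \<le> \<Lambda> * dist x z" .
      qed
      also have "\<dots> \<le> (\<Lambda> * dist x z) * d"
        using clb assms(7) by (intro mult_left_mono) auto
      also have "\<dots> = (d * \<Lambda>) * dist x z" by simp
      also have "\<dots> \<le> 1 / 2 * dist x z" using d(3) by (rule mult_right_mono) simp
      finally show "dist (Bcontfun (T x) t) (Bcontfun (T z) t) \<le> 1 / 2 * dist x z"
        unfolding Bcontfun_inverse[OF bcT[OF xz(1)]] Bcontfun_inverse[OF bcT[OF xz(2)]]
          dist_norm[of "T x t"] by (simp add: T_def algebra_simps)
    qed
  qed auto
  then obtain x where x: "x \<in> X" "Bcontfun (T x) = x" by blast
  have xT: "x t = T x t" for t
    using x by (metis Bcontfun_inverse bcT)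
  show thesis
  proof (rule that[of "apply_bcontfun x"])
    show "x t1 = y1" using d by (subst xT) (simp add: T_def cl_def)
    show "norm (x t - y1) \<le> 1" for t using XD[OF x(1)] .
    fix t assume t: "t \<in> {t1 - d<..<t1 + d}"
    have "(I x has_vector_derivative F t (x t)) (at t)"
      using dI[of t x] t at_within_interior[of t "{t1 - d..t1 + d}"] by auto
    then have "((\<lambda>t. y1 + I x t - I x t1) has_vector_derivative F t (x t)) (at t)"
      by (auto intro!: derivative_eq_intros)
    then show "(x has_vector_derivative F t (x t)) (at t)"
    proof (rule has_vector_derivative_transform_within_open[OF _ open_greaterThanLessThan t])
      fix s assume "s \<in> {t1 - d<..<t1 + d}"
      then have "cl s = s" by (auto simp: cl_def)
      then show "y1 + I x s - I x t1 = x s" using xT[of s] by (simp add: T_def)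
    qed
  qed
qed

text \<open>A bounded solution stays in a compact set, on which the local existence time
  \<open>d\<close> is uniform. If \<open>J\<close> ended at some c \<le> b, local existence from a
  time less than \<open>d\<close> before \<open>c\<close> would extend the solution beyond
  \<open>c\<close>, against maximality.\<close>

lemma maximal_solution_continues:
  fixes F :: "real \<Rightarrow> real^'n \<Rightarrow> real^'n"
  assumes max: "maximal_solution F J x"
    and cont: "continuous_on UNIV (\<lambda>(t, y). F t y)"
    and lip: "\<And>R. \<exists>\<Lambda>\<ge>0. \<forall>t y z. norm y \<le> R \<longrightarrow> norm z \<le> R \<longrightarrow> norm (F t y - F t z) \<le> \<Lambda> * norm (y - z)"
    and a: "a \<in> J" "a \<le> b" and bd: "\<And>t. t \<in> J \<Longrightarrow> a \<le> t \<Longrightarrow> t < b \<Longrightarrow> norm (x t) \<le> R"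
  shows "b \<in> J"
proof (rule ccontr)
  assume bJ: "b \<notin> J"
  have J: "open J" "is_interval J" and dx: "\<And>t. t \<in> J \<Longrightarrow> (x has_vector_derivative F t (x t)) (at t)"
    using max by (auto simp: maximal_solution_def solution_on_def)
  have conv: "s \<in> J" if "u \<in> J" "v \<in> J" "u \<le> s" "s \<le> v" for u v s
    using J(2) that unfolding is_interval_1 by blast
  have Jb: "s < b" if "s \<in> J" for s
    using conv[OF a(1) that, of b] bJ a(2) by force
  define c where "c = Sup J"
  have bdJ: "bdd_above J" using Jb by (meson bdd_aboveI less_imp_le)
  have c_ub: "s \<le> c" if "s \<in> J" for s unfolding c_def using that bdJ by (rule cSup_upper)
  have cJ: "c \<notin> J"
  proof
    assume "c \<in> J"
    then obtain e where "e > 0" "ball c e \<subseteq> J" using J(1) openE by blast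
    moreover have "c + e / 2 \<in> ball c e" using \<open>e > 0\<close> by (simp add: dist_norm)
    ultimately show False using c_ub[of "c + e / 2"] by auto
  qed
  have Jc: "s < c" if "s \<in> J" for s using c_ub[OF that] cJ that by (cases "s = c") auto
  have cb: "c \<le> b" unfolding c_def using a(1) Jb by (intro cSup_least) (auto intro: less_imp_le)
  have inJ: "s \<in> J" if s: "a \<le> s" "s < c" for s
  proof -
    obtain v where "v \<in> J" "s < v" using less_cSupD[of J s] a(1) s(2) by (auto simp: c_def)
    then show ?thesis using conv[OF a(1)] s by auto
  qed
  obtain \<Lambda> where \<Lambda>: "\<Lambda> \<ge> 0"
    "\<And>t y z. norm y \<le> R + 1 \<Longrightarrow> norm z \<le> R + 1 \<Longrightarrow> norm (F t y - F t z) \<le> \<Lambda> * norm (y - z)"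
    using lip[of "R + 1"] by blast
  have "compact ((\<lambda>(t, y). F t y) ` ({a - 1..b + 1} \<times> cball 0 (R + 1)))"
    by (intro compact_continuous_image continuous_on_subset[OF cont] compact_Times) auto
  then obtain M where M: "M > 0" "\<And>t y. t \<in> {a - 1..b + 1} \<Longrightarrow> norm y \<le> R + 1 \<Longrightarrow> norm (F t y) \<le> M"
    by (force simp: bounded_pos dest!: compact_imp_bounded)
  define d where "d = min 1 (min (1 / M) (1 / (2 * \<Lambda> + 2)))"
  have d: "0 < d" "d \<le> 1" "d \<le> 1 / M" "d \<le> 1 / (2 * \<Lambda> + 2)" using M(1) \<Lambda>(1) by (auto simp: d_def)
  have d': "d * M \<le> 1" "d * \<Lambda> \<le> 1 / 2" using d(1,3,4) M(1) \<Lambda>(1) by (simp_all add: field_simps)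
  \<comment> \<open>The maximum keeps \<open>t1\<close> in the part of \<open>J\<close> to the right
    of \<open>a\<close>; in either case c < t1 + d.\<close>
  define t1 where "t1 = max a (c - d / 2)"
  have t1: "t1 \<in> J" "a \<le> t1" "t1 < c" "c < t1 + d"
    using d Jc[OF a(1)] by (auto simp: t1_def intro!: inJ)
  have xR: "norm (x t) \<le> R" if "a \<le> t" "t < c" for t
    using bd[OF inJ[OF that]] that cb by auto
  have near: "norm y \<le> R + 1" if "norm (y - x t1) \<le> 1" for y
    using norm_triangle_sub[of y "x t1"] xR[of t1] t1 that by linarith
  obtain y where y: "y t1 = x t1"
    "\<And>t. t \<in> {t1 - d<..<t1 + d} \<Longrightarrow> (y has_vector_derivative F t (y t)) (at t)"
    "\<And>t. norm (y t - x t1) \<le> 1"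
  proof (rule picard_lindelof[OF cont _ _ d(1) d' \<Lambda>(1), of t1 "x t1"])
    fix t and u :: "real^'n" assume t: "t \<in> {t1 - d..t1 + d}" and u: "norm (u - x t1) \<le> 1"
    show "norm (F t u) \<le> M" using t t1 d cb by (intro M(2) near[OF u]) auto
    fix v assume v: "norm (v - x t1) \<le> 1"
    show "norm (F t u - F t v) \<le> \<Lambda> * norm (u - v)" by (rule \<Lambda>(2)[OF near[OF u] near[OF v]])
  qed blast
  \<comment> \<open>Agreement is required only to the right of \<open>t1\<close>, because
    \<open>K\<close> enlarges \<open>J\<close> by points of \<open>{t1<..<t1 + d}\<close>.\<close>
  have eq: "x t = y t" if "t1 < t" "t < c" for t
  proof -
    have "norm (x t - y t) \<le> exp ((\<Lambda> + 1) * (t - t1)) * (norm (x t1 - y t1) + 0)"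
    proof (rule gronwall_norm[where b = t and w = "\<lambda>s. x s - y s" and w' = "\<lambda>s. F s (x s) - F s (y s)"])
      fix s assume s: "s \<in> {t1..t}"
      then have "s \<in> J" using t1 that by (intro inJ) auto
      then show "((\<lambda>s. x s - y s) has_vector_derivative F s (x s) - F s (y s)) (at s within {t1..t})"
        using s that t1 d by (intro has_vector_derivative_at_within[OF has_vector_derivative_diff[OF dx y(2)]]) auto
      show "norm (F s (x s) - F s (y s)) \<le> \<Lambda> * norm (x s - y s) + 0"
        using \<Lambda>(2)[OF _ near[OF y(3)], of "x s"] xR[of s] s t1 that by auto
    qed (use \<Lambda> that in auto)
    then show ?thesis using y(1) by simp
  qed
  define K where "K = J \<union> {t1<..<t1 + d}"
  define z where "z = (\<lambda>t. if t \<in> J then x t else y t)"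
  have "solution_on F K z"
    unfolding solution_on_def
  proof (intro conjI ballI)
    show "open K" unfolding K_def using J(1) by auto
    show "is_interval K"
      unfolding is_interval_1
    proof (intro ballI allI impI)
      fix u v s assume uv: "u \<in> K" "v \<in> K" and s: "u \<le> s \<and> s \<le> v"
      show "s \<in> K"
      proof (cases "s < c")
        case True
        have "s \<in> J"
        proof (cases "s \<le> t1")
          case True
          then have "u \<in> J" using uv s by (auto simp: K_def)
          then show ?thesis using conv[OF _ t1(1)] s True by blast
        next
          case False
          then show ?thesis using inJ \<open>s < c\<close> t1 by auto
        qed
        then show ?thesis by (simp add: K_def)
      next
        case False
        then have "v \<notin> J" using s Jc[of v] by auto
        then show ?thesis using uv s False t1 by (auto simp: K_def)
      qed
    qed
    fix t assume t: "t \<in> K"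
    show "(z has_vector_derivative F t (z t)) (at t)"
    proof (cases "t \<in> J")
      case True
      show ?thesis
        by (rule has_vector_derivative_transform_within_open[OF _ J(1) True]) (use True dx in \<open>auto simp: z_def\<close>)
    next
      case False
      then have t': "t \<in> {t1<..<t1 + d}" using t by (auto simp: K_def)
      have "(y has_vector_derivative F t (y t)) (at t)" using t' d by (intro y(2)) auto
      then have "(z has_vector_derivative F t (y t)) (at t)"
        by (rule has_vector_derivative_transform_within_open[OF _ open_greaterThanLessThan t'])
          (use eq Jc in \<open>auto simp: z_def\<close>)
      then show ?thesis using False by (simp add: z_def)
    qed
  qed
  moreover have "J \<subseteq> K" "\<forall>t\<in>J. z t = x t" by (auto simp: K_def z_def)
  ultimately have "K = J" using max unfolding maximal_solution_def by blast
  moreover have "c \<in> K" using t1 by (simp add: K_def)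
  ultimately show False using cJ by simp
qed

subsection \<open>The matrix exponential of a skew matrix\<close>

lemma mpow_scaleR: "mpow (c *\<^sub>R A) k = c ^ k *\<^sub>R mpow A k"
  by (induction k) (simp_all add: matrix_scalar_ac scalar_matrix_assoc[symmetric] mult.commute)

text \<open>Column sums, rather than single entries, make the induction close with the crude
  constant \<open>a\<close>.\<close>

lemma mpow_entry_bound:
  fixes A :: "real^'n^'n"
  defines "a \<equiv> \<Sum>i\<in>UNIV. \<Sum>j\<in>UNIV. \<bar>A $ i $ j\<bar>"
  shows "(\<Sum>i\<in>UNIV. \<bar>mpow A k $ i $ j\<bar>) \<le> a ^ k"
proof (induction k)
  case 0
  have "(\<Sum>i\<in>UNIV. \<bar>(mat 1 :: real^'n^'n) $ i $ j\<bar>) = (\<Sum>i\<in>UNIV. if i = j then 1 else 0)"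
    by (intro sum.cong) (auto simp: mat_def)
  then show ?case by simp
next
  case (Suc k)
  have "(\<Sum>i\<in>UNIV. \<bar>mpow A (Suc k) $ i $ j\<bar>)
      \<le> (\<Sum>i\<in>UNIV. \<Sum>l\<in>UNIV. \<bar>A $ i $ l\<bar> * \<bar>mpow A k $ l $ j\<bar>)"
    by (intro sum_mono) (simp add: matrix_matrix_mult_def abs_mult[symmetric])
  also have "\<dots> \<le> (\<Sum>i\<in>UNIV. \<Sum>l\<in>UNIV. \<bar>A $ i $ l\<bar> * (\<Sum>m\<in>UNIV. \<bar>mpow A k $ m $ j\<bar>))"
    by (intro sum_mono mult_left_mono member_le_sum) auto
  also have "\<dots> = a * (\<Sum>m\<in>UNIV. \<bar>mpow A k $ m $ j\<bar>)"
    by (simp add: a_def sum_distrib_right)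
  also have "\<dots> \<le> a * a ^ k"
    by (rule mult_left_mono[OF Suc.IH]) (auto simp: a_def intro!: sum_nonneg)
  finally show ?case by simp
qed

lemma summable_mexp_entry: "summable (\<lambda>k. mpow A k $ i $ j / fact k * z ^ k)"
proof -
  define a where "a = (\<Sum>i\<in>UNIV. \<Sum>j\<in>UNIV. \<bar>A $ i $ j\<bar>)"
  have "norm (mpow A k $ i $ j / fact k * z ^ k) \<le> inverse (fact k) * (a * \<bar>z\<bar>) ^ k" for k
  proof -
    have "\<bar>mpow A k $ i $ j\<bar> \<le> (\<Sum>i\<in>UNIV. \<bar>mpow A k $ i $ j\<bar>)"
      by (rule member_le_sum) auto
    also have "\<dots> \<le> a ^ k" unfolding a_def by (rule mpow_entry_bound)
    finally have "\<bar>mpow A k $ i $ j\<bar> * (\<bar>z\<bar> ^ k / fact k) \<le> a ^ k * (\<bar>z\<bar> ^ k / fact k)"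
      by (rule mult_right_mono) simp
    then show ?thesis by (simp add: abs_mult power_abs power_mult_distrib field_simps)
  qed
  then show ?thesis
    by (rule summable_comparison_test'[OF summable_exp[of "a * \<bar>z\<bar>"], where N = 0])
qed

text \<open>This reduces the exponential to scalar power series, for which termwise differentiation
  is available.\<close>

lemma mexp_entry: "mexp (\<phi> *\<^sub>R A) $ i $ j = (\<Sum>k. mpow A k $ i $ j / fact k * \<phi> ^ k)"
proof -
  have "(\<lambda>k. (1 / fact k) *\<^sub>R mpow (\<phi> *\<^sub>R A) k) sums (\<chi> i j. \<Sum>k. mpow A k $ i $ j / fact k * \<phi> ^ k)"
    unfolding sums_def
  proof (intro vec_tendstoI)
    fix i j
    have "(\<lambda>k. mpow A k $ i $ j / fact k * \<phi> ^ k) sums (\<Sum>k. mpow A k $ i $ j / fact k * \<phi> ^ k)"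
      by (rule summable_sums[OF summable_mexp_entry])
    then show "(\<lambda>n. (\<Sum>k<n. (1 / fact k) *\<^sub>R mpow (\<phi> *\<^sub>R A) k) $ i $ j) \<longlonglongrightarrow>
        (\<chi> i j. \<Sum>k. mpow A k $ i $ j / fact k * \<phi> ^ k) $ i $ j"
      by (simp add: sums_def mpow_scaleR mult.commute)
  qed
  then show ?thesis unfolding mexp_def by (simp add: sums_iff)
qed

lemma mexp_0: "mexp (0 *\<^sub>R A) = mat 1"
proof -
  have "mexp (0 *\<^sub>R A) $ i $ j = mat 1 $ i $ j" for i j
    unfolding mexp_entry using powser_zero[of "\<lambda>k. mpow A k $ i $ j / fact k"] by simp
  then show ?thesis by (simp add: vec_eq_iff)
qed

lemma mexp_entry_deriv:
  "((\<lambda>\<phi>. mexp (\<phi> *\<^sub>R A) $ i $ j) has_real_derivative (A ** mexp (\<phi> *\<^sub>R A)) $ i $ j) (at \<phi>)"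
proof -
  have "((\<lambda>\<phi>. \<Sum>k. mpow A k $ i $ j / fact k * \<phi> ^ k) has_real_derivative
      (\<Sum>k. diffs (\<lambda>k. mpow A k $ i $ j / fact k) k * \<phi> ^ k)) (at \<phi>)"
    by (rule termdiffs_strong_converges_everywhere) (rule summable_mexp_entry)
  moreover have "diffs (\<lambda>k. mpow A k $ i $ j / fact k) k = (\<Sum>l\<in>UNIV. A $ i $ l * (mpow A k $ l $ j / fact k))" for k
  proof -
    have "diffs (\<lambda>k. mpow A k $ i $ j / fact k) k = mpow A (Suc k) $ i $ j / fact k"
      by (simp add: diffs_def del: mpow.simps of_nat_Suc)
    then show ?thesis by (simp add: matrix_matrix_mult_def sum_divide_distrib)
  qed
  moreover have "(\<Sum>k. (\<Sum>l\<in>UNIV. A $ i $ l * (mpow A k $ l $ j / fact k)) * \<phi> ^ k) = (A ** mexp (\<phi> *\<^sub>R A)) $ i $ j"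
  proof -
    have "(\<lambda>k. \<Sum>l\<in>UNIV. A $ i $ l * (mpow A k $ l $ j / fact k * \<phi> ^ k)) sums
        (\<Sum>l\<in>UNIV. A $ i $ l * mexp (\<phi> *\<^sub>R A) $ l $ j)"
      unfolding mexp_entry
      by (intro sums_sum sums_mult summable_sums summable_mexp_entry)
    then show ?thesis
      by (simp add: sums_iff matrix_matrix_mult_def sum_distrib_right mult.assoc)
  qed
  ultimately show ?thesis by (simp add: mexp_entry)
qed

lemma has_vector_derivative_vecI:
  fixes f :: "real \<Rightarrow> 'b::euclidean_space^'n"
  assumes "\<And>i. ((\<lambda>x. f x $ i) has_vector_derivative f' $ i) (at x within S)"
  shows "(f has_vector_derivative f') (at x within S)"
  unfolding has_vector_derivative_def
proof (rule has_derivative_componentwise_within[THEN iffD2], intro ballI)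
  fix b :: "'b^'n" assume "b \<in> Basis"
  then obtain i u where b: "b = axis i u" by (auto simp: Basis_vec_def)
  have "((\<lambda>x. f x $ i \<bullet> u) has_derivative (\<lambda>h. (h *\<^sub>R f' $ i) \<bullet> u)) (at x within S)"
    using assms[of i] unfolding has_vector_derivative_def by (intro has_derivative_inner_left)
  then show "((\<lambda>x. f x \<bullet> b) has_derivative (\<lambda>h. (h *\<^sub>R f') \<bullet> b)) (at x within S)"
    by (simp add: b inner_axis)
qed

lemma mexp_deriv:
  "((\<lambda>\<phi>. mexp (\<phi> *\<^sub>R A)) has_vector_derivative A ** mexp (\<phi> *\<^sub>R A)) (at \<phi>)"
  by (intro has_vector_derivative_vecI)
    (simp add: mexp_entry_deriv has_real_derivative_iff_has_vector_derivative[symmetric])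

lemma bounded_linear_matrix_vector_left: "bounded_linear (\<lambda>M :: real^'n^'m. M *v v)"
  by (simp add: linear_linear linear_iff matrix_vector_mult_add_rdistrib scaleR_matrix_vector_assoc[symmetric])

lemma mexp_vec_deriv:
  "((\<lambda>\<phi>. mexp (\<phi> *\<^sub>R A) *v v) has_vector_derivative A *v (mexp (\<phi> *\<^sub>R A) *v v)) (at \<phi>)"
  using bounded_linear.has_vector_derivative[OF bounded_linear_matrix_vector_left mexp_deriv]
  by (simp add: matrix_vector_mul_assoc)

lemma skew_inner:
  fixes A :: "real^'n^'n"
  assumes "transpose A = - A"
  shows "v \<bullet> (A *v w) = - ((A *v v) \<bullet> w)"
proof -
  have "v \<bullet> (A *v w) = (transpose A *v v) \<bullet> w"
    by (simp add: dot_lmul_matrix[symmetric] transpose_matrix_vector)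
  moreover have "(- A) *v v = - (A *v v)"
    by (simp add: matrix_vector_mult_def vec_eq_iff sum_negf)
  ultimately show ?thesis using assms by simp
qed

context
  fixes A :: "real^'n^'n"
  assumes skew: "transpose A = - A"
begin

text \<open>By skewness y and A y are orthogonal, so the squared norm has derivative 0. Besides the
  isometry \<open>norm_mexp\<close> this yields uniqueness for y' = A y: a solution starting at 0
  stays 0.\<close>

lemma skew_flow_norm:
  fixes y :: "real \<Rightarrow> real^'n"
  assumes "\<And>\<phi>. (y has_vector_derivative A *v y \<phi>) (at \<phi>)"
  shows "norm (y \<phi>) = norm (y 0)"
proof -
  have "((\<lambda>s. y s \<bullet> y s) has_real_derivative 0) (at s)" for s
  proof -
    have "((\<lambda>s. y s \<bullet> y s) has_derivative (\<lambda>h. y s \<bullet> (h *\<^sub>R (A *v y s)) + (h *\<^sub>R (A *v y s)) \<bullet> y s)) (at s)"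
      by (rule has_derivative_inner) (use assms in \<open>auto simp: has_vector_derivative_def\<close>)
    moreover have "y s \<bullet> (A *v y s) = 0" using skew_inner[OF skew, of "y s" "y s"] by (simp add: inner_commute)
    ultimately have "((\<lambda>s. y s \<bullet> y s) has_derivative (\<lambda>h. 0)) (at s)" by (simp add: inner_commute[of "A *v y s"])
    then show ?thesis unfolding has_field_derivative_def by (simp add: mult_commute_abs lambda_zero)
  qed
  then have "y \<phi> \<bullet> y \<phi> = y 0 \<bullet> y 0"
    by (intro DERIV_isconst_all[of "\<lambda>s. y s \<bullet> y s"]) blast
  then show ?thesis by (simp add: norm_eq_sqrt_inner)
qed

lemma norm_mexp: "norm (mexp (\<phi> *\<^sub>R A) *v v) = norm v"
  using skew_flow_norm[OF mexp_vec_deriv[of A v], of \<phi>] unfolding mexp_0 by simp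

text \<open>Both sides solve y' = A y in \<phi> and agree at \<phi> = 0, so their difference keeps
  the norm 0. No multiplication of series is involved.\<close>

lemma mexp_add: "mexp ((\<phi> + \<xi>) *\<^sub>R A) *v v = mexp (\<phi> *\<^sub>R A) *v (mexp (\<xi> *\<^sub>R A) *v v)"
proof -
  define w where "w = (\<lambda>\<phi>. mexp ((\<phi> + \<xi>) *\<^sub>R A) *v v - mexp (\<phi> *\<^sub>R A) *v (mexp (\<xi> *\<^sub>R A) *v v))"
  have "(w has_vector_derivative A *v w s) (at s)" for s
  proof -
    have "((\<lambda>\<phi>. mexp ((\<phi> + \<xi>) *\<^sub>R A) *v v) has_vector_derivative 1 *\<^sub>R (A *v (mexp ((s + \<xi>) *\<^sub>R A) *v v))) (at s)"
      by (rule vector_diff_chain_at[of "\<lambda>s. s + \<xi>" 1 s "\<lambda>\<phi>. mexp (\<phi> *\<^sub>R A) *v v", unfolded o_def, OF _ mexp_vec_deriv])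
        (auto intro!: derivative_eq_intros)
    then show ?thesis unfolding w_def matrix_vector_mult_diff_distrib
      by (intro has_vector_derivative_diff mexp_vec_deriv) simp
  qed
  from skew_flow_norm[OF this, of \<phi>] show ?thesis
    using mexp_0[of A] by (simp add: w_def)
qed

lemma mexp_minus_cancel: "mexp (- \<phi> *\<^sub>R A) *v (mexp (\<phi> *\<^sub>R A) *v v) = v"
  using mexp_add[of "- \<phi>" \<phi> v] mexp_0[of A] by simp

lemma mexp_minus_cancel': "mexp (\<phi> *\<^sub>R A) *v (mexp (- \<phi> *\<^sub>R A) *v v) = v"
  using mexp_minus_cancel[of "- \<phi>" v] by simp

end

subsection \<open>Spectrum of the deflated monodromy matrix\<close>

text \<open>If A B = 0 then (z - A) (z - B) = z (z - (A + B)); the claim is the determinant of this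
  identity. It allows multiplicities of eigenvalues to be counted without a Jordan form.\<close>

lemma charpoly_add:
  fixes A B :: "real^'n^'n"
  assumes "A ** B = 0"
  shows "charpoly A * charpoly B = [:0, 1:] ^ CARD('n) * charpoly (A + B)"
proof -
  define cm :: "real^'n^'n \<Rightarrow> complex poly^'n^'n" where
    "cm = (\<lambda>M. \<chi> i j. (if i = j then [:0, 1:] else 0) - [:complex_of_real (M $ i $ j):])"
  have AB: "(\<Sum>k\<in>UNIV. complex_of_real (A $ i $ k) * of_real (B $ k $ j)) = 0" for i j
  proof -
    have "(A ** B) $ i $ j = 0" using assms by simp
    then have "(\<Sum>k\<in>UNIV. A $ i $ k * B $ k $ j) = 0" by (simp add: matrix_matrix_mult_def)
    then have "complex_of_real (\<Sum>k\<in>UNIV. A $ i $ k * B $ k $ j) = 0" by simp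
    then show ?thesis by simp
  qed
  have "(cm A ** cm B) $ i $ j = (mat [:0, 1:] ** cm (A + B)) $ i $ j" for i j
  proof -
    have *: "(\<Sum>k\<in>UNIV. [:complex_of_real (A $ i $ k):] * [:of_real (B $ k $ j):]) = 0"
    proof -
      have "(\<Sum>k\<in>S. [:f k:]) = [:sum f S:]" for f :: "'n \<Rightarrow> complex" and S
        by (induction S rule: infinite_finite_induct) auto
      from this[of "\<lambda>k. complex_of_real (A $ i $ k) * of_real (B $ k $ j)" UNIV] show ?thesis
        using AB[of i j] by (simp add: mult.commute)
    qed
    have "(cm A ** cm B) $ i $ j = (\<Sum>k\<in>UNIV. (if i = k then [:0, 1:] * ((if k = j then [:0, 1:] else 0) - [:complex_of_real (B $ k $ j):]) else 0)
       - (if k = j then [:complex_of_real (A $ i $ k):] * [:0, 1:] else 0)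
       + [:complex_of_real (A $ i $ k):] * [:of_real (B $ k $ j):])"
      unfolding cm_def matrix_matrix_mult_def vec_lambda_beta
      by (intro sum.cong refl) (auto simp: algebra_simps)
    also have "\<dots> = [:0, 1:] * ((if i = j then [:0, 1:] else 0) - [:complex_of_real (B $ i $ j):])
        - [:complex_of_real (A $ i $ j):] * [:0, 1:]"
      unfolding sum.distrib sum_subtractf * by simp
    also have "\<dots> = [:0, 1:] * ((if i = j then [:0, 1:] else 0) - [:complex_of_real (A $ i $ j + B $ i $ j):])"
      by (auto simp: algebra_simps)
    also have "\<dots> = (\<Sum>k\<in>UNIV. if i = k then [:0, 1:] * cm (A + B) $ k $ j else 0)"
      by (simp add: cm_def)
    also have "\<dots> = (mat [:0, 1:] ** cm (A + B)) $ i $ j"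
      unfolding matrix_matrix_mult_def vec_lambda_beta mat_def by (intro sum.cong refl) auto
    finally show ?thesis .
  qed
  then have "cm A ** cm B = mat [:0, 1:] ** cm (A + B)" by (simp add: vec_eq_iff)
  then have "det (cm A) * det (cm B) = det (mat [:0, 1:] :: complex poly^'n^'n) * det (cm (A + B))"
    by (metis det_mul)
  moreover have "det (mat [:0, 1:] :: complex poly^'n^'n) = [:0, 1:] ^ CARD('n)"
    by (subst det_diagonal) (simp_all add: mat_def)
  ultimately show ?thesis by (simp add: charpoly_def cm_def)
qed

abbreviation cmat :: "real^'n^'m \<Rightarrow> complex^'n^'m" where
  "cmat M \<equiv> (\<chi> i j. complex_of_real (M $ i $ j))"

abbreviation cvec :: "real^'n \<Rightarrow> complex^'n" where
  "cvec v \<equiv> (\<chi> i. complex_of_real (v $ i))"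

lemma cmat_cvec: "cmat M *v cvec v = cvec (M *v v)"
  by (simp add: vec_eq_iff matrix_vector_mult_def)

lemma poly_charpoly: "poly (charpoly M) \<mu> = det (mat \<mu> - cmat M)"
  by (simp add: charpoly_def det_def poly_sum poly_prod mat_def if_distrib[of "\<lambda>p. poly p _"] cong: if_cong)

lemma charpoly_eigenvalue_1:
  assumes "M *v q = q" "q \<noteq> 0"
  shows "poly (charpoly M) 1 = 0"
proof (rule ccontr)
  assume "poly (charpoly M) 1 \<noteq> 0"
  then have "invertible (mat 1 - cmat M)" by (simp add: poly_charpoly invertible_det_nz)
  then obtain B where "B ** (mat 1 - cmat M) = mat 1" by (auto simp: invertible_def)
  moreover have "(mat 1 - cmat M) *v cvec q = 0"
    by (simp add: matrix_vector_mult_diff_rdistrib cmat_cvec assms)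
  ultimately have "cvec q = 0"
    by (metis matrix_left_invertible_ker)
  then show False using assms(2) by (simp add: vec_eq_iff)
qed

lemma affine_recursion_bound:
  fixes a :: "nat \<Rightarrow> real"
  assumes "\<And>k. a (Suc k) \<le> \<rho> * a k + c" "0 \<le> \<rho>" "\<rho> < 1"
  shows "a k \<le> \<rho> ^ k * a 0 + c * (1 - \<rho> ^ k) / (1 - \<rho>)"
proof (induction k)
  case (Suc k)
  have "a (Suc k) \<le> \<rho> * a k + c" by (rule assms)
  also have "\<dots> \<le> \<rho> * (\<rho> ^ k * a 0 + c * (1 - \<rho> ^ k) / (1 - \<rho>)) + c"
    using Suc.IH assms(2) by (intro add_right_mono mult_left_mono)
  also have "\<dots> = \<rho> ^ Suc k * a 0 + c * (1 - \<rho> ^ Suc k) / (1 - \<rho>)"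
    using assms(3) by (simp add: field_simps)
  finally show ?case .
qed simp

text \<open>Beyond some index \<open>e\<close> is below \<open>c = r / 2 * (1 - \<rho>)\<close>.
  From there on the affine recursion contributes at most c / (1 - \<rho>) = r / 2, and the transient
  takes the other half.\<close>

lemma perturbed_contraction_tendsto_0:
  fixes a e :: "nat \<Rightarrow> real"
  assumes "\<And>k. a (Suc k) \<le> \<rho> * a k + e k" "0 \<le> \<rho>" "\<rho> < 1" "\<And>k. 0 \<le> a k" "e \<longlonglongrightarrow> 0"
  shows "a \<longlonglongrightarrow> 0"
proof (rule LIMSEQ_I)
  fix r :: real assume r: "r > 0"
  define c where "c = r / 2 * (1 - \<rho>)"
  have c: "c > 0" using r assms by (simp add: c_def)
  obtain N where N: "\<And>k. k \<ge> N \<Longrightarrow> \<bar>e k\<bar> < c" using LIMSEQ_D[OF assms(5) c] by auto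
  have *: "a (N + k) \<le> \<rho> ^ k * a N + c / (1 - \<rho>)" for k
  proof -
    have "a (N + k) \<le> \<rho> ^ k * a (N + 0) + c * (1 - \<rho> ^ k) / (1 - \<rho>)"
    proof (rule affine_recursion_bound[of "\<lambda>k. a (N + k)", OF _ assms(2,3)])
      show "a (N + Suc k) \<le> \<rho> * a (N + k) + c" for k
        using assms(1)[of "N + k"] N[of "N + k"] by auto
    qed
    also have "c * (1 - \<rho> ^ k) / (1 - \<rho>) \<le> c / (1 - \<rho>)"
      using c assms by (intro divide_right_mono) (auto simp: mult_le_cancel_left1)
    finally show ?thesis by simp
  qed
  have "(\<lambda>k. \<rho> ^ k * a N) \<longlonglongrightarrow> 0"
    using tendsto_mult_right[OF LIMSEQ_power_zero[of \<rho>], of "a N"] assms by simp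
  from LIMSEQ_D[OF this, of "r / 2"] obtain N' where N': "\<And>k. k \<ge> N' \<Longrightarrow> \<bar>\<rho> ^ k * a N\<bar> < r / 2"
    using r by auto
  have cr: "c / (1 - \<rho>) = r / 2" unfolding c_def by (rule nonzero_mult_div_cancel_right) (use assms(3) in simp)
  have "a k < r" if k: "k \<ge> N + N'" for k
  proof -
    have "a k \<le> \<rho> ^ (k - N) * a N + r / 2" using *[of "k - N"] k unfolding cr by simp
    moreover have "\<bar>\<rho> ^ (k - N) * a N\<bar> < r / 2" using k by (intro N') simp
    ultimately show ?thesis by linarith
  qed
  then show "\<exists>no. \<forall>n\<ge>no. norm (a n - 0) < r" using assms(4) by auto
qed

lemma norm_vector_scalar_mult: "norm (c *s v) = norm c * norm (v :: complex^'n)"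
  by (simp add: norm_vec_def norm_mult L2_set_right_distrib)

section \<open>Powers of a complex matrix with spectrum in the open unit disc\<close>

context
  fixes C :: "complex^'n^'n"
  assumes noeig: "\<And>\<mu>. cmod \<mu> \<ge> 1 \<Longrightarrow> det (mat \<mu> - C) \<noteq> 0"
begin

text \<open>The vector p(C) v, evaluated by Horner's scheme on the vector itself.\<close>

definition pap :: "complex poly \<Rightarrow> complex^'n \<Rightarrow> complex^'n" where
  "pap p = fold_coeffs (\<lambda>a g v. a *s v + g (C *v v)) p (\<lambda>v. 0)"

lemma pap_0: "pap 0 v = 0" by (simp add: pap_def)

lemma pap_pCons: "pap (pCons a p) v = a *s v + pap p (C *v v)"
  unfolding pap_def fold_coeffs_def by (simp add: cCons_def)

lemma pap_add: "pap (p + q) v = pap p v + pap q v"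
  by (induction p q arbitrary: v rule: poly_induct2)
    (simp_all add: pap_0 pap_pCons vector_sadd_rdistrib algebra_simps)

lemma pap_smult: "pap (smult c p) v = c *s pap p v"
  by (induction p arbitrary: v) (simp_all add: pap_0 pap_pCons vector_add_ldistrib)

lemma pap_vec_add: "pap p (v + w) = pap p v + pap p w"
  by (induction p arbitrary: v w)
    (simp_all add: pap_0 pap_pCons vector_add_ldistrib matrix_vector_right_distrib algebra_simps)

lemma pap_vec_smult: "pap p (c *s v) = c *s pap p v"
  by (induction p arbitrary: v)
    (simp_all add: pap_0 pap_pCons vector_add_ldistrib vector_scalar_commute mult.commute)

lemma pap_sum: "pap (\<Sum>k\<in>S. f k) v = (\<Sum>k\<in>S. pap (f k) v)"
  by (induction S rule: infinite_finite_induct) (simp_all add: pap_0 pap_add)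

lemma pap_monom: "pap (monom c k) v = c *s ((*v) C ^^ k) v"
  by (induction k arbitrary: v) (simp_all add: monom_0 monom_Suc pap_0 pap_pCons funpow_swap1)

lemma pap_factor: "pap ([:- \<nu>, 1:] * q) v = pap q (C *v v - \<nu> *s v)"
proof -
  have "pap ([:- \<nu>, 1:] * q) v = pap (smult (- \<nu>) q + pCons 0 q) v" by simp
  also have "\<dots> = pap q (C *v v) + pap q ((- \<nu>) *s v)"
    by (simp only: pap_add pap_smult pap_pCons pap_vec_smult) simp
  also have "\<dots> = pap q (C *v v - \<nu> *s v)"
  proof -
    have "C *v v - \<nu> *s v = C *v v + (- \<nu>) *s v" by (simp add: vec_eq_iff)
    then show ?thesis by (simp only: pap_vec_add)
  qed
  finally show ?thesis .
qed

text \<open>With n the real dimension of the space, b, C b, ..., C^n b are n + 1 vectors; a linear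
  relation among them is an annihilating polynomial.\<close>

lemma annihilating_poly: "\<exists>p. p \<noteq> 0 \<and> pap p b = 0"
proof -
  define y where "y = (\<lambda>k. ((*v) C ^^ k) b)"
  define n where "n = DIM(complex^'n)"
  show ?thesis
  proof (cases "inj_on y {..n}")
    \<comment> \<open>Linear dependence is a property of the set of these vectors, in which
      repetitions collapse. A coincidence C^i b = C^j b is therefore treated apart, with the
      polynomial z^j - z^i.\<close>
    case False
    then obtain i' j' where ij': "i' \<noteq> j'" "y i' = y j'" unfolding inj_on_def by blast
    define i j where "i = min i' j'" and "j = max i' j'"
    have ij: "i < j" "y i = y j" using ij' by (auto simp: i_def j_def min_def max_def)
    let ?p = "monom 1 j + monom (- 1) i :: complex poly"
    have "coeff ?p j = 1" using ij by simp
    then have "?p \<noteq> 0" by (metis coeff_0 zero_neq_one)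
    moreover have "pap ?p b = 0" using ij by (simp add: pap_add pap_monom y_def vector_sneg_minus1[symmetric])
    ultimately show ?thesis by blast
  next
    case True
    have "dependent (y ` {..n})"
      
    proof (rule dependent_biggerset)
      have "card (y ` {..n}) = Suc n" using card_image[OF True] by simp
      then show "DIM(complex^'n) < card (y ` {..n})" unfolding n_def by (metis lessI)
    qed
    then have "\<exists>u. (\<exists>v\<in>y ` {..n}. u v \<noteq> 0) \<and> (\<Sum>v\<in>y ` {..n}. u v *\<^sub>R v) = 0"
      by (rule dependent_finite[THEN iffD1, rotated]) simp
    then obtain u k where u: "(\<Sum>v\<in>y ` {..n}. u v *\<^sub>R v) = 0" and k: "k \<le> n" "u (y k) \<noteq> 0"
      by blast
    define p where "p = (\<Sum>k\<le>n. monom (complex_of_real (u (y k))) k)"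
    have "coeff p k = u (y k)" using k by (simp add: p_def coeff_sum)
    then have "p \<noteq> 0" using k by auto
    moreover have "pap p b = (\<Sum>k\<le>n. u (y k) *\<^sub>R y k)"
      unfolding p_def pap_sum pap_monom y_def[symmetric]
      by (intro sum.cong refl) (simp add: y_def vec_eq_iff scaleR_conv_of_real[where 'a = complex])
    then have "pap p b = 0" using u by (simp add: sum.reindex[OF True])
    ultimately show ?thesis by blast
  qed
qed

lemma funpow_matrix_linear:
  "((*v) C ^^ k) (v - c *s w) = ((*v) C ^^ k) v - c *s ((*v) C ^^ k) w"
  by (induction k) (simp_all add: matrix_vector_mult_diff_distrib vector_scalar_commute)

lemma funpow_matrix_0: "((*v) C ^^ k) 0 = 0"
  by (induction k) simp_all

text \<open>The sequence y_k = C^k b satisfies y_{k+1} = \<nu> y_k + e_k with e_k tending to 0. For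
  |\<nu>| < 1 this is a perturbed contraction; for |\<nu>| \<ge> 1 the matrix \<nu> - C is
  invertible, and y_k is recovered from e_k by a fixed linear map.\<close>

lemma tendsto_0_step:
  assumes "(\<lambda>k. ((*v) C ^^ k) (C *v b - \<nu> *s b)) \<longlonglongrightarrow> 0"
  shows "(\<lambda>k. ((*v) C ^^ k) b) \<longlonglongrightarrow> 0"
proof -
  define y where "y = (\<lambda>k. ((*v) C ^^ k) b)"
  have y: "((*v) C ^^ k) (C *v b - \<nu> *s b) = C *v y k - \<nu> *s y k" for k
    unfolding funpow_matrix_linear y_def by (simp add: funpow_swap1)
  have ySuc: "y (Suc k) = C *v y k" for k by (simp add: y_def)
  have lim: "(\<lambda>k. C *v y k - \<nu> *s y k) \<longlonglongrightarrow> 0" using assms unfolding y .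
  show ?thesis
  proof (cases "cmod \<nu> < 1")
    case True
    have "(\<lambda>k. norm (y k)) \<longlonglongrightarrow> 0"
    proof (rule perturbed_contraction_tendsto_0[where \<rho> = "cmod \<nu>" and e = "\<lambda>k. norm (C *v y k - \<nu> *s y k)"])
      show "norm (y (Suc k)) \<le> cmod \<nu> * norm (y k) + norm (C *v y k - \<nu> *s y k)" for k
        using norm_triangle_sub[of "C *v y k" "\<nu> *s y k"] by (simp add: ySuc norm_vector_scalar_mult)
    qed (use True tendsto_norm_zero[OF lim] in auto)
    then show ?thesis unfolding y_def by (rule tendsto_norm_zero_cancel)
  next
    case False
    then have "invertible (mat \<nu> - C)" using noeig by (simp add: invertible_det_nz)
    then obtain D where D: "D ** (mat \<nu> - C) = mat 1" by (auto simp: invertible_def)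
    have "D *v (C *v y k - \<nu> *s y k) = - y k" for k
    proof -
      have "mat \<nu> *v y k = \<nu> *s y k"
        by (simp add: vec_eq_iff matrix_vector_mult_def mat_def if_distrib[of "\<lambda>x. x * _"] cong: if_cong)
      then have "C *v y k - \<nu> *s y k = - ((mat \<nu> - C) *v y k)"
        by (simp add: matrix_vector_mult_diff_rdistrib)
      then have "D *v (C *v y k - \<nu> *s y k) = D *v (0 - ((mat \<nu> - C) *v y k))" by simp
      then show ?thesis
        unfolding matrix_vector_mult_diff_distrib by (simp add: matrix_vector_mul_assoc D)
    qed
    moreover have "(\<lambda>k. D *v (C *v y k - \<nu> *s y k)) \<longlonglongrightarrow> D *v 0"
      by (rule bounded_linear.tendsto[OF matrix_vector_mul_bounded_linear lim])
    ultimately have "(\<lambda>k. - y k) \<longlonglongrightarrow> 0" by simp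
    then show ?thesis unfolding y_def using tendsto_minus_cancel[of _ 0] by simp
  qed
qed

text \<open>Over the complex numbers an annihilating polynomial splits into linear factors, and the
  previous lemma removes one at a time. The induction starts from "C^k p(C) b tends to 0" instead of
  p(C) b = 0, since this weaker property is what remains after a factor has been removed. This takes
  the place of a Jordan form or a spectral radius argument.\<close>

lemma powers_tendsto_0: "(\<lambda>k. ((*v) C ^^ k) b) \<longlonglongrightarrow> 0"
proof -
  have "(\<lambda>k. ((*v) C ^^ k) (pap p b)) \<longlonglongrightarrow> 0 \<Longrightarrow> p \<noteq> 0 \<Longrightarrow> (\<lambda>k. ((*v) C ^^ k) b) \<longlonglongrightarrow> 0" for p
  proof (induction "degree p" arbitrary: p b)
    case 0
    then obtain c where c: "p = [:c:]" by (metis degree_0_id)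
    then have "c \<noteq> 0" using 0 by simp
    then have "b = 0 - (- (1 / c)) *s pap p b" by (simp add: c pap_pCons pap_0 vec_eq_iff)
    have "((*v) C ^^ k) b = 0 - (- (1 / c)) *s ((*v) C ^^ k) (pap p b)" for k
      by (subst \<open>b = 0 - _\<close>) (simp only: funpow_matrix_linear funpow_matrix_0)
    moreover have "(\<lambda>k. norm (0 - (- (1 / c)) *s ((*v) C ^^ k) (pap p b))) \<longlonglongrightarrow> 0"
      using tendsto_mult_left_zero[OF tendsto_norm_zero[OF 0(2)]]
      by (simp add: norm_vector_scalar_mult tendsto_mult_right_zero tendsto_norm_zero[OF 0(2)])
    ultimately show ?case by (simp add: tendsto_norm_zero_cancel)
  next
    case (Suc d)
    have "\<not> constant (poly p)" using Suc(2) by (simp add: constant_degree)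
    then obtain \<nu> where "poly p \<nu> = 0" using fundamental_theorem_of_algebra by blast
    then obtain q where q: "p = [:- \<nu>, 1:] * q" by (metis dvdE poly_eq_0_iff_dvd)
    then have q0: "q \<noteq> 0" using Suc by auto
    then have "degree p = 1 + degree q" unfolding q by (subst degree_mult_eq) auto
    then have "d = degree q" using Suc(2) by simp
    moreover have "(\<lambda>k. ((*v) C ^^ k) (pap q (C *v b - \<nu> *s b))) \<longlonglongrightarrow> 0"
      using Suc(3) unfolding q pap_factor .
    ultimately have "(\<lambda>k. ((*v) C ^^ k) (C *v b - \<nu> *s b)) \<longlonglongrightarrow> 0" using Suc(1) q0 by blast
    then show ?case by (rule tendsto_0_step)
  qed
  moreover obtain p where "p \<noteq> 0" "pap p b = 0" using annihilating_poly by blast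
  moreover from this have "(\<lambda>k. ((*v) C ^^ k) (pap p b)) \<longlonglongrightarrow> 0" by (simp add: funpow_matrix_0)
  ultimately show ?thesis by blast
qed

end

lemma norm_cvec: "norm (cvec v) = norm v"
  by (simp add: norm_vec_def)

text \<open>Pointwise convergence comes from the complexification; finitely many basis vectors make
  it uniform, which costs the dimension in \<open>c'\<close>.\<close>

lemma real_powers_small:
  fixes K :: "real^'n^'n"
  assumes "\<And>\<mu>. cmod \<mu> \<ge> 1 \<Longrightarrow> poly (charpoly K) \<mu> \<noteq> 0" "c > 0"
  shows "\<exists>N. \<forall>k\<ge>N. \<forall>b. norm (((*v) K ^^ k) b) \<le> c * norm b"
proof -
  have lin: "linear (((*v) K) ^^ k)" for k
  proof (induction k)
    case 0
    show ?case by (simp add: linear_iff)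
  next
    case (Suc k)
    show ?case unfolding funpow.simps(2) by (rule linear_compose[OF Suc matrix_vector_mul_linear])
  qed
  have lim: "(\<lambda>k. norm (((*v) K ^^ k) b)) \<longlonglongrightarrow> 0" for b
  proof -
    have "((*v) (cmat K) ^^ k) (cvec b) = cvec (((*v) K ^^ k) b)" for k
      by (induction k) (simp_all add: cmat_cvec)
    moreover have "(\<lambda>k. ((*v) (cmat K) ^^ k) (cvec b)) \<longlonglongrightarrow> 0"
      by (rule powers_tendsto_0) (use assms(1) in \<open>simp add: poly_charpoly\<close>)
    ultimately have "(\<lambda>k. norm (cvec (((*v) K ^^ k) b))) \<longlonglongrightarrow> 0" by (simp add: tendsto_norm_zero)
    then show ?thesis by (simp only: norm_cvec)
  qed
  define c' where "c' = c / DIM(real^'n)"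
  have c': "c' > 0" using assms(2) by (simp add: c'_def)
  have "eventually (\<lambda>k. \<forall>b\<in>(Basis :: (real^'n) set). norm (((*v) K ^^ k) b) < c') sequentially"
    using order_tendstoD(2)[OF lim c'] by (intro eventually_ball_finite) auto
  then obtain N where N: "\<And>k b. k \<ge> N \<Longrightarrow> b \<in> Basis \<Longrightarrow> norm (((*v) K ^^ k) b) < c'"
    by (auto simp: eventually_sequentially)
  have "norm (((*v) K ^^ k) b) \<le> c * norm b" if "k \<ge> N" for k b
  proof -
    have "((*v) K ^^ k) b = ((*v) K ^^ k) (\<Sum>i\<in>Basis. (b \<bullet> i) *\<^sub>R i)" by (simp add: euclidean_representation)
    also have "\<dots> = (\<Sum>i\<in>Basis. (b \<bullet> i) *\<^sub>R ((*v) K ^^ k) i)"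
      by (simp only: linear_sum[OF lin] linear_scale[OF lin])
    also have "norm \<dots> \<le> (\<Sum>i\<in>(Basis :: (real^'n) set). norm b * c')"
    proof (rule sum_norm_le)
      fix i :: "real^'n" assume "i \<in> Basis"
      then show "norm ((b \<bullet> i) *\<^sub>R ((*v) K ^^ k) i) \<le> norm b * c'"
        using less_imp_le[OF N[OF that]] Basis_le_norm[of i b] by (auto intro!: mult_mono)
    qed
    also have "\<dots> = c * norm b" by (simp add: c'_def)
    finally show ?thesis .
  qed
  then show ?thesis by blast
qed

lemma outer_product_mult_vec: "(\<chi> i j. (q :: real^'n) $ i * p $ j) *v v = (p \<bullet> v) *\<^sub>R q"
  by (simp add: vec_eq_iff matrix_vector_mult_def inner_vec_def sum_distrib_left mult_ac)

text \<open>K = M - Q1 - Q2 is M with the two fixed directions removed. Two uses of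
  \<open>charpoly_add\<close> show that the product of the characteristic polynomials of K, Q1 and
  Q2 is z^(2n) times that of M. At 1 this has a zero of order 2, to which Q1 and Q2 contribute at
  least one each, so 1 is no eigenvalue of K; all other eigenvalues lie inside the unit
  disc.\<close>

theorem deflated_monodromy_powers_small:
  fixes M :: "real^'n^'n"
  assumes M: "order 1 (charpoly M) = 2" "\<And>\<mu>. poly (charpoly M) \<mu> = 0 \<Longrightarrow> \<mu> \<noteq> 1 \<Longrightarrow> cmod \<mu> < 1"
    and fix_q: "M *v q1 = q1" "M *v q2 = q2"
    and fix_p: "\<And>v. p1 \<bullet> (M *v v) = p1 \<bullet> v" "\<And>v. p2 \<bullet> (M *v v) = p2 \<bullet> v"
    and dual: "p1 \<bullet> q1 = 1" "p1 \<bullet> q2 = 0" "p2 \<bullet> q1 = 0" "p2 \<bullet> q2 = 1"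
    and "c > 0"
  shows "\<exists>N. \<forall>k\<ge>N. \<forall>v. norm (((*v) M ^^ k) v - (p1 \<bullet> v) *\<^sub>R q1 - (p2 \<bullet> v) *\<^sub>R q2) \<le> c * norm v"
proof -
  define Q1 :: "real^'n^'n" where "Q1 = (\<chi> i j. q1 $ i * p1 $ j)"
  define Q2 :: "real^'n^'n" where "Q2 = (\<chi> i j. q2 $ i * p2 $ j)"
  have Q1v: "Q1 *v v = (p1 \<bullet> v) *\<^sub>R q1" and Q2v: "Q2 *v v = (p2 \<bullet> v) *\<^sub>R q2" for v
    by (simp_all add: Q1_def Q2_def outer_product_mult_vec)
  define K where "K = M - (Q1 + Q2)"
  have Kv: "K *v v = M *v v - (p1 \<bullet> v) *\<^sub>R q1 - (p2 \<bullet> v) *\<^sub>R q2" for v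
    by (simp add: K_def matrix_vector_mult_diff_rdistrib matrix_vector_mult_add_rdistrib Q1v Q2v)
  have "Q1 ** Q2 = 0"
    by (simp add: matrix_eq matrix_vector_mul_assoc[symmetric] Q1v Q2v dual)
  then have c1: "charpoly Q1 * charpoly Q2 = [:0, 1:] ^ CARD('n) * charpoly (Q1 + Q2)"
    by (rule charpoly_add)
  have "K ** (Q1 + Q2) = 0"
    by (simp add: matrix_eq matrix_vector_mul_assoc[symmetric] Kv matrix_vector_mult_add_rdistrib Q1v Q2v dual
      matrix_vector_right_distrib matrix_vector_mult_scaleR fix_q inner_add_right)
  then have c2: "charpoly K * charpoly (Q1 + Q2) = [:0, 1:] ^ CARD('n) * charpoly M"
    using charpoly_add[of K "Q1 + Q2"] by (simp add: K_def)
  have prod: "charpoly K * (charpoly Q1 * charpoly Q2) = [:0, 1:] ^ (2 * CARD('n)) * charpoly M"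
    unfolding c1 mult.left_commute[of "charpoly K"] c2 by (simp add: power_add[symmetric] mult.assoc[symmetric] mult_2)
  \<comment> \<open>The zero polynomial would vanish at 2, which the bound on the roots other than 1
    excludes.\<close>
  have M0: "charpoly M \<noteq> 0" using M(2)[of 2] by auto
  have X0: "poly ([:0, 1:] ^ (2 * CARD('n)) :: complex poly) \<mu> = \<mu> ^ (2 * CARD('n))" for \<mu>
    by (simp add: poly_power)
  then have X0': "[:0, 1:] ^ (2 * CARD('n)) \<noteq> (0 :: complex poly)" by auto
  have nz: "charpoly K * (charpoly Q1 * charpoly Q2) \<noteq> 0" unfolding prod using M0 X0' by simp
  have ord: "order 1 (charpoly K) + (order 1 (charpoly Q1) + order 1 (charpoly Q2)) = 2"
  proof -
    have "order 1 (charpoly K * (charpoly Q1 * charpoly Q2)) = order 1 ([:0, 1:] ^ (2 * CARD('n)) * charpoly M)"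
      by (simp only: prod)
    moreover have "order 1 ([:0, 1:] ^ (2 * CARD('n)) :: complex poly) = 0"
      by (rule order_0I) (simp add: X0)
    moreover have "[:0, 1:] ^ (2 * CARD('n)) * charpoly M \<noteq> 0" using M0 X0' by simp
    ultimately have "order 1 (charpoly K * (charpoly Q1 * charpoly Q2)) = 2"
      by (simp add: order_mult M(1))
    then show ?thesis using nz by (simp add: order_mult)
  qed
  have "q1 \<noteq> 0" "q2 \<noteq> 0" using dual by auto
  then have "poly (charpoly Q1) 1 = 0" "poly (charpoly Q2) 1 = 0"
    using charpoly_eigenvalue_1[of Q1 q1] charpoly_eigenvalue_1[of Q2 q2] by (simp_all add: Q1v Q2v dual)
  then have "order 1 (charpoly Q1) \<noteq> 0" "order 1 (charpoly Q2) \<noteq> 0"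
    using nz by (auto simp: order_root)
  then have "order 1 (charpoly K) = 0" using ord by linarith
  then have K1: "poly (charpoly K) 1 \<noteq> 0" using nz by (auto simp: order_root)
  have "poly (charpoly K) \<mu> \<noteq> 0" if "cmod \<mu> \<ge> 1" for \<mu>
  proof (cases "\<mu> = 1")
    case False
    have "poly (charpoly K * (charpoly Q1 * charpoly Q2)) \<mu> = \<mu> ^ (2 * CARD('n)) * poly (charpoly M) \<mu>"
      unfolding prod by (simp add: X0)
    moreover have "poly (charpoly M) \<mu> \<noteq> 0" using M(2)[of \<mu>] False that by auto
    moreover have "\<mu> \<noteq> 0" using that by auto
    ultimately show ?thesis by auto
  qed (use K1 in simp)
  then obtain N where N: "\<And>k b. k \<ge> N \<Longrightarrow> norm (((*v) K ^^ k) b) \<le> c * norm b"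
    using real_powers_small[of K c] \<open>c > 0\<close> by blast
  have fpow: "p1 \<bullet> ((*v) M ^^ k) v = p1 \<bullet> v" "p2 \<bullet> ((*v) M ^^ k) v = p2 \<bullet> v" for k v
    by (induction k) (simp_all add: fix_p)
  have "((*v) K ^^ Suc k) v = ((*v) M ^^ Suc k) v - (p1 \<bullet> v) *\<^sub>R q1 - (p2 \<bullet> v) *\<^sub>R q2" for k v
  proof (induction k)
    case 0
    then show ?case by (simp add: Kv)
  next
    case (Suc k)
    have "((*v) K ^^ Suc (Suc k)) v = K *v (((*v) M ^^ Suc k) v - (p1 \<bullet> v) *\<^sub>R q1 - (p2 \<bullet> v) *\<^sub>R q2)"
      by (subst funpow.simps(2), subst o_apply, subst Suc.IH) simp
    also have "\<dots> = M *v ((*v) M ^^ Suc k) v - (p1 \<bullet> v) *\<^sub>R q1 - (p2 \<bullet> v) *\<^sub>R q2"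
      unfolding Kv matrix_vector_mult_diff_distrib matrix_vector_mult_scaleR fix_q inner_diff_right inner_scaleR_right fpow dual
      by simp
    finally show ?case by simp
  qed
  note KS = this
  have "norm (((*v) M ^^ k) v - (p1 \<bullet> v) *\<^sub>R q1 - (p2 \<bullet> v) *\<^sub>R q2) \<le> c * norm v" if k: "k \<ge> Suc N" for k v
  proof -
    \<comment> \<open>\<open>KS\<close> concerns positive exponents: for exponent 0 the left side is
      v, while the right side lacks the neutral part of v. Hence the threshold
      \<open>Suc N\<close>.\<close>
    obtain j where j: "k = Suc j" using k by (cases k) auto
    show ?thesis using N[of k v] k unfolding j KS by linarith
  qed
  then show ?thesis by (intro exI[of _ "Suc N"] allI impI)
qed

subsection \<open>Periodic and continuously differentiable maps\<close>

lemma periodic_2pi_int: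
  assumes "\<And>x. F (x + 2 * pi) = F x"
  shows "F (x + of_int k * (2 * pi)) = F x"
proof -
  have nat: "F (y + real n * (2 * pi)) = F y" for n y
  proof (induction n)
    case (Suc n)
    have "F (y + real (Suc n) * (2 * pi)) = F ((y + real n * (2 * pi)) + 2 * pi)"
      by (simp add: algebra_simps)
    also have "\<dots> = F y" using Suc by (simp only: assms)
    finally show ?case .
  qed simp
  show ?thesis
  proof (cases k)
    case (nonneg n)
    then show ?thesis using nat[of x n] by simp
  next
    case (neg n)
    then have "real_of_int k = - real (Suc n)" by simp
    then have "x + of_int k * (2 * pi) + real (Suc n) * (2 * pi) = x" by (simp only:)
    then show ?thesis using nat[of "x + of_int k * (2 * pi)" "Suc n"] by (simp only:)
  qed
qed

lemma reduce_mod_2pi: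
  obtains k :: int where "x + of_int k * (2 * pi) \<in> {0..<2 * pi}"
proof
  let ?k = "- \<lfloor>x / (2 * pi)\<rfloor>"
  have "of_int \<lfloor>x / (2 * pi)\<rfloor> \<le> x / (2 * pi)" "x / (2 * pi) < of_int \<lfloor>x / (2 * pi)\<rfloor> + 1"
    by linarith+
  then have "of_int \<lfloor>x / (2 * pi)\<rfloor> * (2 * pi) \<le> x" "x < (of_int \<lfloor>x / (2 * pi)\<rfloor> + 1) * (2 * pi)"
    using pi_gt_zero by (simp_all only: pos_le_divide_eq pos_divide_less_eq mult_pos_pos zero_less_numeral)
  then show "x + of_int ?k * (2 * pi) \<in> {0..<2 * pi}"
    by (simp add: algebra_simps)
qed

lemma C_smooth_Suc_has_derivative:
  "C_smooth (Suc k) f \<Longrightarrow> (f has_derivative frechet_derivative f (at x)) (at x)"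
  by (simp add: frechet_derivative_works)

lemma C_smooth_continuous: "C_smooth k f \<Longrightarrow> continuous_on UNIV f"
  by (cases k) (auto intro!: differentiable_imp_continuous_on simp: differentiable_on_def
      intro: differentiable_at_imp_differentiable_on differentiable_at_withinI)

lemma C_smooth_Suc_continuous:
  "C_smooth (Suc k) f \<Longrightarrow> continuous_on UNIV (\<lambda>x. frechet_derivative f (at x) v)"
  by (auto intro: C_smooth_continuous)

lemma linear_norm_le_Basis:
  fixes L :: "'a::euclidean_space \<Rightarrow> 'b::real_normed_vector"
  assumes "linear L" "\<And>b. b \<in> Basis \<Longrightarrow> norm (L b) \<le> c"
  shows "norm (L v) \<le> (real DIM('a) * c) * norm v"
proof -
  have "L v = (\<Sum>b\<in>Basis. (v \<bullet> b) *\<^sub>R L b)"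
    by (metis (no_types, lifting) assms(1) euclidean_representation linear_scale linear_sum sum.cong)
  also have "norm \<dots> \<le> (\<Sum>b\<in>(Basis :: 'a set). norm v * c)"
    by (rule sum_norm_le) (auto intro!: mult_mono Basis_le_norm assms)
  finally show ?thesis by (simp add: mult_ac)
qed

text \<open>\<open>C_smooth\<close> provides continuity of each directional derivative separately.
  Expansion in a basis upgrades this to uniform estimates linear in the direction and to joint
  continuity.\<close>

locale C1_map =
  fixes f :: "'a::euclidean_space \<Rightarrow> 'b::real_normed_vector" and D :: "'a \<Rightarrow> 'a \<Rightarrow> 'b"
  assumes has_derivative: "(f has_derivative D x) (at x)"
    and continuous: "continuous_on UNIV (\<lambda>x. D x v)"
begin

lemma linear: "linear (D x)"
  using has_derivative has_derivative_linear by blast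

lemma uniformly_continuous_derivative:
  assumes "compact K" "\<eta> > 0"
  obtains r where "r > 0" "\<And>x y v. x \<in> K \<Longrightarrow> y \<in> K \<Longrightarrow> dist x y < r \<Longrightarrow> norm (D x v - D y v) \<le> \<eta> * norm v"
proof -
  define e where "e = \<eta> / real DIM('a)"
  have e: "e > 0" using assms by (simp add: e_def)
  have "\<exists>r>0. \<forall>x\<in>K. \<forall>y\<in>K. dist x y < r \<longrightarrow> dist (D x b) (D y b) < e" for b
    using compact_uniformly_continuous[OF continuous_on_subset[OF continuous subset_UNIV] assms(1), of b] e
    unfolding uniformly_continuous_on_def by (metis dist_commute)
  then obtain r where r: "\<And>b. r b > 0"
    "\<And>b x y. x \<in> K \<Longrightarrow> y \<in> K \<Longrightarrow> dist x y < r b \<Longrightarrow> dist (D x b) (D y b) < e"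
    by metis
  show thesis
  proof (rule that[of "Min (r ` Basis)"])
    show "Min (r ` Basis) > 0" using r(1) by simp
    fix x y :: 'a and v assume xy: "x \<in> K" "y \<in> K" "dist x y < Min (r ` Basis)"
    have "norm ((\<lambda>v. D x v - D y v) v) \<le> (real DIM('a) * e) * norm v"
    proof (rule linear_norm_le_Basis)
      show "linear (\<lambda>v. D x v - D y v)" using linear_compose_sub[OF linear linear] .
      fix b :: 'a assume "b \<in> Basis"
      then have "dist x y < r b" using xy(3) by simp
      from r(2)[OF xy(1,2) this] show "norm (D x b - D y b) \<le> e" by (simp add: dist_norm)
    qed
    then show "norm (D x v - D y v) \<le> \<eta> * norm v" by (simp add: e_def)
  qed
qed

lemma uniformly_differentiable:
  assumes "\<eta> > 0"
  obtains r where "r > 0" "\<And>x h. norm x \<le> R \<Longrightarrow> norm h \<le> r \<Longrightarrow> norm (f (x + h) - f x - D x h) \<le> \<eta> * norm h"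
proof -
  obtain r where r: "r > 0"
    "\<And>x y v. x \<in> cball 0 (R + 1) \<Longrightarrow> y \<in> cball 0 (R + 1) \<Longrightarrow> dist x y < r \<Longrightarrow> norm (D x v - D y v) \<le> \<eta> * norm v"
    using uniformly_continuous_derivative[OF compact_cball assms] by metis
  show thesis
  proof (rule that[of "min 1 (r / 2)"])
    fix x h :: 'a assume x: "norm x \<le> R" and h: "norm h \<le> min 1 (r / 2)"
    have "norm (f (x + h) - f x - D x (x + h - x)) \<le> norm (x + h - x) * \<eta>"
    proof (rule differentiable_bound_linearization[where S = "cball x (norm h)"])
      show "x + t *\<^sub>R (x + h - x) \<in> cball x (norm h)" if "t \<in> {0..1}" for t
        using that by (simp add: dist_norm mult_left_le_one_le)
      show "(f has_derivative D y) (at y within cball x (norm h))" for y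
        using has_derivative by (rule has_derivative_at_withinI)
      show "onorm (D y - D x) \<le> \<eta>" if "y \<in> cball x (norm h)" for y
      proof (rule onorm_bound)
        fix v
        have d: "dist y x \<le> norm h" using that by (simp add: dist_commute)
        then have "norm y \<le> R + 1" using norm_triangle_sub[of y x] x h by (auto simp: dist_norm)
        moreover have "dist y x < r" using d h r(1) by auto
        ultimately show "norm ((D y - D x) v) \<le> \<eta> * norm v" using x r(2)[of y x v] by auto
      qed (use assms in auto)
    qed auto
    then show "norm (f (x + h) - f x - D x h) \<le> \<eta> * norm h" by (simp add: mult.commute)
  qed (use r in auto)
qed

lemma derivative_bounded:
  obtains c where "c > 0" "\<And>x v. norm x \<le> R \<Longrightarrow> norm (D x v) \<le> c * norm v"
proof -
  have "\<exists>c>0. \<forall>x\<in>cball 0 R. norm (D x b) \<le> c" for b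
  proof -
    have "compact ((\<lambda>x. D x b) ` cball 0 R)"
      by (intro compact_continuous_image continuous_on_subset[OF continuous]) auto
    then show ?thesis using compact_imp_bounded bounded_pos by (metis image_eqI)
  qed
  then obtain c where c: "\<And>b. c b > 0" "\<And>b x. norm x \<le> R \<Longrightarrow> norm (D x b) \<le> c b"
    by (metis mem_cball_0)
  show thesis
  proof (rule that[of "real DIM('a) * Max (c ` Basis)"])
    obtain b :: 'a where "b \<in> Basis" using nonempty_Basis by blast
    then have "Max (c ` Basis) > 0" by (intro less_le_trans[OF c(1)[of b] Max_ge]) auto
    then show "real DIM('a) * Max (c ` Basis) > 0" by simp
    fix x v assume "norm (x :: 'a) \<le> R"
    then show "norm (D x v) \<le> real DIM('a) * Max (c ` Basis) * norm v"
      by (intro linear_norm_le_Basis[OF linear] order_trans[OF c(2) Max_ge]) auto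
  qed
qed

lemma lipschitz_on_ball:
  obtains c where "c > 0" "\<And>x y. norm x \<le> R \<Longrightarrow> norm y \<le> R \<Longrightarrow> norm (f x - f y) \<le> c * norm (x - y)"
proof -
  obtain c where c: "c > 0" "\<And>x v. norm x \<le> R \<Longrightarrow> norm (D x v) \<le> c * norm v"
    using derivative_bounded by metis
  show thesis
  proof (rule that[OF c(1)])
    fix x y :: 'a assume xy: "norm x \<le> R" "norm y \<le> R"
    show "norm (f x - f y) \<le> c * norm (x - y)"
    proof (rule differentiable_bound[of "cball 0 R"])
      show "(f has_derivative D y) (at y within cball 0 R)" for y
        using has_derivative by (rule has_derivative_at_withinI)
      show "onorm (D y) \<le> c" if "y \<in> cball 0 R" for y
        by (rule onorm_bound) (use c that in auto)
    qed (use xy in auto)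
  qed
qed

lemma continuous_f: "continuous_on S f"
  using has_derivative has_derivative_continuous continuous_at_imp_continuous_on by blast

lemma jointly_continuous: "continuous_on UNIV (\<lambda>(x, v). D x v)"
proof -
  have "(\<lambda>(x, v). D x v) = (\<lambda>z. \<Sum>b\<in>Basis. (snd z \<bullet> b) *\<^sub>R D (fst z) b)"
  proof
    fix z :: "'a \<times> 'a"
    have "D (fst z) (snd z) = D (fst z) (\<Sum>b\<in>Basis. (snd z \<bullet> b) *\<^sub>R b)" by (simp add: euclidean_representation)
    then show "(case z of (x, v) \<Rightarrow> D x v) = (\<Sum>b\<in>Basis. (snd z \<bullet> b) *\<^sub>R D (fst z) b)"
      by (simp only: linear_sum[OF linear] linear_scale[OF linear] case_prod_beta)
  qed
  moreover have "continuous_on UNIV (\<lambda>z :: 'a \<times> 'a. D (fst z) b)" for b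
    by (rule continuous_on_compose2[OF continuous]) (auto intro: continuous_intros)
  ultimately show ?thesis by (auto intro!: continuous_intros)
qed

end

lemma C_smooth_C1_map: "C_smooth (Suc k) f \<Longrightarrow> C1_map f (\<lambda>x. frechet_derivative f (at x))"
  by unfold_locales (simp_all only: C_smooth_Suc_has_derivative C_smooth_Suc_continuous)

lemma doubly_periodic_uniform:
  fixes G :: "'a::euclidean_space \<times> real \<times> real \<Rightarrow> 'b::metric_space"
  assumes cont: "continuous_on UNIV G"
    and per: "\<And>x \<psi> \<phi>. G (x, \<psi> + 2 * pi, \<phi>) = G (x, \<psi>, \<phi>)" "\<And>x \<psi> \<phi>. G (x, \<psi>, \<phi> + 2 * pi) = G (x, \<psi>, \<phi>)"
    and "\<eta> > 0"
  obtains r where "r > 0" "\<And>x y \<psi> \<psi>' \<phi> \<phi>'. norm x \<le> R \<Longrightarrow> norm y \<le> R \<Longrightarrow> dist x y < r \<Longrightarrow> \<bar>\<psi> - \<psi>'\<bar> < r \<Longrightarrow>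
    \<bar>\<phi> - \<phi>'\<bar> < r \<Longrightarrow> dist (G (x, \<psi>, \<phi>)) (G (y, \<psi>', \<phi>')) < \<eta>"
proof -
  \<comment> \<open>One period with a margin of 1 on both sides: the first point is moved into one
    period and the second by the same shift, and their phases differ by less than 1.\<close>
  define K :: "('a \<times> real \<times> real) set" where "K = cball 0 R \<times> {-1..2 * pi + 1} \<times> {-1..2 * pi + 1}"
  have "compact K" unfolding K_def by (intro compact_Times) auto
  then have "uniformly_continuous_on K G"
    by (rule compact_uniformly_continuous[OF continuous_on_subset[OF cont subset_UNIV]])
  then obtain r where r: "r > 0" "\<And>z z'. z \<in> K \<Longrightarrow> z' \<in> K \<Longrightarrow> dist z z' < r \<Longrightarrow> dist (G z) (G z') < \<eta>"
    using \<open>\<eta> > 0\<close> unfolding uniformly_continuous_on_def by (metis dist_commute)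
  show thesis
  proof (rule that[of "min 1 (r / 3)"])
    fix x y :: 'a and \<psi> \<psi>' \<phi> \<phi>' :: real
    assume x: "norm x \<le> R" and y: "norm y \<le> R" and d: "dist x y < min 1 (r / 3)"
      "\<bar>\<psi> - \<psi>'\<bar> < min 1 (r / 3)" "\<bar>\<phi> - \<phi>'\<bar> < min 1 (r / 3)"
    obtain k where k: "\<psi> + of_int k * (2 * pi) \<in> {0..<2 * pi}" by (rule reduce_mod_2pi)
    obtain l where l: "\<phi> + of_int l * (2 * pi) \<in> {0..<2 * pi}" by (rule reduce_mod_2pi)
    have red: "G (z, \<theta>, \<xi>) = G (z, \<theta> + of_int k * (2 * pi), \<xi> + of_int l * (2 * pi))" for z \<theta> \<xi>
      using periodic_2pi_int[of "\<lambda>\<theta>. G (z, \<theta>, \<xi>)" \<theta> k] periodic_2pi_int[of "\<lambda>\<xi>. G (z, \<theta> + of_int k * (2 * pi), \<xi>)" \<xi> l] per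
      by simp
    have "dist (x, \<psi> + of_int k * (2 * pi), \<phi> + of_int l * (2 * pi)) (y, \<psi>' + of_int k * (2 * pi), \<phi>' + of_int l * (2 * pi))
        \<le> dist x y + (\<bar>\<psi> - \<psi>'\<bar> + \<bar>\<phi> - \<phi>'\<bar>)"
      unfolding dist_Pair_Pair
      by (intro order_trans[OF sqrt_sum_squares_le_sum] add_mono order_refl) (auto simp: dist_real_def)
    also have "\<dots> < r" using d by simp
    finally have "dist (G (x, \<psi> + of_int k * (2 * pi), \<phi> + of_int l * (2 * pi)))
        (G (y, \<psi>' + of_int k * (2 * pi), \<phi>' + of_int l * (2 * pi))) < \<eta>"
      using x y d k l by (intro r(2)) (auto simp: K_def)
    then show "dist (G (x, \<psi>, \<phi>)) (G (y, \<psi>', \<phi>')) < \<eta>"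
      by (simp only: red[of x \<psi> \<phi>] red[of y \<psi>' \<phi>'])
  qed (use r in auto)
qed

lemma doubly_periodic_bounded:
  fixes G :: "'a::euclidean_space \<times> real \<times> real \<Rightarrow> 'b::real_normed_vector"
  assumes cont: "continuous_on UNIV G"
    and per: "\<And>x \<psi> \<phi>. G (x, \<psi> + 2 * pi, \<phi>) = G (x, \<psi>, \<phi>)" "\<And>x \<psi> \<phi>. G (x, \<psi>, \<phi> + 2 * pi) = G (x, \<psi>, \<phi>)"
  obtains M where "M > 0" "\<And>x \<psi> \<phi>. norm x \<le> R \<Longrightarrow> norm (G (x, \<psi>, \<phi>)) \<le> M"
proof -
  define K :: "('a \<times> real \<times> real) set" where "K = cball 0 R \<times> {0..2 * pi} \<times> {0..2 * pi}"
  have "compact (G ` K)"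
    unfolding K_def by (intro compact_continuous_image continuous_on_subset[OF cont] compact_Times) auto
  then obtain M where M: "M > 0" "\<And>z. z \<in> K \<Longrightarrow> norm (G z) \<le> M"
    using compact_imp_bounded bounded_pos by (metis image_eqI)
  show thesis
  proof (rule that[OF M(1)])
    fix x :: 'a and \<psi> \<phi> assume x: "norm x \<le> R"
    obtain k where k: "\<psi> + of_int k * (2 * pi) \<in> {0..<2 * pi}" by (rule reduce_mod_2pi)
    obtain l where l: "\<phi> + of_int l * (2 * pi) \<in> {0..<2 * pi}" by (rule reduce_mod_2pi)
    have "G (x, \<psi>, \<phi>) = G (x, \<psi> + of_int k * (2 * pi), \<phi> + of_int l * (2 * pi))"
      using periodic_2pi_int[of "\<lambda>\<theta>. G (x, \<theta>, \<phi>)" \<psi> k] periodic_2pi_int[of "\<lambda>\<xi>. G (x, \<psi> + of_int k * (2 * pi), \<xi>)" \<phi> l] per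
      by simp
    then show "norm (G (x, \<psi>, \<phi>)) \<le> M" using M(2) x k l by (auto simp: K_def)
  qed
qed

lemma periodic_bounded:
  fixes F :: "real \<Rightarrow> 'b::real_normed_vector"
  assumes "continuous_on UNIV F" "\<And>x. F (x + 2 * pi) = F x"
  obtains M where "M > 0" "\<And>x. norm (F x) \<le> M"
proof -
  have "compact (F ` {0..2 * pi})"
    by (intro compact_continuous_image continuous_on_subset[OF assms(1)]) auto
  then obtain M where M: "M > 0" "\<And>x. x \<in> {0..2 * pi} \<Longrightarrow> norm (F x) \<le> M"
    using compact_imp_bounded bounded_pos by (metis image_eqI)
  show thesis
  proof (rule that[OF M(1)])
    fix x
    obtain k where k: "x + of_int k * (2 * pi) \<in> {0..<2 * pi}" by (rule reduce_mod_2pi)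
    then show "norm (F x) \<le> M"
      using M(2)[of "x + of_int k * (2 * pi)"] periodic_2pi_int[of F x k, OF assms(2)] by simp
  qed
qed

lemma periodic_uniformly_continuous:
  fixes F :: "real \<Rightarrow> 'b::real_normed_vector"
  assumes "continuous_on UNIV F" "\<And>x. F (x + 2 * pi) = F x" "\<eta> > 0"
  obtains r where "r > 0" "\<And>x y. \<bar>x - y\<bar> \<le> r \<Longrightarrow> norm (F x - F y) \<le> \<eta>"
proof -
  \<comment> \<open>\<open>F\<close> is read as a function of three variables that depends on the
    middle one only, so that the uniform statement above applies.\<close>
  have c: "continuous_on UNIV (\<lambda>z :: real \<times> real \<times> real. F (fst (snd z)))"
    by (rule continuous_on_compose2[OF assms(1)]) (auto intro!: continuous_intros)
  obtain r where r: "r > 0" "\<And>x y :: real. \<And>\<psi> \<psi>' \<phi> \<phi>'. norm x \<le> 1 \<Longrightarrow> norm y \<le> 1 \<Longrightarrow> dist x y < r \<Longrightarrow> \<bar>\<psi> - \<psi>'\<bar> < r \<Longrightarrow>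
      \<bar>\<phi> - \<phi>'\<bar> < r \<Longrightarrow> dist (F (fst (snd (x, \<psi>, \<phi> :: real)))) (F (fst (snd (y, \<psi>', \<phi>')))) < \<eta>"
    by (rule doubly_periodic_uniform[OF c _ _ assms(3), of 1]) (auto simp: assms(2))
  show thesis
  proof (rule that[of "r / 2"])
    fix x y :: real assume "\<bar>x - y\<bar> \<le> r / 2"
    then show "norm (F x - F y) \<le> \<eta>" using r(2)[of 0 0 x y 0 0] r(1) by (simp add: dist_norm)
  qed (use r in auto)
qed

section \<open>Integrals of periodic functions\<close>

lemma continuous_antiderivative:
  fixes k :: "real \<Rightarrow> real"
  assumes "continuous_on UNIV k"
  obtains P where "\<And>x. (P has_real_derivative k x) (at x)"
    "\<And>a b. a \<le> b \<Longrightarrow> integral {a..b} k = P b - P a"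
proof -
  \<comment> \<open>The oriented integral from 0 to \<open>x\<close>: for either sign of
    \<open>x\<close> one of the two intervals is empty or a single point.\<close>
  define P where "P = (\<lambda>x. integral {0..x} k - integral {x..0} k)"
  have int: "k integrable_on {a..b}" for a b
    by (rule integrable_continuous_real[OF continuous_on_subset[OF assms]]) simp
  have P: "P x = integral {- N..x} k - integral {- N..0} k" if "- N \<le> x" "0 \<le> N" for x N
  proof (cases "0 \<le> x")
    case True
    then show ?thesis using Henstock_Kurzweil_Integration.integral_combine[of "-N" 0 x k] that int
      by (cases "x = 0") (auto simp: P_def)
  next
    case False
    then show ?thesis using Henstock_Kurzweil_Integration.integral_combine[of "-N" x 0 k] that int
      by (auto simp: P_def)
  qed
  have dP: "(P has_real_derivative k x) (at x)" for x
  proof -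
    define N where "N = \<bar>x\<bar> + 1"
    have x: "x \<in> {- N<..<N}" by (auto simp: N_def)
    have "((\<lambda>x. integral {- N..x} k) has_real_derivative k x) (at x within {- N..N})"
      using x by (intro integral_has_real_derivative continuous_on_subset[OF assms]) auto
    moreover have "at x within {- N..N} = at x" using x by (intro at_within_interior) auto
    ultimately have "((\<lambda>x. integral {- N..x} k - integral {- N..0} k) has_real_derivative k x) (at x)"
      by (auto intro!: derivative_eq_intros)
    then show ?thesis
      by (rule has_field_derivative_transform_within_open[OF _ open_greaterThanLessThan x])
        (use P[of N] in \<open>auto simp: N_def\<close>)
  qed
  moreover have "integral {a..b} k = P b - P a" if "a \<le> b" for a b
  proof -
    have "(k has_integral (P b - P a)) {a..b}"
      using dP that by (intro fundamental_theorem_of_calculus)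
        (auto simp: has_real_derivative_iff_has_vector_derivative[symmetric] intro: has_field_derivative_at_within)
    then show ?thesis by (rule integral_unique)
  qed
  ultimately show thesis by (rule that)
qed

lemma integral_affine_substitution:
  fixes k :: "real \<Rightarrow> real"
  assumes "continuous_on UNIV k" "\<omega> > 0" "a \<le> b"
  shows "integral {a..b} (\<lambda>s. k (c + \<omega> * s)) = integral {c + \<omega> * a..c + \<omega> * b} k / \<omega>"
proof -
  obtain P where P: "\<And>x. (P has_real_derivative k x) (at x)" "\<And>a b. a \<le> b \<Longrightarrow> integral {a..b} k = P b - P a"
    using continuous_antiderivative[OF assms(1)] by metis
  have "((\<lambda>s. P (c + \<omega> * s) / \<omega>) has_real_derivative k (c + \<omega> * s)) (at s)" for s
    using assms(2) by (auto intro!: derivative_eq_intros DERIV_chain2[OF P(1)])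
  then have "((\<lambda>s. k (c + \<omega> * s)) has_integral (P (c + \<omega> * b) / \<omega> - P (c + \<omega> * a) / \<omega>)) {a..b}"
    using assms(3) by (intro fundamental_theorem_of_calculus)
      (auto simp: has_real_derivative_iff_has_vector_derivative[symmetric] intro: has_field_derivative_at_within)
  then show ?thesis using assms P(2)[of "c + \<omega> * a" "c + \<omega> * b"] by (simp add: integral_unique diff_divide_distrib)
qed

lemma integral_periods:
  fixes k :: "real \<Rightarrow> real"
  assumes "continuous_on UNIV k" "\<And>x. k (x + 2 * pi) = k x"
  shows "integral {c..c + real m * (2 * pi)} k = real m * integral {0..2 * pi} k"
proof -
  obtain P where P: "\<And>x. (P has_real_derivative k x) (at x)" "\<And>a b. a \<le> b \<Longrightarrow> integral {a..b} k = P b - P a"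
    using continuous_antiderivative[OF assms(1)] by metis
  have "((\<lambda>x. P (x + 2 * pi) - P x) has_real_derivative 0) (at x)" for x
    using assms(2) by (auto intro!: derivative_eq_intros DERIV_chain2[OF P(1)] P(1))
  then have *: "P (x + 2 * pi) - P x = P (0 + 2 * pi) - P 0" for x
    by (intro DERIV_isconst_all[of "\<lambda>x. P (x + 2 * pi) - P x"]) blast
  have "P (c + real m * (2 * pi)) - P c = real m * (P (2 * pi) - P 0)"
  proof (induction m)
    case (Suc m)
    have "P (c + real (Suc m) * (2 * pi)) = P ((c + real m * (2 * pi)) + 2 * pi)" by (simp add: algebra_simps)
    then show ?case using *[of "c + real m * (2 * pi)"] Suc by (simp add: algebra_simps)
  qed simp
  then show ?thesis using P(2)[of c "c + real m * (2 * pi)"] P(2)[of 0 "2 * pi"] by simp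
qed

subsection \<open>Averaging and one-way barriers\<close>

text \<open>The interval is cut into periods 2 pi / \<omega> of the fast phase. On each the slow
  variable is frozen at the left end, where the average is exact; freezing costs \<eta> for
  \<open>F\<close> and \<eta> for its mean. The incomplete last period costs at most 2 M times a
  period.\<close>

lemma fast_phase_average:
  fixes F :: "real \<Rightarrow> real \<Rightarrow> real"
  assumes cont: "continuous_on UNIV (\<lambda>(s, \<xi>). F s \<xi>)"
    and per: "\<And>s \<xi>. F s (\<xi> + 2 * pi) = F s \<xi>"
    and bd: "\<And>s \<xi>. \<bar>F s \<xi>\<bar> \<le> M"
    and osc: "\<And>s s' \<xi>. \<bar>s - s'\<bar> \<le> r \<Longrightarrow> \<bar>F s \<xi> - F s' \<xi>\<bar> \<le> \<eta>"
    and \<omega>: "\<omega> > 0" "2 * pi / \<omega> \<le> r" and S: "S \<ge> 0"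
  shows "\<bar>integral {0..S} (\<lambda>s. F s (\<xi> + \<omega> * s)) - integral {0..S} (\<lambda>s. (1 / (2 * pi)) * integral {0..2 * pi} (F s))\<bar>
    \<le> 2 * \<eta> * S + 2 * M * (2 * pi / \<omega>)"
proof -
  define \<tau> where "\<tau> = 2 * pi / \<omega>"
  have \<tau>: "\<tau> > 0" "\<tau> \<le> r" using \<omega> by (auto simp: \<tau>_def)
  define Fb where "Fb = (\<lambda>s. (1 / (2 * pi)) * integral {0..2 * pi} (F s))"
  define e where "e = (\<lambda>s. F s (\<xi> + \<omega> * s) - Fb s)"
  have contF: "continuous_on UNIV (F s)" for s
  proof -
    have "continuous_on UNIV (\<lambda>\<xi>. (s, \<xi>))"
      by (intro continuous_on_Pair continuous_on_const continuous_on_id)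
    from continuous_on_compose2[OF cont this] show ?thesis by simp
  qed
  have intF: "F s integrable_on {a..b}" for s a b
    by (rule integrable_continuous_real[OF continuous_on_subset[OF contF]]) simp
  have contF': "continuous_on UNIV (\<lambda>s. F s (\<xi> + \<omega> * s))"
  proof -
    have "continuous_on UNIV (\<lambda>s. (s, \<xi> + \<omega> * s))" by (intro continuous_intros)
    from continuous_on_compose2[OF cont this] show ?thesis by simp
  qed
  have Fb_bound: "\<bar>Fb s - Fb s'\<bar> \<le> c" if "\<And>\<xi>. \<bar>F s \<xi> - F s' \<xi>\<bar> \<le> c" for s s' c
  proof -
    have "norm (integral (cbox 0 (2 * pi)) (\<lambda>\<xi>. F s \<xi> - F s' \<xi>)) \<le> c * measure lborel (cbox 0 (2 * pi))"
      by (rule integrable_bound) (use that order_trans[OF abs_ge_zero that] in \<open>auto intro!: integrable_diff intF\<close>)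
    then have "\<bar>integral {0..2 * pi} (F s) - integral {0..2 * pi} (F s')\<bar> \<le> c * (2 * pi)"
      using integral_diff[OF intF[of s 0 "2 * pi"] intF[of s' 0 "2 * pi"]] by simp
    then show ?thesis by (simp add: Fb_def diff_divide_distrib[symmetric] pos_divide_le_eq abs_divide)
  qed
  have contFb: "continuous_on UNIV Fb"
  proof -
    have "continuous_on UNIV (\<lambda>s. integral (cbox 0 (2 * pi)) (F s))"
      by (rule integral_continuous_on_param) (rule continuous_on_subset[OF cont], simp)
    then show ?thesis unfolding Fb_def by (auto intro!: continuous_intros)
  qed
  have Mb: "\<bar>Fb s\<bar> \<le> M" for s
  proof -
    have "norm (integral (cbox 0 (2 * pi)) (F s)) \<le> M * measure lborel (cbox 0 (2 * pi))"
      by (rule integrable_bound) (use bd order_trans[OF abs_ge_zero bd] in \<open>auto intro!: intF\<close>)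
    then show ?thesis by (simp add: Fb_def pos_divide_le_eq abs_divide)
  qed
  have int_e: "e integrable_on {a..b}" for a b
    unfolding e_def
    by (intro integrable_diff integrable_continuous_real continuous_on_subset[OF contF'] continuous_on_subset[OF contFb]) auto
  have piece: "\<bar>integral {a..a + \<tau>} e\<bar> \<le> 2 * \<eta> * \<tau>" for a
  proof -
    have int2: "(\<lambda>s. F a (\<xi> + \<omega> * s)) integrable_on {a..a + \<tau>}"
      by (intro integrable_continuous_real continuous_on_compose2[OF contF]) (auto intro: continuous_intros)
    have "integral {a..a + \<tau>} (\<lambda>s. F a (\<xi> + \<omega> * s)) = integral {\<xi> + \<omega> * a..\<xi> + \<omega> * a + real 1 * (2 * pi)} (F a) / \<omega>"
      using integral_affine_substitution[OF contF \<omega>(1), of a "a + \<tau>" a \<xi>] \<tau> \<omega>(1)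
      by (simp add: \<tau>_def algebra_simps)
    also have "\<dots> = \<tau> * Fb a"
      unfolding integral_periods[OF contF per] using \<omega> by (simp add: \<tau>_def Fb_def)
    finally have avg: "integral {a..a + \<tau>} (\<lambda>s. F a (\<xi> + \<omega> * s) - Fb a) = 0"
      using integral_diff[OF int2 integrable_const_ivl, of "Fb a"] \<tau> by simp
    have "integral {a..a + \<tau>} e = integral {a..a + \<tau>} (\<lambda>s. e s - (F a (\<xi> + \<omega> * s) - Fb a))"
      using integral_diff[OF int_e[of a "a + \<tau>"] integrable_diff[OF int2 integrable_const_ivl], of "Fb a"] avg by simp
    also have "norm \<dots> \<le> 2 * \<eta> * measure lborel (cbox a (a + \<tau>))"
      unfolding cbox_interval[symmetric]
    proof (rule integrable_bound)
      show "0 \<le> 2 * \<eta>" using order_trans[OF abs_ge_zero osc[of 0 0]] \<tau> by simp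
      show "(\<lambda>s. e s - (F a (\<xi> + \<omega> * s) - Fb a)) integrable_on cbox a (a + \<tau>)"
        using int2 int_e by (auto intro!: integrable_diff)
      fix s assume "s \<in> cbox a (a + \<tau>)"
      then have sa: "\<bar>s - a\<bar> \<le> r" using \<tau> by auto
      show "norm (e s - (F a (\<xi> + \<omega> * s) - Fb a)) \<le> 2 * \<eta>"
        using osc[OF sa, of "\<xi> + \<omega> * s"] Fb_bound[OF osc[OF sa]]
        unfolding e_def real_norm_def by linarith
    qed
    finally show ?thesis using \<tau> by simp
  qed
  have pieces: "\<bar>integral {0..real n * \<tau>} e\<bar> \<le> 2 * \<eta> * (real n * \<tau>)" for n
  proof (induction n)
    case (Suc n)
    have "integral {0..real n * \<tau>} e + integral {real n * \<tau>..real n * \<tau> + \<tau>} e = integral {0..real n * \<tau> + \<tau>} e"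
      using \<tau> int_e by (intro Henstock_Kurzweil_Integration.integral_combine) auto
    moreover have "real (Suc n) * \<tau> = real n * \<tau> + \<tau>" by (simp add: algebra_simps)
    ultimately show ?case using Suc piece[of "real n * \<tau>"] by (simp add: algebra_simps abs_le_iff)
  qed simp
  define n where "n = nat \<lfloor>S / \<tau>\<rfloor>"
  have "0 \<le> S / \<tau>" using S \<tau> by simp
  then have "real n \<le> S / \<tau>" "S / \<tau> < real n + 1" unfolding n_def by linarith+
  then have n: "real n * \<tau> \<le> S" "S \<le> real n * \<tau> + \<tau>" using \<tau> by (simp_all add: field_simps)
  have M0: "0 \<le> M" using order_trans[OF abs_ge_zero bd] .
  have \<eta>0: "0 \<le> \<eta>" using order_trans[OF abs_ge_zero osc[of 0 0]] \<tau> by simp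
  have "norm (integral (cbox (real n * \<tau>) S) e) \<le> 2 * M * measure lborel (cbox (real n * \<tau>) S)"
  proof (rule integrable_bound)
    show "norm (e s) \<le> 2 * M" for s using bd[of s "\<xi> + \<omega> * s"] Mb[of s] by (auto simp: e_def)
  qed (use M0 int_e in auto)
  also have "\<dots> \<le> 2 * M * \<tau>" using n M0 by (intro mult_left_mono) auto
  finally have rest: "\<bar>integral {real n * \<tau>..S} e\<bar> \<le> 2 * M * \<tau>" by simp
  have "integral {0..real n * \<tau>} e + integral {real n * \<tau>..S} e = integral {0..S} e"
    using n \<tau> int_e by (intro Henstock_Kurzweil_Integration.integral_combine) auto
  moreover have "\<bar>integral {0..real n * \<tau>} e\<bar> \<le> 2 * \<eta> * S"
    using pieces[of n] n \<eta>0 by (meson mult_left_mono order_trans mult_nonneg_nonneg zero_le_numeral)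
  ultimately have "\<bar>integral {0..S} e\<bar> \<le> 2 * \<eta> * S + 2 * M * \<tau>" using rest by linarith
  moreover have "integral {0..S} e = integral {0..S} (\<lambda>s. F s (\<xi> + \<omega> * s)) - integral {0..S} Fb"
    unfolding e_def
    by (intro integral_diff integrable_continuous_real continuous_on_subset[OF contF'] continuous_on_subset[OF contFb]) auto
  ultimately show ?thesis by (simp add: Fb_def \<tau>_def)
qed

definition critical_values :: "(real \<Rightarrow> real) \<Rightarrow> real set" where
  "critical_values G = {G \<psi> | \<psi>. \<psi> \<in> {0..<2 * pi} \<and> deriv G \<psi> = 0}"

text \<open>The definition admits critical points of one period only, so the given one is first
  translated.\<close>

lemma critical_value_intro:
  assumes "\<And>x. G (x + 2 * pi) = G x" "(G has_real_derivative 0) (at \<psi>)"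
  shows "G \<psi> \<in> critical_values G"
proof -
  obtain k where k: "\<psi> + of_int k * (2 * pi) \<in> {0..<2 * pi}" by (rule reduce_mod_2pi)
  have G: "G (x + of_int k * (2 * pi)) = G x" for x by (rule periodic_2pi_int) (rule assms(1))
  have "(\<lambda>x. G (x - of_int k * (2 * pi))) = G"
    using G[of "x - of_int k * (2 * pi)" for x] by auto
  moreover have "((\<lambda>x. G (x - of_int k * (2 * pi))) has_real_derivative 0) (at (\<psi> + of_int k * (2 * pi)))"
  proof -
    have 1: "((\<lambda>x. x - of_int k * (2 * pi)) has_real_derivative 1) (at (\<psi> + of_int k * (2 * pi)))"
      by (auto intro!: derivative_eq_intros)
    have "(G has_real_derivative 0) (at (\<psi> + of_int k * (2 * pi) - of_int k * (2 * pi)))" using assms(2) by simp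
    from DERIV_chain2[OF this 1] show ?thesis by simp
  qed
  ultimately have "deriv G (\<psi> + of_int k * (2 * pi)) = 0" by (simp add: DERIV_imp_deriv)
  then show ?thesis using k G[of \<psi>, symmetric] unfolding critical_values_def by blast
qed

text \<open>A level at distance at least \<open>\<epsilon>\<close> from the critical values cannot be attained approximately on a
  whole interval: in the limit the function would be constant there, and the level critical.\<close>

lemma noncritical_level_gap:
  fixes G :: "real \<Rightarrow> real"
  assumes cont: "continuous_on UNIV G" and per: "\<And>x. G (x + 2 * pi) = G x"
    and "\<epsilon> > 0" "\<epsilon>2 > 0"
  obtains \<eta> where "\<eta> > 0"
    "\<And>w a. infdist w (critical_values G) \<ge> \<epsilon> \<Longrightarrow> \<exists>v\<in>{a..a + \<epsilon>2}. \<bar>G v - w\<bar> > \<eta>"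
proof (rule ccontr)
  assume "\<not> thesis"
  have neg: "\<exists>w a. infdist w (critical_values G) \<ge> \<epsilon> \<and> (\<forall>v\<in>{a..a + \<epsilon>2}. \<bar>G v - w\<bar> \<le> inverse (real (Suc n)))" for n
  proof (rule ccontr)
    assume "\<not> ?thesis"
    then have "\<And>w a. infdist w (critical_values G) \<ge> \<epsilon> \<Longrightarrow> \<exists>v\<in>{a..a + \<epsilon>2}. \<bar>G v - w\<bar> > inverse (real (Suc n))"
      by (meson not_le)
    from that[OF _ this] \<open>\<not> thesis\<close> show False by simp
  qed
  then obtain w a where w: "\<And>n. infdist (w n) (critical_values G) \<ge> \<epsilon>"
    and wa: "\<And>n v. v \<in> {a n..a n + \<epsilon>2} \<Longrightarrow> \<bar>G v - w n\<bar> \<le> inverse (real (Suc n))"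
    by metis
  have "\<exists>k :: int. a n + of_int k * (2 * pi) \<in> {0..<2 * pi}" for n using reduce_mod_2pi by metis
  then obtain k where k: "\<And>n. a n + of_int (k n) * (2 * pi) \<in> {0..<2 * pi}" by metis
  define b where "b = (\<lambda>n. a n + of_int (k n) * (2 * pi))"
  have wb: "\<bar>G v - w n\<bar> \<le> inverse (real (Suc n))" if "v \<in> {b n..b n + \<epsilon>2}" for n v
    using wa[of "v + of_int (- k n) * (2 * pi)" n] that periodic_2pi_int[of G v "- k n", OF per]
    by (auto simp: b_def)
  obtain M where M: "\<And>x. \<bar>G x\<bar> \<le> M" using periodic_bounded[OF cont per] by (metis real_norm_def)
  \<comment> \<open>Compactness in both variables: \<open>b n\<close> lies in one period, and
    \<open>w n\<close> is within 1 of a value of the bounded function \<open>G\<close>.\<close>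
  have "(b n, w n) \<in> {0..2 * pi} \<times> {- M - 1..M + 1}" for n
  proof -
    have "inverse (real (Suc n)) \<le> 1" by (simp add: inverse_le_1_iff)
    then have "\<bar>w n\<bar> \<le> M + 1" using wb[of "b n" n] M[of "b n"] assms(4) by auto
    moreover have "b n \<in> {0..2 * pi}" using k[of n] by (auto simp: b_def)
    ultimately show ?thesis by auto
  qed
  moreover have "compact ({0..2 * pi} \<times> {- M - 1..M + 1})" by (intro compact_Times) auto
  ultimately obtain l r where r: "strict_mono r" "((\<lambda>n. (b n, w n)) \<circ> r) \<longlonglongrightarrow> l"
    using seq_compactE[OF compact_imp_seq_compact, of "{0..2 * pi} \<times> {- M - 1..M + 1}" "\<lambda>n. (b n, w n)"]
    by blast
  define b' w' where "b' = fst l" and "w' = snd l"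
  have lb: "(\<lambda>n. b (r n)) \<longlonglongrightarrow> b'" and lw: "(\<lambda>n. w (r n)) \<longlonglongrightarrow> w'"
    using tendsto_fst[OF r(2)] tendsto_snd[OF r(2)] by (simp_all add: b'_def w'_def o_def)
  \<comment> \<open>A point of the open limit interval eventually lies in the intervals
    \<open>{b (r n)..b (r n) + \<epsilon>2}\<close>; an end point may fail to.\<close>
  have const: "G v = w'" if v: "v \<in> {b'<..<b' + \<epsilon>2}" for v
  proof -
    have "eventually (\<lambda>n. b (r n) < v) sequentially" "eventually (\<lambda>n. b (r n) > v - \<epsilon>2) sequentially"
      using order_tendstoD[OF lb] v by auto
    then have ev: "eventually (\<lambda>n. \<bar>G v - w (r n)\<bar> \<le> inverse (real (Suc (r n)))) sequentially"
      by eventually_elim (intro wb, auto)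
    have "(\<lambda>n. inverse (real (Suc (r n)))) \<longlonglongrightarrow> 0"
      using LIMSEQ_subseq_LIMSEQ[OF LIMSEQ_inverse_real_of_nat r(1)] by (simp add: o_def)
    moreover have "(\<lambda>n. \<bar>G v - w (r n)\<bar>) \<longlonglongrightarrow> \<bar>G v - w'\<bar>" by (intro tendsto_intros lw)
    ultimately have "\<bar>G v - w'\<bar> \<le> 0" using tendsto_le[OF sequentially_bot _ _ ev] by blast
    then show ?thesis by simp
  qed
  define m where "m = b' + \<epsilon>2 / 2"
  have m: "m \<in> {b'<..<b' + \<epsilon>2}" using assms(4) by (auto simp: m_def)
  have "((\<lambda>_. w') has_real_derivative 0) (at m)" by simp
  then have "(G has_real_derivative 0) (at m)"
    by (rule has_field_derivative_transform_within_open[OF _ open_greaterThanLessThan m]) (simp add: const)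
  then have "G m \<in> critical_values G" by (intro critical_value_intro per)
  then have mem: "w' \<in> critical_values G" using const[OF m] by simp
  have "eventually (\<lambda>n. dist (w (r n)) w' < \<epsilon>) sequentially" using lw \<open>\<epsilon> > 0\<close> by (rule tendstoD)
  then obtain n where "dist (w (r n)) w' < \<epsilon>" by (auto simp: eventually_sequentially)
  then have "infdist (w (r n)) (critical_values G) < \<epsilon>" using infdist_le[OF mem, of "w (r n)"] by simp
  then show False using w[of "r n"] by simp
qed

text \<open>Where G v > w + \<eta>, the sequence cannot pass \<open>v\<close> downwards: within
  \<open>r\<close> above \<open>v\<close> its increment is nonnegative, since the oscillation of
  \<open>G\<close> and the error take at most \<eta> / 2 each, and from farther above an increment
  of size at most \<open>r\<close> does not get below \<open>v\<close>. The case G v < w - \<eta> is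
  symmetric. So every barrier is eventually on a fixed side of the sequence, and two neighbouring
  barriers on different sides trap it.\<close>

lemma barrier_locking:
  fixes \<sigma> e :: "nat \<Rightarrow> real" and G :: "real \<Rightarrow> real"
  assumes per: "\<And>x. G (x + 2 * pi) = G x"
    and osc: "\<And>x y. \<bar>x - y\<bar> \<le> r \<Longrightarrow> \<bar>G x - G y\<bar> \<le> \<eta> / 2"
    and gap: "\<And>a. \<exists>v\<in>{a..a + \<epsilon>2}. \<bar>G v - w\<bar> > \<eta>"
    and up: "G vp > w + \<eta>" and down: "G vm < w - \<eta>"
    and step: "\<And>k. k \<ge> K0 \<Longrightarrow> \<sigma> (Suc k) - \<sigma> k = \<mu> * (G (\<sigma> k) - w + e k)"
    and small: "\<And>k. k \<ge> K0 \<Longrightarrow> \<bar>e k\<bar> \<le> \<eta> / 2" "\<And>k. k \<ge> K0 \<Longrightarrow> \<bar>\<sigma> (Suc k) - \<sigma> k\<bar> \<le> r"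
    and "\<mu> > 0" "\<epsilon>2 > 0"
  obtains s K where "K \<ge> K0" "\<And>k. k \<ge> K \<Longrightarrow> \<bar>\<sigma> k - s\<bar> \<le> \<epsilon>2"
proof -
  have up_step: "\<sigma> (Suc k) \<ge> v" if "G v > w + \<eta>" "k \<ge> K0" "\<sigma> k \<ge> v" for v k
  proof (cases "\<sigma> k \<le> v + r")
    case True
    then have "\<bar>G (\<sigma> k) - G v\<bar> \<le> \<eta> / 2" using that(3) by (intro osc) auto
    then have "G (\<sigma> k) - w + e k \<ge> 0" using small(1)[OF that(2)] that(1) by linarith
    then have "\<mu> * (G (\<sigma> k) - w + e k) \<ge> 0" using \<open>\<mu> > 0\<close> by simp
    then show ?thesis using step[OF that(2)] that(3) by linarith
  next
    case False
    then show ?thesis using small(2)[OF that(2)] by auto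
  qed
  have down_step: "\<sigma> (Suc k) \<le> v" if "G v < w - \<eta>" "k \<ge> K0" "\<sigma> k \<le> v" for v k
  proof (cases "\<sigma> k \<ge> v - r")
    case True
    then have "\<bar>G (\<sigma> k) - G v\<bar> \<le> \<eta> / 2" using that(3) by (intro osc) auto
    then have "- (G (\<sigma> k) - w + e k) \<ge> 0" using small(1)[OF that(2)] that(1) by linarith
    then have "\<mu> * (- (G (\<sigma> k) - w + e k)) \<ge> 0" using \<open>\<mu> > 0\<close> by (intro mult_nonneg_nonneg) auto
    then show ?thesis using step[OF that(2)] that(3) by linarith
  next
    case False
    then show ?thesis using small(2)[OF that(2)] by auto
  qed
  have up_inv: "\<sigma> k \<ge> v" if "G v > w + \<eta>" "k0 \<ge> K0" "\<sigma> k0 \<ge> v" "k \<ge> k0" for v k0 k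
    using that(4) by (induction k rule: dec_induct) (use that up_step in auto)
  have down_inv: "\<sigma> k \<le> v" if "G v < w - \<eta>" "k0 \<ge> K0" "\<sigma> k0 \<le> v" "k \<ge> k0" for v k0 k
    using that(4) by (induction k rule: dec_induct) (use that down_step in auto)
  obtain v where v: "\<And>j :: int. v j \<in> {of_int j * \<epsilon>2..of_int j * \<epsilon>2 + \<epsilon>2}" "\<And>j. \<bar>G (v j) - w\<bar> > \<eta>"
  proof -
    have "\<forall>j :: int. \<exists>v. v \<in> {of_int j * \<epsilon>2..of_int j * \<epsilon>2 + \<epsilon>2} \<and> \<bar>G v - w\<bar> > \<eta>"
      using gap by blast
    from choice[OF this] that show thesis by blast
  qed
  define above where "above = (\<lambda>j. \<exists>K\<ge>K0. \<forall>k\<ge>K. \<sigma> k \<ge> v j)"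
  define below where "below = (\<lambda>j. \<exists>K\<ge>K0. \<forall>k\<ge>K. \<sigma> k \<le> v j)"
  \<comment> \<open>An upward barrier, once reached, is not passed again; if it is never reached,
    the sequence stays below it from \<open>K0\<close> on. Downward barriers are symmetric.\<close>
  have dich: "above j \<or> below j" for j
  proof (cases "G (v j) > w + \<eta>")
    case True
    show ?thesis
    proof (cases "\<exists>k0\<ge>K0. \<sigma> k0 \<ge> v j")
      case True
      then show ?thesis using up_inv[OF \<open>G (v j) > w + \<eta>\<close>] unfolding above_def by blast
    next
      case False
      then show ?thesis unfolding below_def by (meson le_refl linear)
    qed
  next
    case False
    then have G: "G (v j) < w - \<eta>" using v(2)[of j] by linarith
    show ?thesis
    proof (cases "\<exists>k0\<ge>K0. \<sigma> k0 \<le> v j")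
      case True
      then show ?thesis using down_inv[OF G] unfolding below_def by blast
    next
      case False
      then show ?thesis unfolding above_def by (meson le_refl linear)
    qed
  qed
  have far: "\<exists>n :: nat. y \<le> x + real n * c" if "c > 0" for x y c :: real
  proof -
    obtain n :: nat where "(y - x) / c \<le> real n" using real_arch_simple by blast
    then show ?thesis using that by (auto simp: field_simps intro!: exI[of _ n])
  qed
  \<comment> \<open>Without a bound the sequence might run through all cells in one direction.
    Translates of \<open>vp\<close> below the start and of \<open>vm\<close> above it, by multiples
    of 2 pi, are barriers that confine it.\<close>
  obtain B where B: "\<And>k. k \<ge> K0 \<Longrightarrow> \<bar>\<sigma> k\<bar> \<le> B"
  proof -
    obtain n :: nat where n: "vp \<le> \<sigma> K0 + real n * (2 * pi)" using far[of "2 * pi"] by auto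
    have "G (vp + of_int (- int n) * (2 * pi)) > w + \<eta>"
      using up periodic_2pi_int[of G vp "- int n", OF per] by simp
    then have lo: "\<sigma> k \<ge> vp + of_int (- int n) * (2 * pi)" if "k \<ge> K0" for k
      by (rule up_inv[of _ K0]) (use n that in auto)
    obtain n' :: nat where n': "\<sigma> K0 \<le> vm + real n' * (2 * pi)" using far[of "2 * pi"] by auto
    have "G (vm + of_int (int n') * (2 * pi)) < w - \<eta>"
      using down periodic_2pi_int[of G vm "int n'", OF per] by simp
    then have hi: "\<sigma> k \<le> vm + of_int (int n') * (2 * pi)" if "k \<ge> K0" for k
      by (rule down_inv[of _ K0]) (use n' that in auto)
    show thesis
      by (rule that[of "\<bar>vp + of_int (- int n) * (2 * pi)\<bar> + \<bar>vm + of_int (int n') * (2 * pi)\<bar>"])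
        (use lo hi in fastforce)
  qed
  obtain n0 :: nat where n0: "B \<le> 0 + real n0 * \<epsilon>2" using far[OF \<open>\<epsilon>2 > 0\<close>] by blast
  define j0 where "j0 = - int n0 - 1"
  have "v j0 \<le> of_int j0 * \<epsilon>2 + \<epsilon>2" using v(1)[of j0] by simp
  also have "\<dots> \<le> - B" using n0 by (simp add: j0_def algebra_simps)
  finally have "above j0" unfolding above_def using B by (intro exI[of _ K0]) force
  have nab: "below (j0 + int n)" if "n \<ge> 2 * n0 + 2" for n
  proof -
    have "real n0 \<le> of_int (j0 + int n)" using that by (simp add: j0_def)
    then have "real n0 * \<epsilon>2 \<le> of_int (j0 + int n) * \<epsilon>2" using \<open>\<epsilon>2 > 0\<close> by (intro mult_right_mono) auto
    also have "\<dots> \<le> v (j0 + int n)" using v(1)[of "j0 + int n"] by simp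
    finally have "B \<le> v (j0 + int n)" using n0 by simp
    then show ?thesis unfolding below_def using B by (intro exI[of _ K0]) force
  qed
  \<comment> \<open>Scanning the cells from far left to far right, the side has to change from
    \<open>above\<close> to \<open>below\<close> between some pair of neighbours.\<close>
  have "\<exists>n. above (j0 + int n) \<and> below (j0 + int (Suc n))"
  proof (rule ccontr)
    assume no: "\<nexists>n. above (j0 + int n) \<and> below (j0 + int (Suc n))"
    have "above (j0 + int n)" for n
    proof (induction n)
      case 0 then show ?case using \<open>above j0\<close> by simp
    next
      case (Suc n) then show ?case using no dich by blast
    qed
    then show False using no nab[of "Suc (2 * n0 + 2)"] by fastforce
  qed
  then obtain n where n: "above (j0 + int n)" "below (j0 + int (Suc n))" by blast
  define j where "j = j0 + int n"
  obtain K1 where K1: "K1 \<ge> K0" "\<And>k. k \<ge> K1 \<Longrightarrow> \<sigma> k \<ge> v j" using n(1) by (auto simp: above_def j_def)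
  obtain K2 where K2: "\<And>k. k \<ge> K2 \<Longrightarrow> \<sigma> k \<le> v (j + 1)" using n(2) by (auto simp: below_def j_def add.assoc add.commute[of 1])
  \<comment> \<open>The cells of \<open>v j\<close> and \<open>v (j + 1)\<close> are adjacent; their
    common end is taken as the centre \<open>s\<close>.\<close>
  show thesis
  proof (rule that[of "max K1 K2" "(of_int j + 1) * \<epsilon>2"])
    fix k assume "k \<ge> max K1 K2"
    then have "v j \<le> \<sigma> k" "\<sigma> k \<le> v (j + 1)" using K1 K2 by auto
    then show "\<bar>\<sigma> k - (of_int j + 1) * \<epsilon>2\<bar> \<le> \<epsilon>2"
      using v(1)[of j] v(1)[of "j + 1"] by (auto simp: algebra_simps abs_le_iff)
  qed (use K1 in auto)
qed

subsection \<open>The linearization along the torus\<close>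

lemma matrix_norm_bound:
  obtains c where "c > 0" "\<And>v. norm ((M :: real^'m^'k) *v v) \<le> c * norm v"
  using bounded_linear.pos_bounded[OF matrix_vector_mul_bounded_linear[of M]] by (metis mult.commute)

lemma bounded_bilinear_matrix_vector_mult:
  "bounded_bilinear (\<lambda>(M :: real^'n^'m) v. M *v v)"
  by (simp add: bilinear_conv_bounded_bilinear[symmetric] bilinear_def linear_iff
      matrix_vector_mult_add_rdistrib scaleR_matrix_vector_assoc[symmetric]
      matrix_vector_right_distrib matrix_vector_mult_scaleR)

lemma mexp_affine_deriv:
  "((\<lambda>s. mexp ((c * s + d) *\<^sub>R A)) has_vector_derivative c *\<^sub>R (A ** mexp ((c * s + d) *\<^sub>R A))) (at s within S)"
proof -
  have "((\<lambda>s. c * s + d) has_vector_derivative c) (at s within S)"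
    by (auto intro!: derivative_eq_intros simp: has_real_derivative_iff_has_vector_derivative[symmetric])
  from vector_diff_chain_within[OF this, of "\<lambda>\<phi>. mexp (\<phi> *\<^sub>R A)"] show ?thesis
    by (simp add: o_def has_vector_derivative_at_within[OF mexp_deriv])
qed

lemma mexp_product_deriv:
  fixes A :: "real^'n^'n"
  assumes "(y has_vector_derivative y') (at s within S)"
  shows "((\<lambda>s. mexp ((c * s + d) *\<^sub>R A) *v y s) has_vector_derivative
    mexp ((c * s + d) *\<^sub>R A) *v y' + c *\<^sub>R (A *v (mexp ((c * s + d) *\<^sub>R A) *v y s))) (at s within S)"
  using bounded_bilinear.has_vector_derivative[OF bounded_bilinear_matrix_vector_mult mexp_affine_deriv assms]
  by (simp add: scaleR_matrix_vector_assoc[symmetric] matrix_vector_mul_assoc)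

lemma has_vector_derivative_compose_affine:
  fixes y :: "real \<Rightarrow> 'a::real_normed_vector"
  assumes "(y has_vector_derivative y') (at (c * s + d))"
  shows "((\<lambda>s. y (c * s + d)) has_vector_derivative c *\<^sub>R y') (at s within S)"
proof -
  have "((\<lambda>s. c * s + d) has_vector_derivative c) (at s within S)"
    by (auto intro!: derivative_eq_intros simp: has_real_derivative_iff_has_vector_derivative[symmetric])
  from vector_diff_chain_within[OF this has_vector_derivative_at_within[OF assms]] show ?thesis
    by (simp add: o_def)
qed

locale forced_torus =
  fixes f :: "real^'n \<Rightarrow> real^'n"
    and g :: "(real^'n) \<times> real \<times> real \<Rightarrow> real^'n"
    and A :: "real^'n^'n"
    and \<alpha>0 \<beta>0 :: real
    and x0 p1 p2 :: "real \<Rightarrow> real^'n"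
  assumes smooth_f: "C_smooth 1 f" and smooth_g: "C_smooth 1 g"
    and skew: "transpose A = - A"
    and f_equivariant: "\<And>x \<xi>. f (mexp (\<xi> *\<^sub>R A) *v x) = mexp (\<xi> *\<^sub>R A) *v f x"
    and g_periodic1: "\<And>x \<psi> \<phi>. g (x, \<psi> + 2 * pi, \<phi>) = g (x, \<psi>, \<phi>)"
    and g_periodic2: "\<And>x \<psi> \<phi>. g (x, \<psi>, \<phi> + 2 * pi) = g (x, \<psi>, \<phi>)"
    and g_equivariant: "\<And>x \<psi> \<phi> \<xi>. g (mexp (\<xi> *\<^sub>R A) *v x, \<psi>, \<phi> + \<xi>) = mexp (\<xi> *\<^sub>R A) *v g (x, \<psi>, \<phi>)"
    and \<beta>0_pos: "\<beta>0 > 0"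
    and x0_periodic: "\<And>\<psi>. x0 (\<psi> + 2 * pi) = x0 \<psi>"
    and x0_solution: "solution_on (\<lambda>t. f) UNIV (\<lambda>t. mexp ((\<alpha>0 * t) *\<^sub>R A) *v x0 (\<beta>0 * t))"
    and stable: "exponentially_orbitally_stable f A \<alpha>0 \<beta>0 x0"
    and p1_adjoint: "\<And>\<psi>. (p1 has_vector_derivative adjoint_matrix f A \<alpha>0 \<beta>0 x0 \<psi> *v p1 \<psi>) (at \<psi>)"
    and p2_adjoint: "\<And>\<psi>. (p2 has_vector_derivative adjoint_matrix f A \<alpha>0 \<beta>0 x0 \<psi> *v p2 \<psi>) (at \<psi>)"
    and p1_periodic: "\<And>\<psi>. p1 (\<psi> + 2 * pi) = p1 \<psi>"
    and p2_periodic: "\<And>\<psi>. p2 (\<psi> + 2 * pi) = p2 \<psi>"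
    and p1_dx0: "\<And>\<psi>. p1 \<psi> \<bullet> vector_derivative x0 (at \<psi>) = 1"
    and p1_Ax0: "\<And>\<psi>. p1 \<psi> \<bullet> (A *v x0 \<psi>) = 0"
    and p2_dx0: "\<And>\<psi>. p2 \<psi> \<bullet> vector_derivative x0 (at \<psi>) = 0"
    and p2_Ax0: "\<And>\<psi>. p2 \<psi> \<bullet> (A *v x0 \<psi>) = 1"
begin

abbreviation E :: "real \<Rightarrow> real^'n^'n" where "E \<phi> \<equiv> mexp (\<phi> *\<^sub>R A)"

abbreviation Df :: "real^'n \<Rightarrow> real^'n \<Rightarrow> real^'n" where "Df x \<equiv> frechet_derivative f (at x)"

text \<open>This is dx0/d\<psi>, written as the right side of the differential equation so that its
  differentiability follows from that of \<open>f\<close> and \<open>x0\<close>.\<close>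

definition q :: "real \<Rightarrow> real^'n" where
  "q \<psi> = (1 / \<beta>0) *\<^sub>R (f (x0 \<psi>) - \<alpha>0 *\<^sub>R (A *v x0 \<psi>))"

abbreviation V :: "real \<Rightarrow> real^'n^'n" where "V \<equiv> variational_matrix f A \<alpha>0 \<beta>0 x0"

sublocale f: C1_map f Df
  using C_smooth_C1_map[of 0] smooth_f by simp

lemma jacobian_Df: "jacobian f (at x) *v v = Df x v"
  using f.linear unfolding jacobian_def by (simp add: matrix_works)

lemma V_mult: "V \<psi> *v v = (1 / \<beta>0) *\<^sub>R (Df (x0 \<psi>) v - \<alpha>0 *\<^sub>R (A *v v))"
  unfolding variational_matrix_def
  by (simp add: scaleR_matrix_vector_assoc[symmetric] matrix_vector_mult_diff_rdistrib jacobian_Df)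

text \<open>The rotation is undone: x0(\<psi>) is the solution at time \<psi> / \<beta>0, rotated
  back by the angle \<alpha>0 \<psi> / \<beta>0, and equivariance carries this rotation through
  \<open>f\<close>.\<close>

lemma x0_deriv: "(x0 has_vector_derivative q \<psi>) (at \<psi>)"
proof -
  define X where "X = (\<lambda>t. E (\<alpha>0 * t) *v x0 (\<beta>0 * t))"
  have dX: "(X has_vector_derivative f (X t)) (at t)" for t
    using x0_solution by (simp add: solution_on_def X_def)
  define c where "c = - (\<alpha>0 / \<beta>0)"
  have x0X: "x0 \<psi> = E (c * \<psi> + 0) *v X (1 / \<beta>0 * \<psi> + 0)" for \<psi>
    using mexp_minus_cancel[OF skew, of "\<alpha>0 / \<beta>0 * \<psi>" "x0 \<psi>"] \<beta>0_pos by (simp add: X_def c_def)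
  have "((\<lambda>\<psi>. X (1 / \<beta>0 * \<psi> + 0)) has_vector_derivative (1 / \<beta>0) *\<^sub>R f (X (1 / \<beta>0 * \<psi> + 0))) (at \<psi>)"
    by (rule has_vector_derivative_compose_affine[OF dX])
  from mexp_product_deriv[OF this, of c 0 A]
  have "(x0 has_vector_derivative (1 / \<beta>0) *\<^sub>R f (x0 \<psi>) + c *\<^sub>R (A *v x0 \<psi>)) (at \<psi>)"
    unfolding x0X[symmetric] matrix_vector_mult_scaleR f_equivariant[symmetric] .
  then show ?thesis by (simp add: q_def c_def scaleR_diff_right)
qed

lemma vector_derivative_x0: "vector_derivative x0 (at \<psi>) = q \<psi>"
  using x0_deriv by (rule vector_derivative_at)

text \<open>The equivariance of \<open>f\<close>, differentiated at \<xi> = 0. It makes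
  \<open>A *v x0\<close> a solution of the variational equation.\<close>

lemma A_f: "A *v f x = Df x (A *v x)"
proof -
  have "((\<lambda>\<xi>. E \<xi> *v f x) has_vector_derivative A *v f x) (at 0)"
    using mexp_vec_deriv[of A "f x" 0] mexp_0[of A] by simp
  moreover have "((\<lambda>\<xi>. f (E \<xi> *v x)) has_vector_derivative Df x (A *v x)) (at 0)"
  proof -
    have "((\<lambda>\<xi>. E \<xi> *v x) has_derivative (\<lambda>h. h *\<^sub>R (A *v x))) (at 0)"
      using mexp_vec_deriv[of A x 0] mexp_0[of A] by (simp add: has_vector_derivative_def)
    from has_derivative_compose[OF this, of f "Df x"] f.has_derivative[of x]
    have "((\<lambda>\<xi>. f (E \<xi> *v x)) has_derivative (\<lambda>h. Df x (h *\<^sub>R (A *v x)))) (at 0)"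
      using mexp_0[of A] by simp
    then show ?thesis by (simp add: has_vector_derivative_def linear_scale[OF f.linear])
  qed
  ultimately show ?thesis unfolding f_equivariant by (rule vector_derivative_unique_at)
qed

lemma f_x0_deriv: "((\<lambda>\<psi>. f (x0 \<psi>)) has_vector_derivative Df (x0 \<psi>) (q \<psi>)) (at \<psi>)"
proof -
  have "((\<lambda>\<psi>. f (x0 \<psi>)) has_derivative (\<lambda>h. Df (x0 \<psi>) (h *\<^sub>R q \<psi>))) (at \<psi>)"
    using x0_deriv by (intro has_derivative_compose[OF _ f.has_derivative]) (simp add: has_vector_derivative_def)
  then show ?thesis by (simp add: has_vector_derivative_def linear_scale[OF f.linear])
qed

lemma Ax0_deriv: "((\<lambda>\<psi>. A *v x0 \<psi>) has_vector_derivative A *v q \<psi>) (at \<psi>)"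
  by (rule bounded_linear.has_vector_derivative[OF matrix_vector_mul_bounded_linear x0_deriv])

lemma q_solution: "(q has_vector_derivative V \<psi> *v q \<psi>) (at \<psi>)"
  unfolding q_def[abs_def] V_mult
  using f_x0_deriv Ax0_deriv unfolding q_def
  by (intro bounded_linear.has_vector_derivative[OF bounded_linear_scaleR_right] has_vector_derivative_diff)

lemma Ax0_solution: "((\<lambda>\<psi>. A *v x0 \<psi>) has_vector_derivative V \<psi> *v (A *v x0 \<psi>)) (at \<psi>)"
  using Ax0_deriv[of \<psi>]
  by (simp add: V_mult A_f[symmetric] q_def matrix_vector_mult_scaleR matrix_vector_mult_diff_distrib)

lemma q_periodic: "q (\<psi> + 2 * pi) = q \<psi>"
  by (simp add: q_def x0_periodic)

lemma V_periodic: "V (\<psi> + of_int k * (2 * pi)) = V \<psi>"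
  by (simp add: variational_matrix_def periodic_2pi_int[of x0, OF x0_periodic])

lemma continuous_x0: "continuous_on S x0"
  using x0_deriv has_vector_derivative_continuous continuous_at_imp_continuous_on by blast

lemma continuous_q: "continuous_on S q"
  using q_solution has_vector_derivative_continuous continuous_at_imp_continuous_on by blast

lemma continuous_p1: "continuous_on S p1"
  using p1_adjoint has_vector_derivative_continuous continuous_at_imp_continuous_on by blast

lemma continuous_p2: "continuous_on S p2"
  using p2_adjoint has_vector_derivative_continuous continuous_at_imp_continuous_on by blast

lemma V_bounded:
  obtains c where "c > 0" "\<And>\<psi> v. norm (V \<psi> *v v) \<le> c * norm v"
proof -
  obtain R where R: "\<And>\<psi>. norm (x0 \<psi>) \<le> R" using periodic_bounded[OF continuous_x0 x0_periodic] by metis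
  obtain c1 where c1: "c1 > 0" "\<And>x v. norm x \<le> R \<Longrightarrow> norm (Df x v) \<le> c1 * norm v"
    using f.derivative_bounded by metis
  obtain c2 where c2: "c2 > 0" "\<And>v. norm (A *v v) \<le> c2 * norm v" using matrix_norm_bound by metis
  show thesis
  proof (rule that[of "(1 / \<beta>0) * (c1 + \<bar>\<alpha>0\<bar> * c2)"])
    show "(1 / \<beta>0) * (c1 + \<bar>\<alpha>0\<bar> * c2) > 0" using \<beta>0_pos c1 c2 by (intro mult_pos_pos add_pos_nonneg) auto
    fix \<psi> v
    have "norm (Df (x0 \<psi>) v - \<alpha>0 *\<^sub>R (A *v v)) \<le> c1 * norm v + \<bar>\<alpha>0\<bar> * (c2 * norm v)"
      by (intro order_trans[OF norm_triangle_ineq4] add_mono c1 R) (auto intro!: mult_left_mono c2)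
    then have "(1 / \<beta>0) * norm (Df (x0 \<psi>) v - \<alpha>0 *\<^sub>R (A *v v)) \<le> (1 / \<beta>0) * (c1 * norm v + \<bar>\<alpha>0\<bar> * (c2 * norm v))"
      using \<beta>0_pos by (intro mult_left_mono) auto
    also have "(1 / \<beta>0) * norm (Df (x0 \<psi>) v - \<alpha>0 *\<^sub>R (A *v v)) = norm (V \<psi> *v v)"
      unfolding V_mult norm_scaleR using \<beta>0_pos by simp
    finally show "norm (V \<psi> *v v) \<le> (1 / \<beta>0) * (c1 + \<bar>\<alpha>0\<bar> * c2) * norm v"
      by (simp add: algebra_simps)
  qed
qed

definition lin_sol :: "(real \<Rightarrow> real^'n) \<Rightarrow> bool" where
  "lin_sol y \<longleftrightarrow> (\<forall>\<psi>. (y has_vector_derivative V \<psi> *v y \<psi>) (at \<psi>))"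

lemma lin_sol_deriv: "lin_sol y \<Longrightarrow> (y has_vector_derivative V \<psi> *v y \<psi>) (at \<psi> within S)"
  by (simp add: lin_sol_def has_vector_derivative_at_within)

lemma lin_sol_growth:
  obtains c where "c > 0" "\<And>y s t. lin_sol y \<Longrightarrow> norm (y t) \<le> exp (c * \<bar>t - s\<bar>) * norm (y s)"
proof -
  obtain c where c: "c > 0" "\<And>\<psi> v. norm (V \<psi> *v v) \<le> c * norm v" using V_bounded by metis
  have "norm (y t) \<le> exp ((c + 1) * \<bar>t - s\<bar>) * norm (y s)" if y: "lin_sol y" for y s t
  proof (cases "s \<le> t")
    case True
    have "norm (y t) \<le> exp ((c + 1) * (t - s)) * (norm (y s) + 0)"
      by (rule gronwall_norm[OF lin_sol_deriv[OF y], where b = t]) (use c True in auto)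
    then show ?thesis using True by simp
  next
    case False
    \<comment> \<open>For t < s the differential inequality is used in reversed time.\<close>
    have "norm (y ((-1) * (- t) + 0)) \<le> exp ((c + 1) * (- t - (- s))) * (norm (y ((-1) * (- s) + 0)) + 0)"
      by (rule gronwall_norm[where b = "- t" and w = "\<lambda>u. y ((-1) * u + 0)",
            OF has_vector_derivative_compose_affine[OF lin_sol_deriv[OF y]]])
        (use c False in auto)
    then show ?thesis using False by simp
  qed
  then show thesis using c(1) by (intro that[of "c + 1"]) auto
qed

lemma lin_sol_diff: "lin_sol y \<Longrightarrow> lin_sol z \<Longrightarrow> lin_sol (\<lambda>\<psi>. y \<psi> - z \<psi>)"
  unfolding lin_sol_def matrix_vector_mult_diff_distrib by (auto intro: has_vector_derivative_diff)

lemma lin_sol_unique: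
  assumes "lin_sol y" "lin_sol z" "y s = z s"
  shows "y t = z t"
proof -
  obtain c where "\<And>y s t. lin_sol y \<Longrightarrow> norm (y t) \<le> exp (c * \<bar>t - s\<bar>) * norm (y s)"
    using lin_sol_growth by metis
  from this[OF lin_sol_diff[OF assms(1,2)], of t s] assms(3) show ?thesis by simp
qed

lemma lin_sol_shift: 
  assumes "lin_sol y"
  shows "lin_sol (\<lambda>\<psi>. y (\<psi> + of_int k * (2 * pi)))"
  unfolding lin_sol_def
proof
  fix \<psi>
  have "(y has_vector_derivative V \<psi> *v y (1 * \<psi> + of_int k * (2 * pi))) (at (1 * \<psi> + of_int k * (2 * pi)))"
    using lin_sol_deriv[OF assms, of "\<psi> + of_int k * (2 * pi)" UNIV] by (simp add: V_periodic)
  from has_vector_derivative_compose_affine[OF this]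
  show "((\<lambda>\<psi>. y (\<psi> + of_int k * (2 * pi))) has_vector_derivative V \<psi> *v y (\<psi> + of_int k * (2 * pi))) (at \<psi>)"
    by simp
qed

lemma lin_sol_q: "lin_sol q"
  using q_solution by (simp add: lin_sol_def)

lemma lin_sol_Ax0: "lin_sol (\<lambda>\<psi>. A *v x0 \<psi>)"
  using Ax0_solution by (simp add: lin_sol_def)

text \<open>Skewness turns + \<alpha>0 A into the transpose of - \<alpha>0 A, so
  \<open>adjoint_matrix\<close> is minus the transpose of \<open>V\<close>.\<close>

lemma adjoint_inner:
  "(adjoint_matrix f A \<alpha>0 \<beta>0 x0 \<psi> *v p) \<bullet> v = - (p \<bullet> (V \<psi> *v v))"
proof -
  have "(transpose (jacobian f (at (x0 \<psi>))) *v p) \<bullet> v = p \<bullet> (Df (x0 \<psi>) v)"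
    by (simp add: dot_lmul_matrix transpose_matrix_vector jacobian_Df)
  moreover have "(A *v p) \<bullet> v = - (p \<bullet> (A *v v))"
    using skew_inner[OF skew, of p v] by simp
  moreover have "adjoint_matrix f A \<alpha>0 \<beta>0 x0 \<psi> *v p =
      - ((1 / \<beta>0) *\<^sub>R (transpose (jacobian f (at (x0 \<psi>))) *v p + \<alpha>0 *\<^sub>R (A *v p)))"
  proof -
    have "(- M) *v p = - (M *v p)" for M :: "real^'n^'n"
      by (simp add: matrix_vector_mult_def vec_eq_iff sum_negf)
    then show ?thesis unfolding adjoint_matrix_def
      by (simp add: scaleR_matrix_vector_assoc[symmetric] matrix_vector_mult_add_rdistrib)
  qed
  ultimately have "(adjoint_matrix f A \<alpha>0 \<beta>0 x0 \<psi> *v p) \<bullet> v =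
      - ((1 / \<beta>0) * (p \<bullet> (Df (x0 \<psi>) v) - \<alpha>0 * (p \<bullet> (A *v v))))"
    by (simp only: inner_minus_left inner_scaleR_left inner_add_left) simp
  then show ?thesis by (simp add: V_mult inner_diff_right)
qed

text \<open>The contributions of \<open>V\<close> and of the adjoint matrix cancel, so only the
  perturbation is seen; for \<open>e = 0\<close> the pairing is conserved.\<close>

lemma adjoint_solution_pairing_deriv:
  assumes p: "(p has_vector_derivative adjoint_matrix f A \<alpha>0 \<beta>0 x0 \<psi> *v p \<psi>) (at \<psi> within S)"
    and y: "(y has_vector_derivative V \<psi> *v y \<psi> + e) (at \<psi> within S)"
  shows "((\<lambda>\<psi>. p \<psi> \<bullet> y \<psi>) has_real_derivative p \<psi> \<bullet> e) (at \<psi> within S)"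
proof -
  have "((\<lambda>\<psi>. p \<psi> \<bullet> y \<psi>) has_vector_derivative p \<psi> \<bullet> (V \<psi> *v y \<psi> + e) + (adjoint_matrix f A \<alpha>0 \<beta>0 x0 \<psi> *v p \<psi>) \<bullet> y \<psi>) (at \<psi> within S)"
    using bounded_bilinear.has_vector_derivative[OF bounded_bilinear_inner p y] .
  then show ?thesis
    by (simp add: adjoint_inner inner_add_right has_real_derivative_iff_has_vector_derivative)
qed

lemma pairing_constant:
  assumes "\<And>\<psi>. (p has_vector_derivative adjoint_matrix f A \<alpha>0 \<beta>0 x0 \<psi> *v p \<psi>) (at \<psi>)" "lin_sol y"
  shows "p s \<bullet> y s = p t \<bullet> y t"
proof -
  have "((\<lambda>\<psi>. p \<psi> \<bullet> y \<psi>) has_real_derivative 0) (at \<psi>)" for \<psi>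
    using adjoint_solution_pairing_deriv[OF assms(1), of y \<psi> 0] lin_sol_deriv[OF assms(2)] by simp
  then show ?thesis by (intro DERIV_isconst_all[of "\<lambda>\<psi>. p \<psi> \<bullet> y \<psi>"]) blast
qed

definition P :: "real \<Rightarrow> real^'n \<Rightarrow> real^'n" where
  "P \<psi> h = h - (p1 \<psi> \<bullet> h) *\<^sub>R q \<psi> - (p2 \<psi> \<bullet> h) *\<^sub>R (A *v x0 \<psi>)"

lemma monodromy:
  obtains Y where "Y 0 = mat 1" "\<And>v. lin_sol (\<lambda>\<psi>. Y \<psi> *v v)"
    "order 1 (charpoly (Y (2 * pi))) = 2"
    "\<And>\<mu>. poly (charpoly (Y (2 * pi))) \<mu> = 0 \<Longrightarrow> \<mu> \<noteq> 1 \<Longrightarrow> cmod \<mu> < 1"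
proof -
  obtain Y where Y: "principal_fundamental_matrix V Y" "order 1 (charpoly (Y (2 * pi))) = 2"
    "\<And>\<mu>. poly (charpoly (Y (2 * pi))) \<mu> = 0 \<Longrightarrow> \<mu> \<noteq> 1 \<Longrightarrow> cmod \<mu> < 1"
    using stable unfolding exponentially_orbitally_stable_def by blast
  have "lin_sol (\<lambda>\<psi>. Y \<psi> *v v)" for v
    unfolding lin_sol_def
  proof
    fix \<psi>
    have "(Y has_vector_derivative V \<psi> ** Y \<psi>) (at \<psi>)" using Y(1) by (simp add: principal_fundamental_matrix_def)
    from bounded_linear.has_vector_derivative[OF bounded_linear_matrix_vector_left this]
    show "((\<lambda>\<psi>. Y \<psi> *v v) has_vector_derivative V \<psi> *v (Y \<psi> *v v)) (at \<psi>)"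
      by (simp add: matrix_vector_mul_assoc)
  qed
  then show thesis using Y by (intro that) (auto simp: principal_fundamental_matrix_def)
qed

text \<open>By uniqueness the map from v to Y \<psi> v is injective, hence surjective in finite
  dimension, so every value at \<psi> is attained.\<close>

lemma lin_sol_exists: "\<exists>y. lin_sol y \<and> y \<psi> = h"
proof -
  obtain Y where Y: "Y 0 = mat 1" "\<And>v. lin_sol (\<lambda>\<psi>. Y \<psi> *v v)" using monodromy by metis
  have "inj ((*v) (Y \<psi>))"
  proof (rule injI)
    fix v w assume "Y \<psi> *v v = Y \<psi> *v w"
    from lin_sol_unique[OF Y(2) Y(2) this, of 0] show "v = w" by (simp add: Y(1))
  qed
  then have "surj ((*v) (Y \<psi>))" by (intro linear_injective_imp_surjective) auto
  then obtain v where "h = Y \<psi> *v v" by (auto elim: surjE)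
  then show ?thesis using Y(2) by blast
qed

text \<open>The projection \<open>P\<close> removes the two neutral directions, so that \<open>P\<close> composed with
  sufficiently many periods of the linear flow is a contraction for the Euclidean norm,
  uniformly in the phase.\<close>

lemma projected_flow_contracts:
  obtains m :: nat where "m \<ge> 1" "\<And>y \<psi>. lin_sol y \<Longrightarrow> norm (P \<psi> (y (\<psi> + real m * (2 * pi)))) \<le> 1 / 2 * norm (y \<psi>)"
proof -
  obtain Y where Y: "Y 0 = mat 1" "\<And>v. lin_sol (\<lambda>\<psi>. Y \<psi> *v v)"
    "order 1 (charpoly (Y (2 * pi))) = 2"
    "\<And>\<mu>. poly (charpoly (Y (2 * pi))) \<mu> = 0 \<Longrightarrow> \<mu> \<noteq> 1 \<Longrightarrow> cmod \<mu> < 1"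
    using monodromy by metis
  obtain c where c: "c > 0" "\<And>y s t. lin_sol y \<Longrightarrow> norm (y t) \<le> exp (c * \<bar>t - s\<bar>) * norm (y s)"
    using lin_sol_growth by metis
  define C where "C = exp (c * (2 * pi))"
  define M where "M = Y (2 * pi)"
  have Yq: "Y s *v q 0 = q s" for s by (rule lin_sol_unique[OF Y(2) lin_sol_q, where s = 0]) (simp add: Y(1))
  have YA: "Y s *v (A *v x0 0) = A *v x0 s" for s by (rule lin_sol_unique[OF Y(2) lin_sol_Ax0, where s = 0]) (simp add: Y(1))
  have pY: "p1 s \<bullet> (Y s *v v) = p1 0 \<bullet> v" "p2 s \<bullet> (Y s *v v) = p2 0 \<bullet> v" for s v
    using pairing_constant[OF p1_adjoint Y(2), of s v 0] pairing_constant[OF p2_adjoint Y(2), of s v 0]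
    by (simp_all add: Y(1))
  have per0: "q (2 * pi) = q 0" "x0 (2 * pi) = x0 0" "p1 (2 * pi) = p1 0" "p2 (2 * pi) = p2 0"
    using q_periodic[of 0] x0_periodic[of 0] p1_periodic[of 0] p2_periodic[of 0] by simp_all
  \<comment> \<open>Solutions are carried from \<psi> to phase 0, where the monodromy matrix acts,
    and back. For \<psi> in one period each transport costs at most the factor \<open>C\<close>, so
    the powers have to gain 1 / (2 C^2).\<close>
  have "1 / 2 / (C * C) > 0" by (simp add: C_def)
  from deflated_monodromy_powers_small[OF Y(3,4) _ _ _ _ _ _ _ _ this, of "q 0" "A *v x0 0" "p1 0" "p2 0"]
  obtain N where N: "\<And>k v. k \<ge> N \<Longrightarrow> norm (((*v) M ^^ k) v - (p1 0 \<bullet> v) *\<^sub>R q 0 - (p2 0 \<bullet> v) *\<^sub>R (A *v x0 0))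
      \<le> 1 / 2 / (C * C) * norm v"
    using Yq[of "2 * pi"] YA[of "2 * pi"] pY[of "2 * pi"] p1_dx0[of 0] p1_Ax0[of 0] p2_dx0[of 0] p2_Ax0[of 0]
    unfolding M_def vector_derivative_x0 per0 by metis
  define m where "m = Suc N"
  have Ym: "Y (s + real k * (2 * pi)) *v v = Y s *v (((*v) M ^^ k) v)" for s k v
  proof (induction k arbitrary: v)
    case (Suc k)
    have shift: "Y (t + 2 * pi) *v v = Y t *v (M *v v)" for t
    proof -
      have "Y (t + of_int 1 * (2 * pi)) *v v = Y t *v (M *v v)"
        by (rule lin_sol_unique[OF lin_sol_shift[OF Y(2)] Y(2), where s = 0]) (simp add: Y(1) M_def)
      then show ?thesis by simp
    qed
    have "Y (s + real (Suc k) * (2 * pi)) *v v = Y ((s + real k * (2 * pi)) + 2 * pi) *v v"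
      by (simp add: algebra_simps)
    also have "\<dots> = Y s *v ((*v) M ^^ k) (M *v v)" unfolding shift Suc.IH ..
    finally show ?case by (simp add: funpow_swap1)
  qed simp
  have base: "norm (P \<psi> (y (\<psi> + real m * (2 * pi)))) \<le> 1 / 2 * norm (y \<psi>)"
    if y: "lin_sol y" and \<psi>: "\<psi> \<in> {0..2 * pi}" for y \<psi>
  proof -
    define v where "v = y 0"
    have yY: "y s = Y s *v v" for s by (rule lin_sol_unique[OF y Y(2), where s = 0]) (simp add: Y(1) v_def)
    have pM: "p1 0 \<bullet> ((*v) M ^^ k) v = p1 0 \<bullet> v" "p2 0 \<bullet> ((*v) M ^^ k) v = p2 0 \<bullet> v" for k v
    proof (induction k)
      case (Suc k)
      case 1 show ?case using pY(1)[of "2 * pi"] Suc by (simp add: M_def per0)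
      case 2 show ?case using pY(2)[of "2 * pi"] Suc by (simp add: M_def per0)
    qed simp_all
    define u where "u = ((*v) M ^^ m) v - (p1 0 \<bullet> v) *\<^sub>R q 0 - (p2 0 \<bullet> v) *\<^sub>R (A *v x0 0)"
    \<comment> \<open>The pairings with \<open>p1\<close> and \<open>p2\<close> are conserved and
      \<open>Y \<psi>\<close> carries the neutral vectors at 0 to those at \<psi>, so
      \<open>P\<close> commutes with this transport.\<close>
    have "P \<psi> (y (\<psi> + real m * (2 * pi))) = Y \<psi> *v u"
      unfolding P_def yY Ym pY pM u_def matrix_vector_mult_diff_distrib matrix_vector_mult_scaleR Yq YA ..
    also have "norm \<dots> \<le> exp (c * \<bar>\<psi> - 0\<bar>) * norm (Y 0 *v u)" by (rule c(2)[OF Y(2)])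
    also have "\<dots> \<le> C * norm u" using \<psi> c(1) by (simp add: Y(1) C_def mult_right_mono)
    also have "\<dots> \<le> C * (1 / 2 / (C * C) * norm v)"
      unfolding u_def by (intro mult_left_mono N) (auto simp: m_def C_def)
    also have "\<dots> = 1 / 2 / C * norm v" by (simp add: C_def)
    also have "\<dots> \<le> 1 / 2 / C * (C * norm (y \<psi>))"
    proof (rule mult_left_mono)
      have "norm v \<le> exp (c * \<bar>0 - \<psi>\<bar>) * norm (y \<psi>)" unfolding v_def by (rule c(2)[OF y])
      also have "\<dots> \<le> C * norm (y \<psi>)" using \<psi> c(1) by (simp add: C_def mult_right_mono)
      finally show "norm v \<le> C * norm (y \<psi>)" .
    qed (simp add: C_def)
    also have "\<dots> = 1 / 2 * norm (y \<psi>)" by (simp add: C_def)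
    finally show ?thesis .
  qed
  show thesis
  proof (rule that[of m])
    fix y \<psi> assume y: "lin_sol y"
    obtain k where k: "\<psi> + of_int k * (2 * pi) \<in> {0..<2 * pi}" by (rule reduce_mod_2pi)
    have Pk: "P (\<psi> + of_int k * (2 * pi)) = P \<psi>"
      by (rule ext) (simp add: P_def periodic_2pi_int[of x0, OF x0_periodic] periodic_2pi_int[of q, OF q_periodic]
        periodic_2pi_int[of p1, OF p1_periodic] periodic_2pi_int[of p2, OF p2_periodic])
    have "norm (P (\<psi> + of_int k * (2 * pi)) (y (\<psi> + of_int k * (2 * pi) + real m * (2 * pi) + of_int (- k) * (2 * pi))))
       \<le> 1 / 2 * norm (y (\<psi> + of_int k * (2 * pi) + of_int (- k) * (2 * pi)))"
      by (rule base[OF lin_sol_shift[OF y]]) (use k in auto)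
    then show "norm (P \<psi> (y (\<psi> + real m * (2 * pi)))) \<le> 1 / 2 * norm (y \<psi>)"
      unfolding Pk by (simp add: algebra_simps)
  qed (simp add: m_def)
qed

subsection \<open>The averaged phase equation\<close>

text \<open>The speed, per unit of \<gamma>, at which the forcing moves the phase \<psi> on the
  torus. The other arguments stand for \<beta> t and the fast phase \<alpha> t - \<phi>.\<close>

definition H :: "real \<Rightarrow> real \<Rightarrow> real \<Rightarrow> real" where
  "H \<psi> \<theta> \<phi> = p1 \<psi> \<bullet> g (x0 \<psi>, \<theta>, \<phi>)"

definition Hbar :: "real \<Rightarrow> real \<Rightarrow> real" where
  "Hbar \<psi> \<theta> = (1 / (2 * pi)) * integral {0..2 * pi} (H \<psi> \<theta>)"

abbreviation Dg :: "(real^'n) \<times> real \<times> real \<Rightarrow> (real^'n) \<times> real \<times> real \<Rightarrow> real^'n" where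
  "Dg z \<equiv> frechet_derivative g (at z)"

sublocale g: C1_map g Dg
  by (rule C_smooth_C1_map[of 0]) (use smooth_g in \<open>simp only: One_nat_def\<close>)

lemma continuous_H:
  assumes "continuous_on S a" "continuous_on S b" "continuous_on S c"
  shows "continuous_on S (\<lambda>z. H (a z) (b z) (c z))"
  unfolding H_def
  by (intro continuous_on_inner continuous_on_compose2[OF continuous_p1 assms(1)]
      continuous_on_compose2[OF g.continuous_f] continuous_on_Pair
      continuous_on_compose2[OF continuous_x0 assms(1)] assms) auto

lemma Hbar_eq: "Hbar \<psi> \<theta> = p1 \<psi> \<bullet> g1 g (x0 \<psi>) \<theta>"
proof -
  have "(\<lambda>\<phi>. g (x0 \<psi>, \<theta>, \<phi>)) integrable_on {0..2 * pi}"
    by (intro integrable_continuous_real continuous_on_compose2[OF g.continuous_f])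
      (auto intro!: continuous_intros)
  from integral_linear[OF this bounded_linear_inner_right[of "p1 \<psi>"]]
  have "integral {0..2 * pi} (H \<psi> \<theta>) = p1 \<psi> \<bullet> integral {0..2 * pi} (\<lambda>\<phi>. g (x0 \<psi>, \<theta>, \<phi>))"
    by (simp add: o_def H_def[abs_def])
  then show ?thesis by (simp add: Hbar_def g1_def)
qed

abbreviation G :: "real \<Rightarrow> real" where "G \<equiv> G1 g x0 p1"

lemma G_eq: "G \<sigma> = (1 / (2 * pi)) * integral {0..2 * pi} (\<lambda>\<theta>. Hbar (\<sigma> + \<theta>) \<theta>)"
  by (simp add: G1_def Hbar_eq)

lemma G_periodic: "G (\<sigma> + 2 * pi) = G \<sigma>"
proof -
  have "Hbar (\<psi> + 2 * pi) \<theta> = Hbar \<psi> \<theta>" for \<psi> \<theta>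
    by (simp add: Hbar_eq x0_periodic p1_periodic)
  from this[of "\<sigma> + \<theta>" \<theta> for \<theta>] show ?thesis unfolding G_eq by (simp add: add_ac)
qed

lemma continuous_Hbar:
  assumes "continuous_on S a" "continuous_on S b"
  shows "continuous_on S (\<lambda>z. Hbar (a z) (b z))"
proof -
  have "continuous_on UNIV (\<lambda>z. integral (cbox 0 (2 * pi)) (H (fst z) (snd z)))"
    by (intro integral_continuous_on_param, unfold case_prod_beta) (intro continuous_H continuous_intros)
  then have "continuous_on UNIV (\<lambda>z. Hbar (fst z) (snd z))" unfolding Hbar_def by (auto intro!: continuous_intros)
  from continuous_on_compose2[OF this continuous_on_Pair[OF assms]] show ?thesis by simp
qed

lemma continuous_G: "continuous_on S G"
proof -
  have "continuous_on UNIV (\<lambda>\<sigma>. integral (cbox 0 (2 * pi)) (\<lambda>\<theta>. Hbar (\<sigma> + \<theta>) \<theta>))"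
    by (intro integral_continuous_on_param, unfold case_prod_beta) (intro continuous_Hbar continuous_intros)
  then have "continuous_on UNIV G" unfolding G_eq[abs_def] by (auto intro!: continuous_intros)
  then show ?thesis by (rule continuous_on_subset) simp
qed

text \<open>The first summand is the derivative of \<open>p1\<close>, rewritten through the adjoint equation so that
  its continuity is that of \<open>Df\<close>.\<close>

definition H' :: "real \<Rightarrow> real \<Rightarrow> real \<Rightarrow> real" where
  "H' \<psi> \<theta> \<phi> = - (p1 \<psi> \<bullet> ((1 / \<beta>0) *\<^sub>R (Df (x0 \<psi>) (g (x0 \<psi>, \<theta>, \<phi>)) - \<alpha>0 *\<^sub>R (A *v g (x0 \<psi>, \<theta>, \<phi>)))))
    + p1 \<psi> \<bullet> Dg (x0 \<psi>, \<theta>, \<phi>) (q \<psi>, 0, 0)"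

lemma H_deriv: "((\<lambda>\<psi>. H \<psi> \<theta> \<phi>) has_real_derivative H' \<psi> \<theta> \<phi>) (at \<psi>)"
proof -
  have "((\<lambda>\<psi>. (x0 \<psi>, \<theta>, \<phi>)) has_derivative (\<lambda>h. (h *\<^sub>R q \<psi>, 0, 0))) (at \<psi>)"
    using x0_deriv[of \<psi>] by (intro has_derivative_Pair) (auto simp: has_vector_derivative_def)
  from has_derivative_compose[OF this g.has_derivative]
  have "((\<lambda>\<psi>. g (x0 \<psi>, \<theta>, \<phi>)) has_derivative (\<lambda>h. Dg (x0 \<psi>, \<theta>, \<phi>) (h *\<^sub>R q \<psi>, 0, 0))) (at \<psi>)" .
  moreover have "Dg z (h *\<^sub>R v, 0, 0) = h *\<^sub>R Dg z (v, 0, 0)" for z h v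
    using linear_scale[OF g.linear, of z h "(v, 0, 0)"] by simp
  ultimately have "((\<lambda>\<psi>. g (x0 \<psi>, \<theta>, \<phi>)) has_vector_derivative Dg (x0 \<psi>, \<theta>, \<phi>) (q \<psi>, 0, 0)) (at \<psi>)"
    by (simp add: has_vector_derivative_def)
  from bounded_bilinear.has_vector_derivative[OF bounded_bilinear_inner p1_adjoint this]
  show ?thesis
    by (simp add: H_def H'_def has_real_derivative_iff_has_vector_derivative adjoint_inner V_mult)
qed

lemma continuous_H':
  assumes "continuous_on S a" "continuous_on S b" "continuous_on S c"
  shows "continuous_on S (\<lambda>z. H' (a z) (b z) (c z))"
proof -
  have x: "continuous_on S (\<lambda>z. x0 (a z))" by (rule continuous_on_compose2[OF continuous_x0 assms(1) subset_UNIV])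
  have p: "continuous_on S (\<lambda>z. p1 (a z))" by (rule continuous_on_compose2[OF continuous_p1 assms(1) subset_UNIV])
  have q: "continuous_on S (\<lambda>z. q (a z))" by (rule continuous_on_compose2[OF continuous_q assms(1) subset_UNIV])
  have xg: "continuous_on S (\<lambda>z. (x0 (a z), b z, c z))" by (intro continuous_on_Pair x assms)
  have gg: "continuous_on S (\<lambda>z. g (x0 (a z), b z, c z))"
    by (rule continuous_on_compose2[OF g.continuous_f xg subset_UNIV])
  have 1: "continuous_on S (\<lambda>z. Df (x0 (a z)) (g (x0 (a z), b z, c z)))"
    using continuous_on_compose2[OF f.jointly_continuous continuous_on_Pair[OF x gg]] by simp
  have "continuous_on S (\<lambda>z. (q (a z), 0 :: real, 0 :: real))"
    by (intro continuous_on_Pair q continuous_on_const)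
  from continuous_on_compose2[OF g.jointly_continuous continuous_on_Pair[OF xg this]]
  have 2: "continuous_on S (\<lambda>z. Dg (x0 (a z), b z, c z) (q (a z), 0, 0))" by simp
  have 3: "continuous_on S (\<lambda>z. A *v g (x0 (a z), b z, c z))"
    by (rule bounded_linear.continuous_on[OF matrix_vector_mul_bounded_linear gg])
  show ?thesis unfolding H'_def
    by (intro continuous_on_add continuous_on_minus continuous_on_inner continuous_on_scaleR continuous_on_const
        continuous_on_diff p 1 2 3)
qed

text \<open>The Leibniz rule is applied to the mean over the fast phase and then to the one over
  \<theta>. Differentiability is what turns extrema of \<open>G\<close> into zeros of
  \<open>deriv G\<close>, and so extreme values into elements of \<open>S1\<close>.\<close>

lemma G_differentiable: "\<exists>D. (G has_real_derivative D) (at \<sigma>)"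
proof -
  have inner_deriv: "((\<lambda>\<sigma>. integral (cbox 0 (2 * pi)) (H (\<sigma> + \<theta>) \<theta>)) has_field_derivative
      integral (cbox 0 (2 * pi)) (H' (\<sigma> + \<theta>) \<theta>)) (at \<sigma> within UNIV)" for \<sigma> \<theta>
  proof (rule leibniz_rule_field_derivative[where f = "\<lambda>\<sigma>. H (\<sigma> + \<theta>) \<theta>" and fx = "\<lambda>\<sigma>. H' (\<sigma> + \<theta>) \<theta>"])
    show "((\<lambda>\<sigma>. H (\<sigma> + \<theta>) \<theta> \<phi>) has_field_derivative H' (\<sigma> + \<theta>) \<theta> \<phi>) (at \<sigma> within UNIV)" for \<sigma> \<phi>
    proof -
      have "((\<lambda>\<sigma>. \<sigma> + \<theta>) has_real_derivative 1) (at \<sigma>)" by (auto intro!: derivative_eq_intros)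
      from DERIV_chain2[OF H_deriv this] show ?thesis by simp
    qed
    show "H (\<sigma> + \<theta>) \<theta> integrable_on cbox 0 (2 * pi)" for \<sigma>
      by (intro integrable_continuous continuous_H continuous_intros)
    show "continuous_on (UNIV \<times> cbox 0 (2 * pi)) (\<lambda>(\<sigma>, \<phi>). H' (\<sigma> + \<theta>) \<theta> \<phi>)"
      unfolding case_prod_beta by (intro continuous_H' continuous_intros)
  qed auto
  have "((\<lambda>\<sigma>. integral (cbox 0 (2 * pi)) (\<lambda>\<theta>. integral (cbox 0 (2 * pi)) (H (\<sigma> + \<theta>) \<theta>))) has_field_derivative
      integral (cbox 0 (2 * pi)) (\<lambda>\<theta>. integral (cbox 0 (2 * pi)) (H' (\<sigma> + \<theta>) \<theta>))) (at \<sigma> within UNIV)"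
  proof (rule leibniz_rule_field_derivative[where f = "\<lambda>\<sigma> \<theta>. integral (cbox 0 (2 * pi)) (H (\<sigma> + \<theta>) \<theta>)", OF inner_deriv])
    have "continuous_on UNIV (\<lambda>z. integral (cbox 0 (2 * pi)) (\<lambda>\<phi>. H (fst z + snd z) (snd z) \<phi>))"
      by (intro integral_continuous_on_param, unfold case_prod_beta) (intro continuous_H continuous_intros)
    then have c: "continuous_on UNIV (\<lambda>z. integral (cbox 0 (2 * pi)) (H (fst z + snd z) (snd z)))" by simp
    show "(\<lambda>\<theta>. integral (cbox 0 (2 * pi)) (H (\<sigma> + \<theta>) \<theta>)) integrable_on cbox 0 (2 * pi)" for \<sigma>
    proof (rule integrable_continuous)
      have "continuous_on (cbox 0 (2 * pi)) (\<lambda>\<theta>. (\<sigma>, \<theta>))" by (intro continuous_on_Pair continuous_on_const continuous_on_id)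
      from continuous_on_compose2[OF c this]
      show "continuous_on (cbox 0 (2 * pi)) (\<lambda>\<theta>. integral (cbox 0 (2 * pi)) (H (\<sigma> + \<theta>) \<theta>))" by simp
    qed
    have "continuous_on (UNIV \<times> cbox 0 (2 * pi)) (\<lambda>z. integral (cbox 0 (2 * pi)) (\<lambda>\<phi>. H' (fst z + snd z) (snd z) \<phi>))"
      by (intro integral_continuous_on_param, unfold case_prod_beta) (intro continuous_H' continuous_intros)
    then show "continuous_on (UNIV \<times> cbox 0 (2 * pi)) (\<lambda>(\<sigma>, \<theta>). integral (cbox 0 (2 * pi)) (H' (\<sigma> + \<theta>) \<theta>))"
      by (simp add: case_prod_beta)
  qed auto
  from DERIV_cmult[OF this, of "(1 / (2 * pi)) * (1 / (2 * pi))"] show ?thesis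
    by (intro exI) (simp add: G_eq[abs_def] Hbar_def mult.assoc[symmetric])
qed

lemma S1_eq: "S1 g x0 p1 = critical_values G"
  by (simp add: S1_def critical_values_def)

text \<open>By periodicity the extrema over one period are global, so they are critical points even
  if attained at an end of the period.\<close>

lemma G_extremal_values:
  obtains vp vm where "G vp = G1_plus g x0 p1" "G1_plus g x0 p1 \<in> critical_values G"
    "G vm = G1_minus g x0 p1" "G1_minus g x0 p1 \<in> critical_values G"
    "\<And>x. G x \<le> G vp" "\<And>x. G vm \<le> G x"
proof -
  have ne: "{0..2 * pi} \<noteq> {}" by simp
  obtain vp where vp: "vp \<in> {0..2 * pi}" "\<And>x. x \<in> {0..2 * pi} \<Longrightarrow> G x \<le> G vp"
    using continuous_attains_sup[OF compact_Icc ne continuous_G] by blast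
  obtain vm where vm: "vm \<in> {0..2 * pi}" "\<And>x. x \<in> {0..2 * pi} \<Longrightarrow> G vm \<le> G x"
    using continuous_attains_inf[OF compact_Icc ne continuous_G] by blast
  have red: "\<exists>y\<in>{0..2 * pi}. G x = G y" for x
  proof -
    obtain k where k: "x + of_int k * (2 * pi) \<in> {0..<2 * pi}" by (rule reduce_mod_2pi)
    then show ?thesis
      using periodic_2pi_int[of G x k, OF G_periodic] by (intro bexI[of _ "x + of_int k * (2 * pi)"]) auto
  qed
  have vp': "G x \<le> G vp" and vm': "G vm \<le> G x" for x
    using red[of x] vp(2) vm(2) by auto
  have "G1_plus g x0 p1 = G vp" unfolding G1_plus_def by (intro cSup_eq_maximum) (use vp in auto)
  moreover have "G1_minus g x0 p1 = G vm" unfolding G1_minus_def by (intro cInf_eq_minimum) (use vm in auto)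
  moreover have "G vp \<in> critical_values G"
  proof -
    obtain D where D: "(G has_real_derivative D) (at vp)" using G_differentiable by blast
    then have "D = 0" by (rule DERIV_local_max[of _ _ _ 1]) (use vp' in auto)
    with D show ?thesis by (intro critical_value_intro G_periodic) simp
  qed
  moreover have "G vm \<in> critical_values G"
  proof -
    obtain D where D: "(G has_real_derivative D) (at vm)" using G_differentiable by blast
    then have "D = 0" by (rule DERIV_local_min[of _ _ _ 1]) (use vm' in auto)
    with D show ?thesis by (intro critical_value_intro G_periodic) simp
  qed
  ultimately show thesis using vp' vm' by (intro that[of vp vm]) auto
qed

text \<open>Along the unperturbed motion the phase difference \<sigma> is constant and \<theta> runs
  through exactly \<open>m\<close> periods, so that the time average is G \<sigma> without
  error.\<close>

lemma Hbar_average_over_periods: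
  "integral {0..2 * pi * real m / \<beta>0} (\<lambda>s. Hbar (\<sigma> + (\<theta> + \<beta>0 * s)) (\<theta> + \<beta>0 * s)) = 2 * pi * real m / \<beta>0 * G \<sigma>"
proof -
  have c: "continuous_on UNIV (\<lambda>\<theta>. Hbar (\<sigma> + \<theta>) \<theta>)" by (intro continuous_Hbar continuous_intros)
  have Hper: "Hbar (\<psi> + 2 * pi) \<theta> = Hbar \<psi> \<theta>" "Hbar \<psi> (\<theta> + 2 * pi) = Hbar \<psi> \<theta>" for \<psi> \<theta>
    by (simp_all add: Hbar_def H_def[abs_def] x0_periodic p1_periodic g_periodic1)
  have per: "Hbar (\<sigma> + (x + 2 * pi)) (x + 2 * pi) = Hbar (\<sigma> + x) x" for x
    using Hper(1)[of "\<sigma> + x" x] Hper(2)[of "\<sigma> + x + 2 * pi" x] by (simp add: add.assoc)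
  have "integral {0..2 * pi * real m / \<beta>0} (\<lambda>s. Hbar (\<sigma> + (\<theta> + \<beta>0 * s)) (\<theta> + \<beta>0 * s)) =
      integral {\<theta> + \<beta>0 * 0..\<theta> + \<beta>0 * (2 * pi * real m / \<beta>0)} (\<lambda>\<theta>. Hbar (\<sigma> + \<theta>) \<theta>) / \<beta>0"
    by (rule integral_affine_substitution[OF c \<beta>0_pos]) (use \<beta>0_pos in simp)
  also have "\<dots> = integral {\<theta>..\<theta> + real m * (2 * pi)} (\<lambda>\<theta>. Hbar (\<sigma> + \<theta>) \<theta>) / \<beta>0"
    using \<beta>0_pos by (simp add: mult_ac)
  also have "\<dots> = real m * integral {0..2 * pi} (\<lambda>\<theta>. Hbar (\<sigma> + \<theta>) \<theta>) / \<beta>0"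
    by (subst integral_periods[OF c per]) simp
  finally show ?thesis by (simp add: G_eq)
qed

subsection \<open>Deviation from the torus and phase reset\<close>

text \<open>The deviation from the torus point with phases \<psi> and \<phi>, seen in the frame
  rotated by -\<phi>. In this frame the linear part of its equation depends on \<psi> alone.\<close>

definition dev :: "real \<Rightarrow> real \<Rightarrow> real^'n \<Rightarrow> real^'n" where
  "dev \<psi> \<phi> x = E (- \<phi>) *v x - x0 \<psi>"

definition remainder :: "real \<Rightarrow> real^'n \<Rightarrow> real^'n" where
  "remainder \<psi> h = f (x0 \<psi> + h) - f (x0 \<psi>) - Df (x0 \<psi>) h"

text \<open>What the equation for the deviation contains beyond its linear part. By equivariance the
  rotation is absorbed into the third phase, which becomes \<alpha> t - \<phi>.\<close>

definition forcing :: "real \<Rightarrow> real \<Rightarrow> real \<Rightarrow> real \<Rightarrow> real \<Rightarrow> real \<Rightarrow> (real \<Rightarrow> real^'n) \<Rightarrow> real \<Rightarrow> real^'n" where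
  "forcing \<psi>0 \<phi>0 t0 \<alpha> \<beta> \<gamma> h s = remainder (\<psi>0 + \<beta>0 * s) (h s)
    + \<gamma> *\<^sub>R g (x0 (\<psi>0 + \<beta>0 * s) + h s, \<beta> * (t0 + s), \<alpha> * (t0 + s) - (\<phi>0 + \<alpha>0 * s))"

lemma dev_eq: "E (- \<phi>) *v x = x0 \<psi> + dev \<psi> \<phi> x"
  by (simp add: dev_def)

lemma norm_eq_dev: "norm x = norm (x0 \<psi> + dev \<psi> \<phi> x)"
  using norm_mexp[OF skew, of "- \<phi>" x] by (simp add: dev_def)

lemma norm_dev: "norm (x - E \<phi> *v x0 \<psi>) = norm (dev \<psi> \<phi> x)"
proof -
  have "x - E \<phi> *v x0 \<psi> = E \<phi> *v (E (- \<phi>) *v x - x0 \<psi>)"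
    by (simp only: matrix_vector_mult_diff_distrib mexp_minus_cancel'[OF skew])
  then show ?thesis by (simp only: norm_mexp[OF skew] dev_def)
qed

text \<open>The rotation passes through \<open>f\<close> unchanged and through \<open>g\<close> with
  a phase shift. Subtracting \<beta>0 q = f(x0) - \<alpha>0 A x0 leaves the linearization, its
  Taylor remainder and the forcing.\<close>

lemma dev_deriv:
  fixes x :: "real \<Rightarrow> real^'n" and \<psi>0 \<phi>0 t0 \<alpha> \<beta> \<gamma> s :: real
  assumes dx: "(x has_vector_derivative f (x (t0 + s)) + \<gamma> *\<^sub>R g (x (t0 + s), \<beta> * (t0 + s), \<alpha> * (t0 + s))) (at (t0 + s))"
  defines "h \<equiv> \<lambda>s. dev (\<psi>0 + \<beta>0 * s) (\<phi>0 + \<alpha>0 * s) (x (t0 + s))"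
  shows "(h has_vector_derivative \<beta>0 *\<^sub>R (V (\<psi>0 + \<beta>0 * s) *v h s) + forcing \<psi>0 \<phi>0 t0 \<alpha> \<beta> \<gamma> h s) (at s within S)"
proof -
  define \<psi> \<phi> X where "\<psi> = \<psi>0 + \<beta>0 * s" and "\<phi> = \<phi>0 + \<alpha>0 * s" and "X = x (t0 + s)"
  define F where "F = f X + \<gamma> *\<^sub>R g (X, \<beta> * (t0 + s), \<alpha> * (t0 + s))"
  have EX: "E (- \<phi>) *v X = x0 \<psi> + h s" by (simp add: h_def dev_def \<psi>_def \<phi>_def X_def)
  have "((\<lambda>s. x (1 * s + t0)) has_vector_derivative 1 *\<^sub>R F) (at s within S)"
    by (rule has_vector_derivative_compose_affine) (use dx in \<open>simp add: F_def X_def add.commute\<close>)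
  from mexp_product_deriv[OF this, of "- \<alpha>0" "- \<phi>0" A]
  have 1: "((\<lambda>s. E (- (\<phi>0 + \<alpha>0 * s)) *v x (t0 + s)) has_vector_derivative
      E (- \<phi>) *v F + (- \<alpha>0) *\<^sub>R (A *v (E (- \<phi>) *v X))) (at s within S)"
    by (simp add: \<phi>_def X_def algebra_simps)
  have "((\<lambda>s. x0 (\<beta>0 * s + \<psi>0)) has_vector_derivative \<beta>0 *\<^sub>R q (\<beta>0 * s + \<psi>0)) (at s within S)"
    by (rule has_vector_derivative_compose_affine[OF x0_deriv])
  then have 2: "((\<lambda>s. x0 (\<psi>0 + \<beta>0 * s)) has_vector_derivative \<beta>0 *\<^sub>R q \<psi>) (at s within S)"
    by (simp add: \<psi>_def add.commute)
  have EF: "E (- \<phi>) *v F = f (x0 \<psi> + h s) + \<gamma> *\<^sub>R g (x0 \<psi> + h s, \<beta> * (t0 + s), \<alpha> * (t0 + s) - \<phi>)"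
    unfolding F_def matrix_vector_right_distrib matrix_vector_mult_scaleR f_equivariant[symmetric]
      g_equivariant[symmetric] EX by simp
  have "\<beta>0 *\<^sub>R q \<psi> = f (x0 \<psi>) - \<alpha>0 *\<^sub>R (A *v x0 \<psi>)" using \<beta>0_pos by (simp add: q_def)
  moreover have "\<beta>0 *\<^sub>R (V \<psi> *v h s) = Df (x0 \<psi>) (h s) - \<alpha>0 *\<^sub>R (A *v h s)" using \<beta>0_pos by (simp add: V_mult)
  ultimately have "E (- \<phi>) *v F + (- \<alpha>0) *\<^sub>R (A *v (E (- \<phi>) *v X)) - \<beta>0 *\<^sub>R q \<psi> =
      \<beta>0 *\<^sub>R (V \<psi> *v h s) + (remainder \<psi> (h s) + \<gamma> *\<^sub>R g (x0 \<psi> + h s, \<beta> * (t0 + s), \<alpha> * (t0 + s) - \<phi>))"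
    unfolding EF EX remainder_def by (simp add: matrix_vector_right_distrib scaleR_add_right)
  with has_vector_derivative_diff[OF 1 2] show ?thesis
    unfolding \<psi>_def \<phi>_def h_def dev_def forcing_def by simp
qed

lemma P_bounded:
  obtains c where "c > 0" "\<And>\<psi> v. norm (P \<psi> v) \<le> c * norm v"
proof -
  obtain M1 where M1: "M1 > 0" "\<And>x. norm (p1 x) \<le> M1" using periodic_bounded[OF continuous_p1 p1_periodic] by metis
  obtain M2 where M2: "M2 > 0" "\<And>x. norm (p2 x) \<le> M2" using periodic_bounded[OF continuous_p2 p2_periodic] by metis
  obtain N1 where N1: "N1 > 0" "\<And>x. norm (q x) \<le> N1" using periodic_bounded[OF continuous_q q_periodic] by metis
  have cA: "continuous_on UNIV (\<lambda>\<psi>. A *v x0 \<psi>)"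
    by (rule bounded_linear.continuous_on[OF matrix_vector_mul_bounded_linear continuous_x0])
  obtain N2 where N2: "N2 > 0" "\<And>x. norm (A *v x0 x) \<le> N2" using periodic_bounded[OF cA] x0_periodic by auto
  have 1: "norm ((p \<bullet> v) *\<^sub>R w) \<le> M * N * norm v" if "norm p \<le> M" "norm w \<le> N" for p v w :: "real^'n" and M N
  proof -
    have "norm ((p \<bullet> v) *\<^sub>R w) \<le> (norm p * norm v) * norm w"
      using Cauchy_Schwarz_ineq2[of p v] by (simp add: mult_right_mono)
    also have "\<dots> \<le> (M * norm v) * N"
      using that order_trans[OF norm_ge_zero that(1)] by (intro mult_mono mult_right_mono) auto
    finally show ?thesis by (simp add: mult_ac)
  qed
  show thesis
  proof (rule that[of "1 + M1 * N1 + M2 * N2"])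
    show "1 + M1 * N1 + M2 * N2 > 0" using M1 M2 N1 N2 by (intro add_pos_pos mult_pos_pos) auto
    fix \<psi> v
    show "norm (P \<psi> v) \<le> (1 + M1 * N1 + M2 * N2) * norm v"
      unfolding P_def distrib_right mult_1
      by (intro order_trans[OF norm_triangle_ineq4] add_mono 1 M1 M2 N1 N2 order_refl)
  qed
qed

lemma p1_P: "p1 \<psi> \<bullet> P \<psi> v = 0"
  using p1_dx0[of \<psi>] p1_Ax0[of \<psi>] by (simp add: P_def inner_diff_right vector_derivative_x0)

text \<open>Shifting the phases by the neutral components of the deviation realizes the projection \<open>P\<close> up to
  an error of higher order.\<close>

lemma phase_reset:
  assumes "\<eta> > 0"
  obtains r where "r > 0" "\<And>\<psi> \<phi> x. norm (dev \<psi> \<phi> x) \<le> r \<Longrightarrow>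
    norm (dev (\<psi> + p1 \<psi> \<bullet> dev \<psi> \<phi> x) (\<phi> + p2 \<psi> \<bullet> dev \<psi> \<phi> x) x - P \<psi> (dev \<psi> \<phi> x)) \<le> \<eta> * norm (dev \<psi> \<phi> x)"
proof -
  obtain M1 where M1: "M1 > 0" "\<And>x. norm (p1 x) \<le> M1" using periodic_bounded[OF continuous_p1 p1_periodic] by metis
  obtain M2 where M2: "M2 > 0" "\<And>x. norm (p2 x) \<le> M2" using periodic_bounded[OF continuous_p2 p2_periodic] by metis
  obtain R where R: "R > 0" "\<And>x. norm (x0 x) \<le> R" using periodic_bounded[OF continuous_x0 x0_periodic] by metis
  obtain a where a: "a > 0" "\<And>v. norm (A *v v) \<le> a * norm v" using matrix_norm_bound by metis
  define \<eta>' where "\<eta>' = \<eta> / (2 * M1)"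
  have \<eta>': "\<eta>' > 0" using assms M1 by (simp add: \<eta>'_def)
  obtain r1 where r1: "r1 > 0" "\<And>x y. \<bar>x - y\<bar> \<le> r1 \<Longrightarrow> norm (q x - q y) \<le> \<eta>'"
    by (rule periodic_uniformly_continuous[OF continuous_q q_periodic \<eta>']) blast
  have E1: "norm (E c *v v - v) \<le> \<bar>c\<bar> * (a * norm v)" for c v
  proof -
    have "norm (E c *v v - E 0 *v v) \<le> (a * norm v) * \<bar>c - 0\<bar>"
    proof (rule has_vector_derivative_imp_norm_bound[where a = "- \<bar>c\<bar>" and b = "\<bar>c\<bar>" and w = "\<lambda>\<phi>. E \<phi> *v v"])
      show "((\<lambda>\<phi>. E \<phi> *v v) has_vector_derivative A *v (E s *v v)) (at s within {- \<bar>c\<bar>..\<bar>c\<bar>})" for s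
        by (rule has_vector_derivative_at_within[OF mexp_vec_deriv])
      show "norm (A *v (E s *v v)) \<le> a * norm v" for s
        using a(2)[of "E s *v v"] by (simp add: norm_mexp[OF skew])
    qed auto
    then show ?thesis unfolding mexp_0 by (simp add: mult.commute)
  qed
  have E2: "norm (E c *v v - v - c *\<^sub>R (A *v v)) \<le> \<bar>c\<bar> * (a * (\<bar>c\<bar> * (a * norm v)))" for c v
  proof -
    have "norm ((E c *v v - c *\<^sub>R (A *v v)) - (E 0 *v v - 0 *\<^sub>R (A *v v))) \<le> (a * (\<bar>c\<bar> * (a * norm v))) * \<bar>c - 0\<bar>"
    proof (rule has_vector_derivative_imp_norm_bound[where a = "- \<bar>c\<bar>" and b = "\<bar>c\<bar>" and w = "\<lambda>\<phi>. E \<phi> *v v - \<phi> *\<^sub>R (A *v v)"])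
      show "((\<lambda>\<phi>. E \<phi> *v v - \<phi> *\<^sub>R (A *v v)) has_vector_derivative A *v (E s *v v) - A *v v) (at s within {- \<bar>c\<bar>..\<bar>c\<bar>})" for s
        by (rule has_vector_derivative_diff[OF has_vector_derivative_at_within[OF mexp_vec_deriv]])
          (auto intro!: derivative_eq_intros)
      show "norm (A *v (E s *v v) - A *v v) \<le> a * (\<bar>c\<bar> * (a * norm v))" if "s \<in> {- \<bar>c\<bar>..\<bar>c\<bar>}" for s
      proof -
        have "norm (A *v (E s *v v - v)) \<le> a * (\<bar>s\<bar> * (a * norm v))"
          using a E1[of s v] by (intro order_trans[OF a(2)] mult_left_mono) auto
        also have "\<dots> \<le> a * (\<bar>c\<bar> * (a * norm v))"
          using that a by (intro mult_left_mono mult_right_mono) auto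
        finally show ?thesis by (simp add: matrix_vector_mult_diff_distrib)
      qed
    qed auto
    then show ?thesis unfolding mexp_0 by (simp add: mult.commute algebra_simps)
  qed
  have X: "norm (x0 (\<psi> + c) - x0 \<psi> - c *\<^sub>R q \<psi>) \<le> \<eta>' * \<bar>c\<bar>" if c: "\<bar>c\<bar> \<le> r1" for \<psi> c
  proof -
    have "norm ((x0 (1 * c + \<psi>) - c *\<^sub>R q \<psi>) - (x0 (1 * 0 + \<psi>) - 0 *\<^sub>R q \<psi>)) \<le> \<eta>' * \<bar>c - 0\<bar>"
    proof (rule has_vector_derivative_imp_norm_bound[where a = "- \<bar>c\<bar>" and b = "\<bar>c\<bar>" and w = "\<lambda>c. x0 (1 * c + \<psi>) - c *\<^sub>R q \<psi>"])
      show "((\<lambda>c. x0 (1 * c + \<psi>) - c *\<^sub>R q \<psi>) has_vector_derivative 1 *\<^sub>R q (1 * s + \<psi>) - q \<psi>) (at s within {- \<bar>c\<bar>..\<bar>c\<bar>})" for s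
        by (rule has_vector_derivative_diff[OF has_vector_derivative_compose_affine[OF x0_deriv]])
          (auto intro!: derivative_eq_intros)
      show "norm (1 *\<^sub>R q (1 * s + \<psi>) - q \<psi>) \<le> \<eta>'" if "s \<in> {- \<bar>c\<bar>..\<bar>c\<bar>}" for s
        using r1(2)[of "s + \<psi>" \<psi>] that c by auto
    qed auto
    then show ?thesis by (simp add: algebra_simps)
  qed
  \<comment> \<open>\<open>L\<close> collects the rotation errors: of first order on the deviation,
    of second order on \<open>x0\<close>. The choice of \<open>r\<close> makes them at most half of
    \<eta>; the other half goes to the Taylor remainder of \<open>x0\<close>, through
    \<open>\<eta>'\<close>.\<close>
  define L where "L = M2 * a + M2 * a * (M2 * a * R)"
  have L: "L > 0" using M2 a R unfolding L_def by (intro add_pos_pos mult_pos_pos) auto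
  define r where "r = min (r1 / M1) (\<eta> / (2 * L))"
  have r: "r > 0" "M1 * r \<le> r1" "L * r \<le> \<eta> / 2"
  proof -
    show "r > 0" using r1 M1 L assms by (simp add: r_def)
    have "r \<le> r1 / M1" by (simp add: r_def)
    then show "M1 * r \<le> r1" using M1 by (simp add: pos_le_divide_eq mult.commute)
    have "r \<le> \<eta> / (2 * L)" by (simp add: r_def)
    then have "r * (2 * L) \<le> \<eta>" using L by (simp add: pos_le_divide_eq)
    then show "L * r \<le> \<eta> / 2" by (simp add: mult_ac)
  qed
  show thesis
  proof (rule that[OF r(1)])
    fix \<psi> \<phi> x assume small: "norm (dev \<psi> \<phi> x) \<le> r"
    define k where "k = dev \<psi> \<phi> x"
    define c1 c2 where "c1 = p1 \<psi> \<bullet> k" and "c2 = p2 \<psi> \<bullet> k"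
    have c: "\<bar>c1\<bar> \<le> M1 * norm k" "\<bar>c2\<bar> \<le> M2 * norm k"
      unfolding c1_def c2_def
      by (rule order_trans[OF Cauchy_Schwarz_ineq2], rule mult_right_mono, use M1 M2 in auto)+
    have "dev (\<psi> + c1) (\<phi> + c2) x = E (- c2) *v (E (- \<phi>) *v x) - x0 (\<psi> + c1)"
      using mexp_add[OF skew, of "- c2" "- \<phi>" x] by (simp add: dev_def algebra_simps)
    also have "\<dots> = E (- c2) *v (x0 \<psi> + k) - x0 (\<psi> + c1)" unfolding k_def dev_eq[of \<phi> x \<psi>] ..
    \<comment> \<open>The shift by \<open>c1\<close> cancels the component of the deviation along
      \<open>q\<close>, the shift by \<open>c2\<close> the one along \<open>A *v x0\<close>; three
      small errors remain.\<close>
    also have "\<dots> - P \<psi> k = (E (- c2) *v k - k) + (E (- c2) *v x0 \<psi> - x0 \<psi> - (- c2) *\<^sub>R (A *v x0 \<psi>))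
        - (x0 (\<psi> + c1) - x0 \<psi> - c1 *\<^sub>R q \<psi>)"
      by (simp add: P_def c1_def[symmetric] c2_def[symmetric] matrix_vector_right_distrib)
    also have "norm \<dots> \<le> (M2 * norm k) * (a * r) + (M2 * norm k) * (a * ((M2 * r) * (a * R))) + \<eta>' * (M1 * norm k)"
    proof -
      have k: "norm k \<le> r" using small by (simp add: k_def)
      have "M1 * norm k \<le> M1 * r" "M2 * norm k \<le> M2 * r" using k M1 M2 by auto
      then have c': "\<bar>c1\<bar> \<le> r1" "\<bar>c2\<bar> \<le> M2 * r" using c r(2) by linarith+
      have "norm (E (- c2) *v k - k) \<le> \<bar>- c2\<bar> * (a * norm k)" by (rule E1)
      also have "\<dots> \<le> (M2 * norm k) * (a * r)"
        by (intro mult_mono) (use c k a M2 in auto)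
      finally have 1: "norm (E (- c2) *v k - k) \<le> (M2 * norm k) * (a * r)" .
      have "norm (E (- c2) *v x0 \<psi> - x0 \<psi> - (- c2) *\<^sub>R (A *v x0 \<psi>)) \<le> \<bar>- c2\<bar> * (a * (\<bar>- c2\<bar> * (a * norm (x0 \<psi>))))"
        by (rule E2)
      also have "\<dots> \<le> (M2 * norm k) * (a * ((M2 * r) * (a * R)))"
        by (intro mult_mono) (use c c' a M2 R r in auto)
      finally have 2: "norm (E (- c2) *v x0 \<psi> - x0 \<psi> - (- c2) *\<^sub>R (A *v x0 \<psi>)) \<le> (M2 * norm k) * (a * ((M2 * r) * (a * R)))" .
      have "norm (x0 (\<psi> + c1) - x0 \<psi> - c1 *\<^sub>R q \<psi>) \<le> \<eta>' * \<bar>c1\<bar>" by (rule X[OF c'(1)])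
      also have "\<dots> \<le> \<eta>' * (M1 * norm k)" using c \<eta>' by (intro mult_left_mono) auto
      finally have 3: "norm (x0 (\<psi> + c1) - x0 \<psi> - c1 *\<^sub>R q \<psi>) \<le> \<eta>' * (M1 * norm k)" .
      have tri: "norm (u + v - w) \<le> norm u + norm v + norm w" for u v w :: "real^'n"
        using norm_triangle_ineq4[of "u + v" w] norm_triangle_ineq[of u v] by linarith
      show ?thesis using tri 1 2 3 by (meson add_mono order_trans)
    qed
    also have "\<dots> = (L * r) * norm k + (\<eta> / 2) * norm k"
      using M1 by (simp add: L_def \<eta>'_def algebra_simps)
    also have "\<dots> \<le> (\<eta> / 2) * norm k + (\<eta> / 2) * norm k"
      using r(3) by (intro add_right_mono mult_right_mono) auto
    finally show "norm (dev (\<psi> + p1 \<psi> \<bullet> dev \<psi> \<phi> x) (\<phi> + p2 \<psi> \<bullet> dev \<psi> \<phi> x) x - P \<psi> (dev \<psi> \<phi> x)) \<le> \<eta> * norm (dev \<psi> \<phi> x)"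
      unfolding k_def[symmetric] c1_def[symmetric] c2_def[symmetric] by simp
  qed
qed

section \<open>A priori estimates for the forced system over one segment\<close>

abbreviation forced :: "real \<Rightarrow> real \<Rightarrow> real \<Rightarrow> real \<Rightarrow> real^'n \<Rightarrow> real^'n" where
  "forced \<alpha> \<beta> \<gamma> t y \<equiv> f y + \<gamma> *\<^sub>R g (y, \<beta> * t, \<alpha> * t)"

lemma g_lipschitz:
  obtains c where "c > 0" "\<And>y z \<psi> \<phi>. norm y \<le> R \<Longrightarrow> norm z \<le> R \<Longrightarrow> norm (g (y, \<psi>, \<phi>) - g (z, \<psi>, \<phi>)) \<le> c * norm (y - z)"
proof -
  \<comment> \<open>With both phases reduced to one period the argument of \<open>g\<close> has norm
    at most R + 4 pi, so the constant does not depend on the phases.\<close>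
  obtain c where c: "c > 0" "\<And>u v. norm u \<le> R + (2 * pi + 2 * pi) \<Longrightarrow> norm v \<le> R + (2 * pi + 2 * pi) \<Longrightarrow> norm (g u - g v) \<le> c * norm (u - v)"
    using g.lipschitz_on_ball by metis
  show thesis
  proof (rule that[OF c(1)])
    fix y z :: "real^'n" and \<psi> \<phi> assume yz: "norm y \<le> R" "norm z \<le> R"
    obtain k where k: "\<psi> + of_int k * (2 * pi) \<in> {0..<2 * pi}" by (rule reduce_mod_2pi)
    obtain l where l: "\<phi> + of_int l * (2 * pi) \<in> {0..<2 * pi}" by (rule reduce_mod_2pi)
    define \<psi>' \<phi>' where "\<psi>' = \<psi> + of_int k * (2 * pi)" and "\<phi>' = \<phi> + of_int l * (2 * pi)"
    have red: "g (u, \<psi>, \<phi>) = g (u, \<psi>', \<phi>')" for u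
      using periodic_2pi_int[of "\<lambda>\<theta>. g (u, \<theta>, \<phi>)" \<psi> k] periodic_2pi_int[of "\<lambda>\<xi>. g (u, \<psi>', \<xi>)" \<phi> l]
        g_periodic1 g_periodic2 by (simp add: \<psi>'_def \<phi>'_def)
    have "norm (u, \<psi>', \<phi>') \<le> R + (2 * pi + 2 * pi)" if "norm u \<le> R" for u :: "real^'n"
    proof -
      have "norm (\<psi>', \<phi>') \<le> \<bar>\<psi>'\<bar> + \<bar>\<phi>'\<bar>" using norm_Pair_le[of \<psi>' \<phi>'] by simp
      moreover have "norm (u, \<psi>', \<phi>') \<le> norm u + norm (\<psi>', \<phi>')" by (rule norm_Pair_le)
      moreover have "\<bar>\<psi>'\<bar> \<le> 2 * pi" "\<bar>\<phi>'\<bar> \<le> 2 * pi" using k l by (auto simp: \<psi>'_def \<phi>'_def)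
      ultimately show ?thesis using that by linarith
    qed
    from c(2)[OF this[OF yz(1)] this[OF yz(2)]]
    show "norm (g (y, \<psi>, \<phi>) - g (z, \<psi>, \<phi>)) \<le> c * norm (y - z)"
      unfolding red[of y] red[of z] by (simp add: norm_Pair)
  qed
qed

lemma forced_continues:
  assumes max: "maximal_solution (forced \<alpha> \<beta> \<gamma>) J x" and "a \<in> J" "a \<le> b"
    and bd: "\<And>t. t \<in> J \<Longrightarrow> a \<le> t \<Longrightarrow> t < b \<Longrightarrow> norm (x t) \<le> R"
  shows "b \<in> J"
proof (rule maximal_solution_continues[OF max _ _ assms(2,3) bd])
  show "continuous_on UNIV (\<lambda>(t, y). forced \<alpha> \<beta> \<gamma> t y)"
    unfolding case_prod_beta
    by (intro continuous_on_add continuous_on_scaleR continuous_on_const continuous_on_compose2[OF f.continuous_f]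
        continuous_on_compose2[OF g.continuous_f] continuous_intros) auto
  fix R
  obtain c1 where c1: "c1 > 0" "\<And>y z. norm y \<le> R \<Longrightarrow> norm z \<le> R \<Longrightarrow> norm (f y - f z) \<le> c1 * norm (y - z)"
    using f.lipschitz_on_ball by metis
  obtain c2 where c2: "c2 > 0" "\<And>y z \<psi> \<phi>. norm y \<le> R \<Longrightarrow> norm z \<le> R \<Longrightarrow> norm (g (y, \<psi>, \<phi>) - g (z, \<psi>, \<phi>)) \<le> c2 * norm (y - z)"
    using g_lipschitz by metis
  show "\<exists>\<Lambda>\<ge>0. \<forall>t y z. norm y \<le> R \<longrightarrow> norm z \<le> R \<longrightarrow>
      norm (forced \<alpha> \<beta> \<gamma> t y - forced \<alpha> \<beta> \<gamma> t z) \<le> \<Lambda> * norm (y - z)"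
  proof (intro exI[of _ "c1 + \<bar>\<gamma>\<bar> * c2"] conjI allI impI)
    show "0 \<le> c1 + \<bar>\<gamma>\<bar> * c2" using c1 c2 by simp
    fix t y z assume yz: "norm (y :: real^'n) \<le> R" "norm (z :: real^'n) \<le> R"
    have "forced \<alpha> \<beta> \<gamma> t y - forced \<alpha> \<beta> \<gamma> t z = (f y - f z) + \<gamma> *\<^sub>R (g (y, \<beta> * t, \<alpha> * t) - g (z, \<beta> * t, \<alpha> * t))"
      by (simp add: scaleR_diff_right)
    also have "norm \<dots> \<le> c1 * norm (y - z) + \<bar>\<gamma>\<bar> * (c2 * norm (y - z))"
      unfolding norm_scaleR[symmetric]
      by (rule order_trans[OF norm_triangle_ineq], rule add_mono[OF c1(2)[OF yz]])
        (simp add: mult_left_mono c2(2)[OF yz])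
    finally show "norm (forced \<alpha> \<beta> \<gamma> t y - forced \<alpha> \<beta> \<gamma> t z) \<le> (c1 + \<bar>\<gamma>\<bar> * c2) * norm (y - z)"
      by (simp add: algebra_simps)
  qed
qed

lemma remainder_small:
  assumes "\<eta> > 0"
  obtains r where "r > 0" "\<And>\<psi> h. norm h \<le> r \<Longrightarrow> norm (remainder \<psi> h) \<le> \<eta> * norm h"
proof -
  obtain R where R: "\<And>\<psi>. norm (x0 \<psi>) \<le> R" using periodic_bounded[OF continuous_x0 x0_periodic] by metis
  obtain r where r: "r > 0" "\<And>x h. norm x \<le> R \<Longrightarrow> norm h \<le> r \<Longrightarrow> norm (f (x + h) - f x - Df x h) \<le> \<eta> * norm h"
    using f.uniformly_differentiable[OF assms] by metis
  show thesis by (rule that[OF r(1)]) (simp add: remainder_def r(2) R)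
qed

lemma g_near_torus_bounded:
  obtains M where "M > 0" "\<And>\<psi> h \<theta> \<xi>. norm h \<le> 1 \<Longrightarrow> norm (g (x0 \<psi> + h, \<theta>, \<xi>)) \<le> M"
proof -
  obtain R where R: "\<And>\<psi>. norm (x0 \<psi>) \<le> R" using periodic_bounded[OF continuous_x0 x0_periodic] by metis
  obtain M where M: "M > 0" "\<And>x \<psi> \<phi>. norm x \<le> R + 1 \<Longrightarrow> norm (g (x, \<psi>, \<phi>)) \<le> M"
    using doubly_periodic_bounded[OF g.continuous_f g_periodic1 g_periodic2] by metis
  show thesis
  proof (rule that[OF M(1)])
    fix \<psi> h \<theta> \<xi> assume "norm (h :: real^'n) \<le> 1"
    then show "norm (g (x0 \<psi> + h, \<theta>, \<xi>)) \<le> M"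
      using norm_triangle_ineq[of "x0 \<psi>" h] R[of \<psi>] by (intro M(2)) linarith
  qed
qed

lemma g_near_torus_close:
  assumes "\<eta> > 0"
  obtains r where "r > 0" "\<And>\<psi> h \<theta> \<theta>' \<xi>. norm h \<le> r \<Longrightarrow> \<bar>\<theta> - \<theta>'\<bar> \<le> r \<Longrightarrow>
    norm (g (x0 \<psi> + h, \<theta>, \<xi>) - g (x0 \<psi>, \<theta>', \<xi>)) \<le> \<eta>"
proof -
  obtain R where R: "\<And>\<psi>. norm (x0 \<psi>) \<le> R" using periodic_bounded[OF continuous_x0 x0_periodic] by metis
  obtain r where r: "r > 0" "\<And>x y \<psi> \<psi>' \<phi> \<phi>'. norm x \<le> R + 1 \<Longrightarrow> norm y \<le> R + 1 \<Longrightarrow> dist x y < r \<Longrightarrow> \<bar>\<psi> - \<psi>'\<bar> < r \<Longrightarrow>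
      \<bar>\<phi> - \<phi>'\<bar> < r \<Longrightarrow> dist (g (x, \<psi>, \<phi>)) (g (y, \<psi>', \<phi>')) < \<eta>"
    by (rule doubly_periodic_uniform[OF g.continuous_f g_periodic1 g_periodic2 assms, of "R + 1"]) blast
  show thesis
  proof (rule that[of "min 1 (r / 2)"])
    fix \<psi> h \<theta> \<theta>' \<xi> assume h: "norm (h :: real^'n) \<le> min 1 (r / 2)" "\<bar>\<theta> - \<theta>'\<bar> \<le> min 1 (r / 2)"
    have "dist (g (x0 \<psi> + h, \<theta>, \<xi>)) (g (x0 \<psi>, \<theta>', \<xi>)) < \<eta>"
    proof (rule r(2))
      show "norm (x0 \<psi> + h) \<le> R + 1" using norm_triangle_ineq[of "x0 \<psi>" h] R[of \<psi>] h(1) by simp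
      show "norm (x0 \<psi>) \<le> R + 1" using R[of \<psi>] by simp
      show "dist (x0 \<psi> + h) (x0 \<psi>) < r" using h r(1) by (simp add: dist_norm)
    qed (use h r(1) in auto)
    then show "norm (g (x0 \<psi> + h, \<theta>, \<xi>) - g (x0 \<psi>, \<theta>', \<xi>)) \<le> \<eta>" by (simp add: dist_norm)
  qed (use r in auto)
qed

text \<open>As long as the deviation h is at most \<open>r\<close>, the remainder is at most |h| and
  \<open>g\<close> is bounded, and the differential inequality then keeps h below \<open>r\<close>.
  This is proved first on the part of the segment inside \<open>J\<close>; it bounds the solution
  there and so shows that \<open>J\<close> contains the whole segment.\<close>

lemma segment_bound:
  assumes "\<tau> > 0"
  obtains C r where "C \<ge> 1" "r > 0"
    "\<And>\<alpha> \<beta> \<gamma> J x t0 \<psi>0 \<phi>0 s. 0 \<le> \<gamma> \<Longrightarrow> maximal_solution (forced \<alpha> \<beta> \<gamma>) J x \<Longrightarrow> t0 \<in> J \<Longrightarrow>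
      C * (norm (dev \<psi>0 \<phi>0 (x t0)) + \<gamma>) < r \<Longrightarrow> s \<in> {0..\<tau>} \<Longrightarrow>
      t0 + s \<in> J \<and> norm (dev (\<psi>0 + \<beta>0 * s) (\<phi>0 + \<alpha>0 * s) (x (t0 + s))) \<le> C * (norm (dev \<psi>0 \<phi>0 (x t0)) + \<gamma>)"
proof -
  obtain c where c: "c > 0" "\<And>\<psi> v. norm (V \<psi> *v v) \<le> c * norm v" using V_bounded by metis
  obtain M where M: "M > 0" "\<And>\<psi> h \<theta> \<xi>. norm h \<le> 1 \<Longrightarrow> norm (g (x0 \<psi> + h, \<theta>, \<xi>)) \<le> M"
    using g_near_torus_bounded by metis
  obtain R where R: "\<And>\<psi>. norm (x0 \<psi>) \<le> R" using periodic_bounded[OF continuous_x0 x0_periodic] by metis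
  obtain r' where r': "r' > 0" "\<And>\<psi> h. norm h \<le> r' \<Longrightarrow> norm (remainder \<psi> h) \<le> 1 * norm h"
    using remainder_small[of 1] by auto
  define r where "r = min r' 1"
  have r: "r > 0" "r \<le> r'" "r \<le> 1" using r' by (auto simp: r_def)
  define p where "p = \<beta>0 * c + 1"
  have p: "p \<ge> 0" using c \<beta>0_pos by (simp add: p_def)
  define C where "C = exp ((p + 1) * \<tau>) * (1 + M)"
  have ex: "exp ((p + 1) * \<tau>) \<ge> 1" using p assms by simp
  then have C: "C \<ge> 1" unfolding C_def using M(1) mult_mono[of 1 "exp ((p + 1) * \<tau>)" 1 "1 + M"] by simp
  show thesis
  proof (rule that[OF C r(1)])
    fix \<alpha> \<beta> \<gamma> J x t0 \<psi>0 \<phi>0 s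
    assume \<gamma>: "0 \<le> \<gamma>" and max: "maximal_solution (forced \<alpha> \<beta> \<gamma>) J x" and t0: "t0 \<in> J"
      and small: "C * (norm (dev \<psi>0 \<phi>0 (x t0)) + \<gamma>) < r" and s: "s \<in> {0..\<tau>}"
    have J: "is_interval J" and dx: "\<And>t. t \<in> J \<Longrightarrow> (x has_vector_derivative forced \<alpha> \<beta> \<gamma> t (x t)) (at t)"
      using max by (auto simp: maximal_solution_def solution_on_def)
    define h where "h = (\<lambda>s. dev (\<psi>0 + \<beta>0 * s) (\<phi>0 + \<alpha>0 * s) (x (t0 + s)))"
    have h0: "h 0 = dev \<psi>0 \<phi>0 (x t0)" by (simp add: h_def)
    define h' where "h' = (\<lambda>s. \<beta>0 *\<^sub>R (V (\<psi>0 + \<beta>0 * s) *v h s) + forcing \<psi>0 \<phi>0 t0 \<alpha> \<beta> \<gamma> h s)"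
    have *: "norm (h u) \<le> C * (norm (h 0) + \<gamma>)" if u: "t0 + u \<in> J" "u \<in> {0..\<tau>}" for u
    proof -
      have inJ: "t0 + v \<in> J" if "v \<in> {0..u}" for v
        using J t0 u(1) that unfolding is_interval_1 by (meson atLeastAtMost_iff add_left_mono le_add_same_cancel1)
      have e: "exp ((p + 1) * u) * (norm (h 0) + \<gamma> * M) \<le> C * (norm (h 0) + \<gamma>)"
      proof -
        have "norm (h 0) + \<gamma> * M \<le> (1 + M) * (norm (h 0) + \<gamma>)"
          using M(1) \<gamma> by (simp add: algebra_simps)
        then have "exp ((p + 1) * u) * (norm (h 0) + \<gamma> * M) \<le> exp ((p + 1) * \<tau>) * ((1 + M) * (norm (h 0) + \<gamma>))"
          using u p M(1) \<gamma> by (intro mult_mono) auto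
        then show ?thesis by (simp add: C_def mult.assoc)
      qed
      have "norm (h u) \<le> exp ((p + 1) * u) * (norm (h 0) + \<gamma> * M)"
      proof (rule gronwall_no_exit[where r = r and h' = h'])
        show "(h has_vector_derivative h' s) (at s within {0..u})" if "s \<in> {0..u}" for s
          unfolding h_def h'_def by (rule dev_deriv) (rule dx[OF inJ[OF that]])
        show "norm (h' s) \<le> p * norm (h s) + \<gamma> * M" if "norm (h s) \<le> r" for s
        proof -
          have 1: "norm (\<beta>0 *\<^sub>R (V (\<psi>0 + \<beta>0 * s) *v h s)) \<le> \<beta>0 * c * norm (h s)"
            using c(2)[of "\<psi>0 + \<beta>0 * s" "h s"] \<beta>0_pos by (simp add: mult.assoc)
          have 2: "norm (remainder (\<psi>0 + \<beta>0 * s) (h s)) \<le> norm (h s)" using r' r that by auto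
          have 3: "norm (\<gamma> *\<^sub>R g (x0 (\<psi>0 + \<beta>0 * s) + h s, \<beta> * (t0 + s), \<alpha> * (t0 + s) - (\<phi>0 + \<alpha>0 * s))) \<le> \<gamma> * M"
            using \<gamma> r that by (auto intro!: mult_left_mono M(2))
          show ?thesis unfolding h'_def forcing_def p_def distrib_right
            using norm_triangle_le[OF add_mono[OF 1 norm_triangle_le[OF add_mono[OF 2 3]]]] by simp
        qed
        show "exp ((p + 1) * u) * (norm (h 0) + \<gamma> * M) < r" using e small h0 by simp
      qed (use p \<gamma> M(1) u in auto)
      with e show ?thesis by simp
    qed
    have "t0 + \<tau> \<in> J"
    proof (rule forced_continues[OF max t0])
      fix t assume t: "t \<in> J" "t0 \<le> t" "t < t0 + \<tau>"
      have "norm (h (t - t0)) \<le> 1" using *[of "t - t0"] t small h0 r by auto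
      moreover have "norm (x t) = norm (x0 (\<psi>0 + \<beta>0 * (t - t0)) + h (t - t0))"
        unfolding h_def using norm_eq_dev[of "x t" "\<psi>0 + \<beta>0 * (t - t0)" "\<phi>0 + \<alpha>0 * (t - t0)"] by simp
      ultimately show "norm (x t) \<le> R + 1"
        using norm_triangle_ineq[of "x0 (\<psi>0 + \<beta>0 * (t - t0))" "h (t - t0)"] R[of "\<psi>0 + \<beta>0 * (t - t0)"] by linarith
    qed (use assms in auto)
    then have "t0 + s \<in> J"
      using J t0 s unfolding is_interval_1 by (meson atLeastAtMost_iff add_left_mono le_add_same_cancel1)
    with *[OF this s] show "t0 + s \<in> J \<and> norm (dev (\<psi>0 + \<beta>0 * s) (\<phi>0 + \<alpha>0 * s) (x (t0 + s))) \<le> C * (norm (dev \<psi>0 \<phi>0 (x t0)) + \<gamma>)"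
      unfolding h0[symmetric] by (simp add: h_def)
  qed
qed

lemma linear_comparison:
  assumes "\<tau> > 0"
  obtains C where "C > 0"
    "\<And>h e b y \<psi>0. (\<And>s. s \<in> {0..\<tau>} \<Longrightarrow> (h has_vector_derivative \<beta>0 *\<^sub>R (V (\<psi>0 + \<beta>0 * s) *v h s) + e s) (at s within {0..\<tau>})) \<Longrightarrow>
      (\<And>s. s \<in> {0..\<tau>} \<Longrightarrow> norm (e s) \<le> b) \<Longrightarrow> lin_sol y \<Longrightarrow> y \<psi>0 = h 0 \<Longrightarrow>
      norm (h \<tau> - y (\<psi>0 + \<beta>0 * \<tau>)) \<le> C * b"
proof -
  obtain c where c: "c > 0" "\<And>\<psi> v. norm (V \<psi> *v v) \<le> c * norm v" using V_bounded by metis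
  define C where "C = exp ((\<beta>0 * c + 1) * \<tau>)"
  show thesis
  proof (rule that[of C])
    fix h e b y \<psi>0
    assume dh: "\<And>s. s \<in> {0..\<tau>} \<Longrightarrow> (h has_vector_derivative \<beta>0 *\<^sub>R (V (\<psi>0 + \<beta>0 * s) *v h s) + e s) (at s within {0..\<tau>})"
      and e: "\<And>s. s \<in> {0..\<tau>} \<Longrightarrow> norm (e s) \<le> b" and y: "lin_sol y" "y \<psi>0 = h 0"
    have "norm (h \<tau> - y (\<beta>0 * \<tau> + \<psi>0)) \<le> exp ((\<beta>0 * c + 1) * (\<tau> - 0)) * (norm (h 0 - y (\<beta>0 * 0 + \<psi>0)) + b)"
    proof (rule gronwall_norm[where b = \<tau> and w = "\<lambda>s. h s - y (\<beta>0 * s + \<psi>0)"])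
      fix s assume s: "s \<in> {0..\<tau>}"
      show "((\<lambda>s. h s - y (\<beta>0 * s + \<psi>0)) has_vector_derivative
          (\<beta>0 *\<^sub>R (V (\<psi>0 + \<beta>0 * s) *v h s) + e s) - \<beta>0 *\<^sub>R (V (\<beta>0 * s + \<psi>0) *v y (\<beta>0 * s + \<psi>0))) (at s within {0..\<tau>})"
        by (rule has_vector_derivative_diff[OF dh[OF s] has_vector_derivative_compose_affine[OF lin_sol_deriv[OF y(1)]]])
      have eq: "(\<beta>0 *\<^sub>R (V (\<psi>0 + \<beta>0 * s) *v h s) + e s) - \<beta>0 *\<^sub>R (V (\<beta>0 * s + \<psi>0) *v y (\<beta>0 * s + \<psi>0)) =
          \<beta>0 *\<^sub>R (V (\<psi>0 + \<beta>0 * s) *v (h s - y (\<beta>0 * s + \<psi>0))) + e s"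
        by (simp add: matrix_vector_mult_diff_distrib scaleR_diff_right add.commute)
      have bd: "norm (\<beta>0 *\<^sub>R (V (\<psi>0 + \<beta>0 * s) *v (h s - y (\<beta>0 * s + \<psi>0)))) \<le> \<beta>0 * c * norm (h s - y (\<beta>0 * s + \<psi>0))"
        using c(2)[of "\<psi>0 + \<beta>0 * s" "h s - y (\<beta>0 * s + \<psi>0)"] \<beta>0_pos by (simp add: mult.assoc)
      show "norm ((\<beta>0 *\<^sub>R (V (\<psi>0 + \<beta>0 * s) *v h s) + e s) - \<beta>0 *\<^sub>R (V (\<beta>0 * s + \<psi>0) *v y (\<beta>0 * s + \<psi>0)))
          \<le> \<beta>0 * c * norm (h s - y (\<beta>0 * s + \<psi>0)) + b"
        unfolding eq by (rule norm_triangle_le[OF add_mono[OF bd e[OF s]]])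
    qed (use assms c \<beta>0_pos order_trans[OF norm_ge_zero e[of 0]] in auto)
    then show "norm (h \<tau> - y (\<psi>0 + \<beta>0 * \<tau>)) \<le> C * b" using y(2) by (simp add: C_def add.commute)
  qed (simp add: C_def)
qed

text \<open>Pairing with \<open>p1\<close> cancels the linear part, so the change is the integral of
  \<open>p1\<close> against the forcing. Evaluating \<gamma> g on the torus instead, with \<beta> t
  replaced by \<beta> t0 + \<beta>0 s, costs per unit time \<eta> B for the Taylor remainder and
  \<eta> \<gamma> for \<open>g\<close>, up to the factor \<open>M\<close>.\<close>

lemma phase_drift:
  fixes \<tau> :: real
  assumes "\<eta> > 0"
  obtains r where "r > 0"
    "\<And>h B \<alpha> \<beta> \<gamma> t0 \<psi>0 \<phi>0 M. (\<And>s. s \<in> {0..\<tau>} \<Longrightarrow> (h has_vector_derivative \<beta>0 *\<^sub>R (V (\<psi>0 + \<beta>0 * s) *v h s)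
        + forcing \<psi>0 \<phi>0 t0 \<alpha> \<beta> \<gamma> h s) (at s within {0..\<tau>})) \<Longrightarrow>
      (\<And>s. s \<in> {0..\<tau>} \<Longrightarrow> norm (h s) \<le> B) \<Longrightarrow> B \<le> r \<Longrightarrow> 0 \<le> \<gamma> \<Longrightarrow> \<bar>\<beta> - \<beta>0\<bar> * \<tau> \<le> r \<Longrightarrow> 0 < \<tau> \<Longrightarrow>
      (\<And>\<psi>. norm (p1 \<psi>) \<le> M) \<Longrightarrow>
      \<bar>p1 (\<psi>0 + \<beta>0 * \<tau>) \<bullet> h \<tau> - p1 \<psi>0 \<bullet> h 0
        - \<gamma> * integral {0..\<tau>} (\<lambda>s. H (\<psi>0 + \<beta>0 * s) (\<beta> * t0 + \<beta>0 * s) ((\<alpha> * t0 - \<phi>0) + (\<alpha> - \<alpha>0) * s))\<bar>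
      \<le> M * (\<eta> * (B + \<gamma>)) * \<tau>"
proof -
  obtain r1 where r1: "r1 > 0" "\<And>\<psi> h. norm h \<le> r1 \<Longrightarrow> norm (remainder \<psi> h) \<le> \<eta> * norm h"
    using remainder_small[OF assms] by metis
  obtain r2 where r2: "r2 > 0" "\<And>\<psi> h \<theta> \<theta>' \<xi>. norm h \<le> r2 \<Longrightarrow> \<bar>\<theta> - \<theta>'\<bar> \<le> r2 \<Longrightarrow>
      norm (g (x0 \<psi> + h, \<theta>, \<xi>) - g (x0 \<psi>, \<theta>', \<xi>)) \<le> \<eta>"
    using g_near_torus_close[OF assms] by metis
  show thesis
  proof (rule that[of "min r1 r2"])
    fix h B \<alpha> \<beta> \<gamma> t0 \<psi>0 \<phi>0 M
    define e where "e = forcing \<psi>0 \<phi>0 t0 \<alpha> \<beta> \<gamma> h"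
    assume "\<And>s. s \<in> {0..\<tau>} \<Longrightarrow> (h has_vector_derivative \<beta>0 *\<^sub>R (V (\<psi>0 + \<beta>0 * s) *v h s)
        + forcing \<psi>0 \<phi>0 t0 \<alpha> \<beta> \<gamma> h s) (at s within {0..\<tau>})"
    then have dh: "\<And>s. s \<in> {0..\<tau>} \<Longrightarrow> (h has_vector_derivative \<beta>0 *\<^sub>R (V (\<psi>0 + \<beta>0 * s) *v h s) + e s) (at s within {0..\<tau>})"
      unfolding e_def .
    assume hB: "\<And>s. s \<in> {0..\<tau>} \<Longrightarrow> norm (h s) \<le> B" and B: "B \<le> min r1 r2" and \<gamma>: "0 \<le> \<gamma>"
      and \<beta>: "\<bar>\<beta> - \<beta>0\<bar> * \<tau> \<le> min r1 r2" and \<tau>: "0 < \<tau>" and M: "\<And>\<psi>. norm (p1 \<psi>) \<le> M"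
    define F where "F = (\<lambda>s. H (\<psi>0 + \<beta>0 * s) (\<beta> * t0 + \<beta>0 * s) ((\<alpha> * t0 - \<phi>0) + (\<alpha> - \<alpha>0) * s))"
    have contF: "continuous_on {0..\<tau>} F" unfolding F_def by (intro continuous_H continuous_intros)
    define D where "D = (\<lambda>s. p1 (\<beta>0 * s + \<psi>0) \<bullet> h s - \<gamma> * integral {0..s} F)"
    have dD: "(D has_vector_derivative p1 (\<psi>0 + \<beta>0 * s) \<bullet> e s - \<gamma> * F s) (at s within {0..\<tau>})"
      if s: "s \<in> {0..\<tau>}" for s
    proof -
      have "((\<lambda>s. p1 (\<beta>0 * s + \<psi>0)) has_vector_derivative \<beta>0 *\<^sub>R (adjoint_matrix f A \<alpha>0 \<beta>0 x0 (\<beta>0 * s + \<psi>0) *v p1 (\<beta>0 * s + \<psi>0))) (at s within {0..\<tau>})"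
        by (rule has_vector_derivative_compose_affine[OF p1_adjoint])
      from bounded_bilinear.has_vector_derivative[OF bounded_bilinear_inner this dh[OF s]]
      have 1: "((\<lambda>s. p1 (\<beta>0 * s + \<psi>0) \<bullet> h s) has_vector_derivative p1 (\<psi>0 + \<beta>0 * s) \<bullet> e s) (at s within {0..\<tau>})"
        by (simp add: adjoint_inner inner_add_right add.commute)
      have "((\<lambda>s. integral {0..s} F) has_vector_derivative F s) (at s within {0..\<tau>})"
        by (rule integral_has_vector_derivative[OF contF s])
      from has_vector_derivative_diff[OF 1 bounded_linear.has_vector_derivative[OF bounded_linear_mult_right[of \<gamma>] this]]
      show ?thesis unfolding D_def .
    qed
    have "norm (D \<tau> - D 0) \<le> M * (\<eta> * (B + \<gamma>)) * \<bar>\<tau> - 0\<bar>"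
    proof (rule has_vector_derivative_imp_norm_bound[OF dD])
      fix s assume s: "s \<in> {0..\<tau>}"
      define \<psi> where "\<psi> = \<psi>0 + \<beta>0 * s"
      define \<xi> where "\<xi> = (\<alpha> * t0 - \<phi>0) + (\<alpha> - \<alpha>0) * s"
      have \<xi>: "\<alpha> * (t0 + s) - (\<phi>0 + \<alpha>0 * s) = \<xi>" by (simp add: \<xi>_def algebra_simps)
      define d where "d = g (x0 \<psi> + h s, \<beta> * (t0 + s), \<xi>) - g (x0 \<psi>, \<beta> * t0 + \<beta>0 * s, \<xi>)"
      have "p1 \<psi> \<bullet> e s - \<gamma> * F s = p1 \<psi> \<bullet> (remainder \<psi> (h s) + \<gamma> *\<^sub>R d)"
        unfolding e_def forcing_def F_def H_def \<xi> \<psi>_def[symmetric] \<xi>_def[symmetric] d_def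
        by (simp add: inner_add_right inner_diff_right right_diff_distrib)
      also have "norm \<dots> \<le> norm (p1 \<psi>) * norm (remainder \<psi> (h s) + \<gamma> *\<^sub>R d)"
        using Cauchy_Schwarz_ineq2 by simp
      also have "\<dots> \<le> M * (\<eta> * (B + \<gamma>))"
      proof (intro mult_mono M)
        have "norm (remainder \<psi> (h s)) \<le> \<eta> * norm (h s)" using hB[OF s] B by (intro r1) auto
        also have "\<dots> \<le> \<eta> * B" using hB[OF s] assms by (intro mult_left_mono) auto
        finally have 1: "norm (remainder \<psi> (h s)) \<le> \<eta> * B" .
        have "\<bar>\<beta> * (t0 + s) - (\<beta> * t0 + \<beta>0 * s)\<bar> = \<bar>\<beta> - \<beta>0\<bar> * s"
          using s by (simp add: abs_mult[symmetric] left_diff_distrib distrib_left) (simp add: abs_mult left_diff_distrib[symmetric])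
        also have "\<dots> \<le> \<bar>\<beta> - \<beta>0\<bar> * \<tau>" using s by (intro mult_left_mono) auto
        finally have "norm d \<le> \<eta>" unfolding d_def using hB[OF s] B \<beta> by (intro r2) auto
        then have 2: "norm (\<gamma> *\<^sub>R d) \<le> \<eta> * \<gamma>" using \<gamma> mult_left_mono[of "norm d" \<eta> \<gamma>] by (simp add: mult.commute)
        show "norm (remainder \<psi> (h s) + \<gamma> *\<^sub>R d) \<le> \<eta> * (B + \<gamma>)"
          using norm_triangle_le[OF add_mono[OF 1 2]] by (simp add: distrib_left)
      qed (use order_trans[OF norm_ge_zero M] in auto)
      finally show "norm (p1 (\<psi>0 + \<beta>0 * s) \<bullet> e s - \<gamma> * F s) \<le> M * (\<eta> * (B + \<gamma>))" unfolding \<psi>_def .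
    qed (use \<tau> in auto)
    then show "\<bar>p1 (\<psi>0 + \<beta>0 * \<tau>) \<bullet> h \<tau> - p1 \<psi>0 \<bullet> h 0
        - \<gamma> * integral {0..\<tau>} (\<lambda>s. H (\<psi>0 + \<beta>0 * s) (\<beta> * t0 + \<beta>0 * s) ((\<alpha> * t0 - \<phi>0) + (\<alpha> - \<alpha>0) * s))\<bar>
      \<le> M * (\<eta> * (B + \<gamma>)) * \<tau>"
      using \<tau> unfolding D_def F_def[symmetric] by (simp add: algebra_simps)
  qed (use r1 r2 in auto)
qed

lemma averaged_drift:
  fixes m :: nat
  assumes "\<eta> > 0" "m \<ge> 1"
  defines "\<tau> \<equiv> 2 * pi * real m / \<beta>0"
  obtains \<omega>0 where "\<omega>0 > 0"
    "\<And>\<psi>0 \<theta>0 \<xi> \<omega>. \<omega> \<ge> \<omega>0 \<Longrightarrow>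
      \<bar>integral {0..\<tau>} (\<lambda>s. H (\<psi>0 + \<beta>0 * s) (\<theta>0 + \<beta>0 * s) (\<xi> + \<omega> * s)) - \<tau> * G (\<psi>0 - \<theta>0)\<bar> \<le> \<eta>"
proof -
  have \<tau>: "\<tau> > 0" using assms \<beta>0_pos by (simp add: \<tau>_def)
  have Hper: "H (\<psi> + 2 * pi) \<theta> \<xi> = H \<psi> \<theta> \<xi>" "H \<psi> (\<theta> + 2 * pi) \<xi> = H \<psi> \<theta> \<xi>" "H \<psi> \<theta> (\<xi> + 2 * pi) = H \<psi> \<theta> \<xi>" for \<psi> \<theta> \<xi>
    by (simp_all add: H_def x0_periodic p1_periodic g_periodic1 g_periodic2)
  have cH: "continuous_on UNIV (\<lambda>z. H (fst z) (fst (snd z)) (snd (snd z)))"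
    by (intro continuous_H continuous_intros)
  obtain M where M: "M > 0" "\<And>\<psi> \<theta> \<xi>. \<bar>H \<psi> \<theta> \<xi>\<bar> \<le> M"
  proof -
    \<comment> \<open>\<open>H\<close> is periodic in all three phases. The first one takes the
      place of the space variable here, and the bound is then extended by periodicity.\<close>
    obtain M where M: "M > 0" "\<And>\<psi> \<theta> \<xi>. norm (\<psi> :: real) \<le> 2 * pi \<Longrightarrow> norm (H (fst (\<psi>, \<theta> :: real, \<xi> :: real)) (fst (snd (\<psi>, \<theta>, \<xi>))) (snd (snd (\<psi>, \<theta>, \<xi>)))) \<le> M"
      by (rule doubly_periodic_bounded[OF cH, of "2 * pi"]) (auto simp: Hper)
    have "\<bar>H \<psi> \<theta> \<xi>\<bar> \<le> M" for \<psi> \<theta> \<xi>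
    proof -
      obtain k where k: "\<psi> + of_int k * (2 * pi) \<in> {0..<2 * pi}" by (rule reduce_mod_2pi)
      have "H \<psi> \<theta> \<xi> = H (\<psi> + of_int k * (2 * pi)) \<theta> \<xi>"
        using periodic_2pi_int[of "\<lambda>\<psi>. H \<psi> \<theta> \<xi>" \<psi> k] Hper by simp
      then show ?thesis using M(2)[of "\<psi> + of_int k * (2 * pi)" \<theta> \<xi>] k by simp
    qed
    then show thesis using M(1) that by blast
  qed
  define \<eta>' where "\<eta>' = \<eta> / (4 * \<tau>)"
  have \<eta>': "\<eta>' > 0" unfolding \<eta>'_def using assms(1) \<tau> by (intro divide_pos_pos mult_pos_pos) auto
  obtain r where r: "r > 0" "\<And>\<psi> \<psi>' \<theta> \<theta>' \<xi>. \<bar>\<psi> - \<psi>'\<bar> < r \<Longrightarrow> \<bar>\<theta> - \<theta>'\<bar> < r \<Longrightarrow> \<bar>H \<psi> \<theta> \<xi> - H \<psi>' \<theta>' \<xi>\<bar> \<le> \<eta>'"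
  proof -
    obtain r where r: "r > 0" "\<And>\<psi> \<psi>' :: real. \<And>\<theta> \<theta>' \<xi> \<xi>'. norm \<psi> \<le> 2 * pi + 1 \<Longrightarrow> norm \<psi>' \<le> 2 * pi + 1 \<Longrightarrow> dist \<psi> \<psi>' < r \<Longrightarrow> \<bar>\<theta> - \<theta>'\<bar> < r \<Longrightarrow>
        \<bar>\<xi> - \<xi>'\<bar> < r \<Longrightarrow> dist (H (fst (\<psi>, \<theta> :: real, \<xi> :: real)) (fst (snd (\<psi>, \<theta>, \<xi>))) (snd (snd (\<psi>, \<theta>, \<xi>)))) (H (fst (\<psi>', \<theta>', \<xi>')) (fst (snd (\<psi>', \<theta>', \<xi>'))) (snd (snd (\<psi>', \<theta>', \<xi>')))) < \<eta>'"
      by (rule doubly_periodic_uniform[OF cH _ _ \<eta>', of "2 * pi + 1"]) (auto simp: Hper)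
    show thesis
    proof (rule that[of "min 1 r"])
      fix \<psi> \<psi>' \<theta> \<theta>' \<xi> assume a: "\<bar>\<psi> - \<psi>'\<bar> < min 1 r" "\<bar>\<theta> - \<theta>'\<bar> < min 1 r"
      obtain k where k: "\<psi> + of_int k * (2 * pi) \<in> {0..<2 * pi}" by (rule reduce_mod_2pi)
      have red: "H u v w = H (u + of_int k * (2 * pi)) v w" for u v w
        using periodic_2pi_int[of "\<lambda>\<psi>. H \<psi> v w" u k] Hper by simp
      have "dist (H (\<psi> + of_int k * (2 * pi)) \<theta> \<xi>) (H (\<psi>' + of_int k * (2 * pi)) \<theta>' \<xi>) < \<eta>'"
        using r(2)[of "\<psi> + of_int k * (2 * pi)" "\<psi>' + of_int k * (2 * pi)" \<theta> \<theta>' \<xi> \<xi>] r(1) a k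
        by (auto simp: dist_real_def)
      then show "\<bar>H \<psi> \<theta> \<xi> - H \<psi>' \<theta>' \<xi>\<bar> \<le> \<eta>'"
        by (simp add: red[of \<psi> \<theta> \<xi>] red[of \<psi>' \<theta>' \<xi>] dist_real_def)
    qed (use r in auto)
  qed
  define r' where "r' = r / (2 * \<beta>0)"
  have r': "r' > 0" "\<beta>0 * r' < r" using r(1) \<beta>0_pos by (auto simp: r'_def)
  \<comment> \<open>The first entry makes the fast period at most \<open>r'\<close>, so that
    freezing the slow phases costs \<open>2 * \<eta>' * \<tau> = \<eta> / 2\<close>; the second
    bounds the cost of the incomplete period by \<eta> / 2.\<close>
  define \<omega>0 where "\<omega>0 = max (2 * pi / r') (8 * pi * M / \<eta>)"
  show thesis
  proof (rule that[of \<omega>0])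
    show pos: "\<omega>0 > 0" using r' by (simp add: \<omega>0_def less_max_iff_disj)
    fix \<psi>0 \<theta>0 \<xi> \<omega> assume \<omega>: "\<omega> \<ge> \<omega>0"
    have w: "\<omega> > 0" "2 * pi / r' \<le> \<omega>" "8 * pi * M / \<eta> \<le> \<omega>" using \<omega> pos by (auto simp: \<omega>0_def)
    have w2: "2 * pi / \<omega> \<le> r'" "2 * M * (2 * pi / \<omega>) \<le> \<eta> / 2"
      using w r' assms(1) by (simp_all add: field_simps)
    have "\<bar>integral {0..\<tau>} (\<lambda>s. H (\<psi>0 + \<beta>0 * s) (\<theta>0 + \<beta>0 * s) (\<xi> + \<omega> * s)) -
        integral {0..\<tau>} (\<lambda>s. (1 / (2 * pi)) * integral {0..2 * pi} (H (\<psi>0 + \<beta>0 * s) (\<theta>0 + \<beta>0 * s)))\<bar>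
      \<le> 2 * \<eta>' * \<tau> + 2 * M * (2 * pi / \<omega>)"
    proof (rule fast_phase_average[where F = "\<lambda>s. H (\<psi>0 + \<beta>0 * s) (\<theta>0 + \<beta>0 * s)", OF _ _ _ _ w(1) w2(1)])
      show "continuous_on UNIV (\<lambda>(s, \<xi>). H (\<psi>0 + \<beta>0 * s) (\<theta>0 + \<beta>0 * s) \<xi>)"
        unfolding case_prod_beta by (intro continuous_H continuous_intros)
      fix s s' \<xi> :: real assume "\<bar>s - s'\<bar> \<le> r'"
      then have "\<beta>0 * \<bar>s - s'\<bar> \<le> \<beta>0 * r'" using \<beta>0_pos by simp
      moreover have "\<bar>\<beta>0 * s - \<beta>0 * s'\<bar> = \<beta>0 * \<bar>s - s'\<bar>"
        using \<beta>0_pos by (simp add: right_diff_distrib[symmetric] abs_mult)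
      ultimately have "\<bar>\<beta>0 * s - \<beta>0 * s'\<bar> < r" using r'(2) by linarith
      then show "\<bar>H (\<psi>0 + \<beta>0 * s) (\<theta>0 + \<beta>0 * s) \<xi> - H (\<psi>0 + \<beta>0 * s') (\<theta>0 + \<beta>0 * s') \<xi>\<bar> \<le> \<eta>'"
        by (intro r(2)) auto
    qed (use M Hper \<tau> in auto)
    also have "2 * \<eta>' * \<tau> = \<eta> / 2" using \<tau> by (simp add: \<eta>'_def)
    also have "integral {0..\<tau>} (\<lambda>s. (1 / (2 * pi)) * integral {0..2 * pi} (H (\<psi>0 + \<beta>0 * s) (\<theta>0 + \<beta>0 * s))) = \<tau> * G (\<psi>0 - \<theta>0)"
      using Hbar_average_over_periods[of m "\<psi>0 - \<theta>0" \<theta>0] unfolding \<tau>_def Hbar_def by (simp add: mult_ac)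
    finally show "\<bar>integral {0..\<tau>} (\<lambda>s. H (\<psi>0 + \<beta>0 * s) (\<theta>0 + \<beta>0 * s) (\<xi> + \<omega> * s)) - \<tau> * G (\<psi>0 - \<theta>0)\<bar> \<le> \<eta>"
      using w2(2) by linarith
  qed
qed

subsection \<open>One step of the reset dynamics\<close>

text \<open>The neutral component left over by the previous reset enters the error of the recursion for
  \<open>\<psi> - \<beta> t\<close> (last clause). All errors there have to be of order \<open>o(\<gamma>)\<close>, hence the factor \<open>\<eta>\<close> in the
  third clause.\<close>

definition reset_step :: "real \<Rightarrow> real \<Rightarrow> real \<Rightarrow> real \<Rightarrow> real \<Rightarrow> real set \<Rightarrow> (real \<Rightarrow> real^'n) \<Rightarrow> real \<Rightarrow>
    real \<times> real \<Rightarrow> real \<times> real \<Rightarrow> bool" where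
  "reset_step \<tau> C \<eta> \<beta> \<gamma> J x t z z' \<longleftrightarrow>
    (\<forall>s\<in>{0..\<tau>}. t + s \<in> J \<and> norm (dev (fst z + \<beta>0 * s) (snd z + \<alpha>0 * s) (x (t + s))) \<le> C * (norm (dev (fst z) (snd z) (x t)) + \<gamma>)) \<and>
    norm (dev (fst z') (snd z') (x (t + \<tau>))) \<le> (1 / 2 + C * \<eta>) * norm (dev (fst z) (snd z) (x t)) + C * \<gamma> \<and>
    \<bar>p1 (fst z') \<bullet> dev (fst z') (snd z') (x (t + \<tau>))\<bar> \<le> C * \<eta> * (norm (dev (fst z) (snd z) (x t)) + \<gamma>) \<and>
    \<bar>(fst z' - \<beta> * (t + \<tau>)) - (fst z - \<beta> * t) - (\<gamma> * (\<tau> * G (fst z - \<beta> * t)) - (\<beta> - \<beta>0) * \<tau>) - p1 (fst z) \<bullet> dev (fst z) (snd z) (x t)\<bar>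
      \<le> C * \<eta> * (norm (dev (fst z) (snd z) (x t)) + \<gamma>)"

text \<open>The order of the quantifiers matters: \<tau> and \<open>C\<close> are fixed before
  \<eta>, so that C \<eta> can be made small both in the contraction factor and in comparison with
  the drift.\<close>

lemma one_step:
  fixes Mw :: real
  assumes "Mw > 0"
  obtains \<tau> C where "\<tau> > 0" "C > 0"
    "\<And>\<eta>. 0 < \<eta> \<Longrightarrow> \<eta> \<le> 1 \<Longrightarrow> \<exists>r>0. \<exists>\<gamma>1>0. \<exists>\<alpha>1>0. \<forall>\<alpha> \<beta> \<gamma> J x t z.
      \<alpha> \<ge> \<alpha>1 \<longrightarrow> 0 < \<gamma> \<longrightarrow> \<gamma> \<le> \<gamma>1 \<longrightarrow> \<bar>\<beta> - \<beta>0\<bar> \<le> \<gamma> * Mw \<longrightarrow>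
      maximal_solution (forced \<alpha> \<beta> \<gamma>) J x \<longrightarrow> t \<in> J \<longrightarrow> norm (dev (fst z) (snd z) (x t)) + \<gamma> \<le> r \<longrightarrow>
      (\<exists>z'. reset_step \<tau> C \<eta> \<beta> \<gamma> J x t z z')"
proof -
  obtain m :: nat where m: "m \<ge> 1" "\<And>y \<psi>. lin_sol y \<Longrightarrow> norm (P \<psi> (y (\<psi> + real m * (2 * pi)))) \<le> 1 / 2 * norm (y \<psi>)"
    using projected_flow_contracts by metis
  define \<tau> where "\<tau> = 2 * pi * real m / \<beta>0"
  have \<tau>: "\<tau> > 0" using m(1) \<beta>0_pos by (simp add: \<tau>_def)
  have b\<tau>: "\<beta>0 * \<tau> = real m * (2 * pi)" using \<beta>0_pos by (simp add: \<tau>_def)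
  obtain C1 r1 where C1: "C1 \<ge> 1" and r1: "r1 > 0" and seg:
    "\<And>\<alpha> \<beta> \<gamma> J x t0 \<psi>0 \<phi>0 s. 0 \<le> \<gamma> \<Longrightarrow> maximal_solution (forced \<alpha> \<beta> \<gamma>) J x \<Longrightarrow> t0 \<in> J \<Longrightarrow>
      C1 * (norm (dev \<psi>0 \<phi>0 (x t0)) + \<gamma>) < r1 \<Longrightarrow> s \<in> {0..\<tau>} \<Longrightarrow>
      t0 + s \<in> J \<and> norm (dev (\<psi>0 + \<beta>0 * s) (\<phi>0 + \<alpha>0 * s) (x (t0 + s))) \<le> C1 * (norm (dev \<psi>0 \<phi>0 (x t0)) + \<gamma>)"
    by (rule segment_bound[OF \<tau>]) blast
  obtain C2 where C2: "C2 > 0" and comp: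
    "\<And>h e b y \<psi>0. (\<And>s. s \<in> {0..\<tau>} \<Longrightarrow> (h has_vector_derivative \<beta>0 *\<^sub>R (V (\<psi>0 + \<beta>0 * s) *v h s) + e s) (at s within {0..\<tau>})) \<Longrightarrow>
      (\<And>s. s \<in> {0..\<tau>} \<Longrightarrow> norm (e s) \<le> b) \<Longrightarrow> lin_sol y \<Longrightarrow> y \<psi>0 = h 0 \<Longrightarrow>
      norm (h \<tau> - y (\<psi>0 + \<beta>0 * \<tau>)) \<le> C2 * b"
    by (rule linear_comparison[OF \<tau>]) blast
  obtain Mg where Mg: "Mg > 0" "\<And>\<psi> h \<theta> \<xi>. norm h \<le> 1 \<Longrightarrow> norm (g (x0 \<psi> + h, \<theta>, \<xi>)) \<le> Mg"
    using g_near_torus_bounded by metis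
  obtain M1 where M1: "M1 > 0" "\<And>x. norm (p1 x) \<le> M1" using periodic_bounded[OF continuous_p1 p1_periodic] by metis
  obtain CP where CP: "CP > 0" "\<And>\<psi> v. norm (P \<psi> v) \<le> CP * norm v" using P_bounded by metis
  \<comment> \<open>\<open>K1\<close> weighs the errors proportional to the initial deviation,
    \<open>K2\<close> the influence of \<gamma> on the new deviation, \<open>K3\<close> the neutral
    component left by the reset, and \<open>K4\<close> the error of the phase recursion.\<close>
  define K1 where "K1 = CP * C2 * C1 + C1"
  define K2 where "K2 = K1 + CP * C2 * Mg"
  define K3 where "K3 = (CP + 1 + M1) * C1"
  define K4 where "K4 = M1 * (C1 + 1) * \<tau> + 1"
  define C where "C = C1 + K2 + K3 + K4"
  have pos: "K1 > 0" "K3 > 0" "K4 > 0" "CP * C2 * Mg > 0"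
    using C1 C2 CP M1 Mg \<tau> unfolding K1_def K3_def K4_def by (intro add_pos_pos mult_pos_pos; simp)+
  then have K2: "K2 > 0" "K1 \<le> K2" by (simp_all add: K2_def)
  have Cge: "C > 0" "C1 \<le> C" "K1 \<le> C" "K2 \<le> C" "K3 \<le> C" "K4 \<le> C" using pos K2 C1 by (auto simp: C_def)
  show thesis
  proof (rule that[OF \<tau> Cge(1)])
    fix \<eta> :: real assume \<eta>: "0 < \<eta>" "\<eta> \<le> 1"
    obtain r2 where r2: "r2 > 0" "\<And>\<psi> h. norm h \<le> r2 \<Longrightarrow> norm (remainder \<psi> h) \<le> \<eta> * norm h"
      using remainder_small[OF \<eta>(1)] by metis
    obtain r3 where r3: "r3 > 0" "\<And>\<psi> \<phi> x. norm (dev \<psi> \<phi> x) \<le> r3 \<Longrightarrow>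
      norm (dev (\<psi> + p1 \<psi> \<bullet> dev \<psi> \<phi> x) (\<phi> + p2 \<psi> \<bullet> dev \<psi> \<phi> x) x - P \<psi> (dev \<psi> \<phi> x)) \<le> \<eta> * norm (dev \<psi> \<phi> x)"
      by (rule phase_reset[OF \<eta>(1)]) blast
    obtain r4 where r4: "r4 > 0" and drift:
      "\<And>h B \<alpha> \<beta> \<gamma> t0 \<psi>0 \<phi>0 M. (\<And>s. s \<in> {0..\<tau>} \<Longrightarrow> (h has_vector_derivative \<beta>0 *\<^sub>R (V (\<psi>0 + \<beta>0 * s) *v h s)
        + forcing \<psi>0 \<phi>0 t0 \<alpha> \<beta> \<gamma> h s) (at s within {0..\<tau>})) \<Longrightarrow>
      (\<And>s. s \<in> {0..\<tau>} \<Longrightarrow> norm (h s) \<le> B) \<Longrightarrow> B \<le> r4 \<Longrightarrow> 0 \<le> \<gamma> \<Longrightarrow> \<bar>\<beta> - \<beta>0\<bar> * \<tau> \<le> r4 \<Longrightarrow> 0 < \<tau> \<Longrightarrow>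
      (\<And>\<psi>. norm (p1 \<psi>) \<le> M) \<Longrightarrow>
      \<bar>p1 (\<psi>0 + \<beta>0 * \<tau>) \<bullet> h \<tau> - p1 \<psi>0 \<bullet> h 0
        - \<gamma> * integral {0..\<tau>} (\<lambda>s. H (\<psi>0 + \<beta>0 * s) (\<beta> * t0 + \<beta>0 * s) ((\<alpha> * t0 - \<phi>0) + (\<alpha> - \<alpha>0) * s))\<bar>
      \<le> M * (\<eta> * (B + \<gamma>)) * \<tau>"
      by (rule phase_drift[OF \<eta>(1), of \<tau>]) blast
    obtain \<omega>0 where \<omega>0: "\<omega>0 > 0" "\<And>\<psi>0 \<theta>0 \<xi> \<omega>. \<omega> \<ge> \<omega>0 \<Longrightarrow>
      \<bar>integral {0..\<tau>} (\<lambda>s. H (\<psi>0 + \<beta>0 * s) (\<theta>0 + \<beta>0 * s) (\<xi> + \<omega> * s)) - \<tau> * G (\<psi>0 - \<theta>0)\<bar> \<le> \<eta>"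
      unfolding \<tau>_def by (rule averaged_drift[OF \<eta>(1) m(1)]) blast
    obtain r5 where r5: "r5 > 0" "\<And>x y. \<bar>x - y\<bar> \<le> r5 \<Longrightarrow> norm (p1 x - p1 y) \<le> \<eta>"
      by (rule periodic_uniformly_continuous[OF continuous_p1 p1_periodic \<eta>(1)]) blast
    define \<rho> where "\<rho> = Min {1, r1 / 2, r2, r3, r4, r5 / M1}"
    have \<rho>: "\<rho> > 0" "\<rho> \<le> 1" "\<rho> < r1" "\<rho> \<le> r2" "\<rho> \<le> r3" "\<rho> \<le> r4" "\<rho> \<le> r5 / M1"
      using r1 r2(1) r3(1) r4 r5(1) M1(1) unfolding \<rho>_def by (auto simp: min_less_iff_disj)
    \<comment> \<open>Within a segment the deviation can grow by the factor \<open>C1\<close>, and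
      it has to stay below \<open>\<rho>\<close>, where all local estimates hold.\<close>
    define r where "r = \<rho> / C1"
    have r: "r > 0" "C1 * r = \<rho>" using \<rho>(1) C1 by (auto simp: r_def)
    define \<gamma>1 where "\<gamma>1 = r4 / (Mw * \<tau>)"
    define \<alpha>1 where "\<alpha>1 = \<bar>\<alpha>0\<bar> + \<omega>0"
    have \<gamma>1: "\<gamma>1 > 0" using r4 assms \<tau> by (simp add: \<gamma>1_def)
    have \<alpha>1: "\<alpha>1 > 0" using \<omega>0(1) by (simp add: \<alpha>1_def)
    show "\<exists>r>0. \<exists>\<gamma>1>0. \<exists>\<alpha>1>0. \<forall>\<alpha> \<beta> \<gamma> J x t z.
      \<alpha> \<ge> \<alpha>1 \<longrightarrow> 0 < \<gamma> \<longrightarrow> \<gamma> \<le> \<gamma>1 \<longrightarrow> \<bar>\<beta> - \<beta>0\<bar> \<le> \<gamma> * Mw \<longrightarrow>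
      maximal_solution (forced \<alpha> \<beta> \<gamma>) J x \<longrightarrow> t \<in> J \<longrightarrow> norm (dev (fst z) (snd z) (x t)) + \<gamma> \<le> r \<longrightarrow>
      (\<exists>z'. reset_step \<tau> C \<eta> \<beta> \<gamma> J x t z z')"
    proof (rule exI[of _ r], rule conjI[OF r(1)], rule exI[of _ \<gamma>1], rule conjI[OF \<gamma>1],
        rule exI[of _ \<alpha>1], rule conjI[OF \<alpha>1], intro allI impI)
      fix \<alpha> \<beta> \<gamma> :: real and J and x :: "real \<Rightarrow> real^'n" and t0 :: real and z :: "real \<times> real"
      assume \<alpha>: "\<alpha> \<ge> \<alpha>1" and \<gamma>: "0 < \<gamma>" "\<gamma> \<le> \<gamma>1" and \<beta>: "\<bar>\<beta> - \<beta>0\<bar> \<le> \<gamma> * Mw"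
        and max: "maximal_solution (forced \<alpha> \<beta> \<gamma>) J x" and t0: "t0 \<in> J"
        and sm: "norm (dev (fst z) (snd z) (x t0)) + \<gamma> \<le> r"
      define \<psi>0 \<phi>0 where "\<psi>0 = fst z" and "\<phi>0 = snd z"
      have small: "norm (dev \<psi>0 \<phi>0 (x t0)) + \<gamma> \<le> r" using sm by (simp add: \<psi>0_def \<phi>0_def)
      define h where "h = (\<lambda>s. dev (\<psi>0 + \<beta>0 * s) (\<phi>0 + \<alpha>0 * s) (x (t0 + s)))"
      define S where "S = norm (h 0) + \<gamma>"
      define B where "B = C1 * S"
      have h0: "h 0 = dev \<psi>0 \<phi>0 (x t0)" by (simp add: h_def)
      have S: "0 < S" "norm (h 0) \<le> S" "\<gamma> \<le> S" using \<gamma> unfolding S_def by (auto simp: add_nonneg_pos)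
      have "B \<le> C1 * r" using small C1 unfolding B_def S_def h0 by (intro mult_left_mono) auto
      then have B: "B \<le> \<rho>" using r by simp
      have B0: "B > 0" "S \<le> B" using S C1 mult_right_mono[of 1 C1 S] by (auto simp: B_def)
      have segm: "t0 + s \<in> J \<and> norm (h s) \<le> B" if "s \<in> {0..\<tau>}" for s
        using seg[OF less_imp_le[OF \<gamma>(1)] max t0 _ that, of \<psi>0 \<phi>0] B \<rho>(3)
        unfolding h_def[symmetric] h0[symmetric] S_def[symmetric] B_def[symmetric] h_def[THEN fun_cong, symmetric] by auto
      have bound0: "\<forall>s\<in>{0..\<tau>}. t0 + s \<in> J \<and> norm (h s) \<le> C * S"
      proof
        have "B \<le> C * S" unfolding B_def using Cge S by (intro mult_right_mono) auto
        then show "t0 + s \<in> J \<and> norm (h s) \<le> C * S" if "s \<in> {0..\<tau>}" for s using segm[OF that] by auto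
      qed
      have dx: "(x has_vector_derivative forced \<alpha> \<beta> \<gamma> t (x t)) (at t)" if "t \<in> J" for t
        using max that by (auto simp: maximal_solution_def solution_on_def)
      define e where "e = forcing \<psi>0 \<phi>0 t0 \<alpha> \<beta> \<gamma> h"
      have dh: "(h has_vector_derivative \<beta>0 *\<^sub>R (V (\<psi>0 + \<beta>0 * s) *v h s) + e s) (at s within {0..\<tau>})"
        if "s \<in> {0..\<tau>}" for s
        unfolding e_def h_def by (rule dev_deriv) (rule dx, use segm[OF that] in simp)
      have e: "norm (e s) \<le> \<eta> * B + \<gamma> * Mg" if s: "s \<in> {0..\<tau>}" for s
        unfolding e_def forcing_def
      proof (rule norm_triangle_le[OF add_mono])
        have "norm (h s) \<le> B" using segm[OF s] by simp
        then show "norm (remainder (\<psi>0 + \<beta>0 * s) (h s)) \<le> \<eta> * B"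
          using r2(2)[of "h s" "\<psi>0 + \<beta>0 * s"] B \<rho> \<eta> mult_left_mono[of "norm (h s)" B \<eta>] by linarith
        show "norm (\<gamma> *\<^sub>R g (x0 (\<psi>0 + \<beta>0 * s) + h s, \<beta> * (t0 + s), \<alpha> * (t0 + s) - (\<phi>0 + \<alpha>0 * s))) \<le> \<gamma> * Mg"
          using \<open>norm (h s) \<le> B\<close> B \<rho> \<gamma> by (auto intro!: mult_left_mono Mg(2))
      qed
      obtain y where y: "lin_sol y" "y \<psi>0 = h 0" using lin_sol_exists by blast
      define \<psi>m \<phi>m where "\<psi>m = \<psi>0 + \<beta>0 * \<tau>" and "\<phi>m = \<phi>0 + \<alpha>0 * \<tau>"
      have k: "dev \<psi>m \<phi>m (x (t0 + \<tau>)) = h \<tau>" by (simp add: h_def \<psi>m_def \<phi>m_def)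
      have cmp: "norm (h \<tau> - y \<psi>m) \<le> C2 * (\<eta> * B + \<gamma> * Mg)"
        unfolding \<psi>m_def using comp[OF dh e y] by simp
      have hB: "norm (h \<tau>) \<le> B" using segm[of \<tau>] \<tau> by simp
      have Ph: "norm (P \<psi>m (h \<tau>)) \<le> 1 / 2 * norm (h 0) + CP * (C2 * (\<eta> * B + \<gamma> * Mg))"
      proof -
        have "P \<psi>m (h \<tau>) = P \<psi>m (y \<psi>m) + P \<psi>m (h \<tau> - y \<psi>m)"
          by (simp add: P_def inner_diff_right scaleR_diff_left algebra_simps)
        moreover have "norm (P \<psi>m (y \<psi>m)) \<le> 1 / 2 * norm (h 0)"
        proof -
          have per: "P (\<psi>0 + of_int (int m) * (2 * pi)) = P \<psi>0"
            by (rule ext) (simp only: P_def periodic_2pi_int[of x0, OF x0_periodic] periodic_2pi_int[of q, OF q_periodic]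
              periodic_2pi_int[of p1, OF p1_periodic] periodic_2pi_int[of p2, OF p2_periodic])
          then have "P \<psi>m = P \<psi>0" by (simp add: \<psi>m_def b\<tau>)
          then show ?thesis using m(2)[OF y(1), of \<psi>0] by (simp add: \<psi>m_def b\<tau> y(2))
        qed
        moreover have "norm (P \<psi>m (h \<tau> - y \<psi>m)) \<le> CP * (C2 * (\<eta> * B + \<gamma> * Mg))"
          by (rule order_trans[OF CP(2)]) (rule mult_left_mono[OF cmp], use CP in simp)
        ultimately show ?thesis by (metis norm_triangle_le add_mono)
      qed
      define c1 where "c1 = p1 \<psi>m \<bullet> h \<tau>"
      define \<psi>1 \<phi>1 where "\<psi>1 = \<psi>m + c1" and "\<phi>1 = \<phi>m + p2 \<psi>m \<bullet> h \<tau>"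
      define h1 where "h1 = dev \<psi>1 \<phi>1 (x (t0 + \<tau>))"
      have reset: "norm (h1 - P \<psi>m (h \<tau>)) \<le> \<eta> * B"
      proof -
        have "norm (h1 - P \<psi>m (h \<tau>)) \<le> \<eta> * norm (h \<tau>)"
          using r3(2)[of \<psi>m \<phi>m "x (t0 + \<tau>)"] hB B \<rho> unfolding k h1_def \<psi>1_def \<phi>1_def c1_def by linarith
        also have "\<dots> \<le> \<eta> * B" using hB \<eta> by (intro mult_left_mono) auto
        finally show ?thesis .
      qed
      have bound1: "norm h1 \<le> (1 / 2 + C * \<eta>) * norm (h 0) + C * \<gamma>"
      proof -
        have "norm h1 \<le> norm (P \<psi>m (h \<tau>)) + norm (h1 - P \<psi>m (h \<tau>))" by (rule norm_triangle_sub)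
        also have "\<dots> \<le> 1 / 2 * norm (h 0) + CP * (C2 * (\<eta> * B + \<gamma> * Mg)) + \<eta> * B" using Ph reset by simp
        also have "\<dots> = 1 / 2 * norm (h 0) + K1 * \<eta> * norm (h 0) + (K1 * \<eta> + CP * C2 * Mg) * \<gamma>"
          by (simp add: B_def S_def K1_def algebra_simps)
        also have "\<dots> \<le> 1 / 2 * norm (h 0) + C * \<eta> * norm (h 0) + C * \<gamma>"
        proof (intro add_mono mult_right_mono order_refl)
          have "K1 * \<eta> \<le> K1 * 1" using \<eta> pos by (intro mult_left_mono) auto
          then show "K1 * \<eta> + CP * C2 * Mg \<le> C" using Cge by (simp add: K2_def)
        qed (use Cge \<eta> \<gamma> in auto)
        finally show ?thesis by (simp add: algebra_simps)
      qed
      have bound2: "\<bar>p1 \<psi>1 \<bullet> h1\<bar> \<le> C * \<eta> * S"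
      proof -
        have "\<bar>c1\<bar> \<le> M1 * norm (h \<tau>)" unfolding c1_def
          by (rule order_trans[OF Cauchy_Schwarz_ineq2], rule mult_right_mono, use M1 in auto)
        also have "\<dots> \<le> M1 * (r5 / M1)" using hB B \<rho>(7) M1 by (intro mult_left_mono) auto
        finally have "\<bar>\<psi>1 - \<psi>m\<bar> \<le> r5" using M1 by (simp add: \<psi>1_def)
        then have p: "norm (p1 \<psi>1 - p1 \<psi>m) \<le> \<eta>" by (rule r5(2))
        have "norm h1 \<le> norm (P \<psi>m (h \<tau>)) + norm (h1 - P \<psi>m (h \<tau>))" by (rule norm_triangle_sub)
        also have "\<dots> \<le> CP * B + 1 * B"
          using order_trans[OF CP(2)[of \<psi>m "h \<tau>"] mult_left_mono[OF hB]] CP(1) reset mult_right_mono[OF \<eta>(2), of B] B0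
          by linarith
        finally have n1: "norm h1 \<le> (CP + 1) * B" by (simp add: algebra_simps)
        \<comment> \<open>\<open>p1 \<psi>m\<close> annihilates the range of
          \<open>P \<psi>m\<close>, so both terms carry a factor \<eta>: the first because the reset
          moves \<psi> by at most \<open>r5\<close>, the second by the accuracy of the
          reset.\<close>
        have "p1 \<psi>1 \<bullet> h1 = (p1 \<psi>1 - p1 \<psi>m) \<bullet> h1 + p1 \<psi>m \<bullet> (h1 - P \<psi>m (h \<tau>))"
          by (simp add: inner_diff_left inner_diff_right p1_P)
        also have "\<bar>\<dots>\<bar> \<le> \<eta> * ((CP + 1) * B) + M1 * (\<eta> * B)"
        proof (rule order_trans[OF abs_triangle_ineq add_mono])
          show "\<bar>(p1 \<psi>1 - p1 \<psi>m) \<bullet> h1\<bar> \<le> \<eta> * ((CP + 1) * B)"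
            by (rule order_trans[OF Cauchy_Schwarz_ineq2], rule mult_mono[OF p n1], use \<eta> in auto)
          show "\<bar>p1 \<psi>m \<bullet> (h1 - P \<psi>m (h \<tau>))\<bar> \<le> M1 * (\<eta> * B)"
            by (rule order_trans[OF Cauchy_Schwarz_ineq2], rule mult_mono[OF M1(2) reset], use M1 in auto)
        qed
        also have "\<dots> = K3 * (\<eta> * S)" by (simp add: K3_def B_def algebra_simps)
        also have "\<dots> \<le> C * (\<eta> * S)" using Cge \<eta> S by (intro mult_right_mono) auto
        finally show ?thesis by (simp add: mult.assoc)
      qed
      define I where "I = integral {0..\<tau>} (\<lambda>s. H (\<psi>0 + \<beta>0 * s) (\<beta> * t0 + \<beta>0 * s) ((\<alpha> * t0 - \<phi>0) + (\<alpha> - \<alpha>0) * s))"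
      have "\<bar>\<beta> - \<beta>0\<bar> * \<tau> \<le> (\<gamma>1 * Mw) * \<tau>"
        using order_trans[OF \<beta> mult_right_mono[OF \<gamma>(2)]] assms \<tau> by (intro mult_right_mono) auto
      also have "\<dots> = r4" using assms \<tau> by (simp add: \<gamma>1_def)
      finally have \<beta>r: "\<bar>\<beta> - \<beta>0\<bar> * \<tau> \<le> r4" .
      have d1: "\<bar>c1 - p1 \<psi>0 \<bullet> h 0 - \<gamma> * I\<bar> \<le> M1 * (\<eta> * (B + \<gamma>)) * \<tau>"
        unfolding c1_def \<psi>m_def I_def
        by (rule drift[OF dh[unfolded e_def] conjunct2[OF segm] _ _ \<beta>r \<tau> M1(2)]) (use B \<rho> \<gamma> in auto)
      have d2: "\<bar>I - \<tau> * G (\<psi>0 - \<beta> * t0)\<bar> \<le> \<eta>"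
        unfolding I_def by (rule \<omega>0(2)) (use \<alpha> in \<open>auto simp: \<alpha>1_def\<close>)
      have bound3: "\<bar>(\<psi>1 - \<beta> * (t0 + \<tau>)) - (\<psi>0 - \<beta> * t0) - (\<gamma> * (\<tau> * G (\<psi>0 - \<beta> * t0)) - (\<beta> - \<beta>0) * \<tau>) - p1 \<psi>0 \<bullet> h 0\<bar> \<le> C * \<eta> * S"
      proof -
        \<comment> \<open>The new phase is \<psi>0 + \<beta>0 \<tau> + c1, so \<psi> - \<beta> t
          grows by c1 - (\<beta> - \<beta>0) \<tau>; \<open>c1\<close> is then compared with the
          averaged drift.\<close>
        have "(\<psi>1 - \<beta> * (t0 + \<tau>)) - (\<psi>0 - \<beta> * t0) - (\<gamma> * (\<tau> * G (\<psi>0 - \<beta> * t0)) - (\<beta> - \<beta>0) * \<tau>) - p1 \<psi>0 \<bullet> h 0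
            = (c1 - p1 \<psi>0 \<bullet> h 0 - \<gamma> * I) + \<gamma> * (I - \<tau> * G (\<psi>0 - \<beta> * t0))"
          by (simp add: \<psi>1_def \<psi>m_def algebra_simps)
        also have "\<bar>\<dots>\<bar> \<le> M1 * (\<eta> * (B + \<gamma>)) * \<tau> + \<gamma> * \<eta>"
          by (rule order_trans[OF abs_triangle_ineq], rule add_mono[OF d1])
            (use \<gamma> d2 in \<open>simp add: abs_mult mult_left_mono\<close>)
        also have "\<dots> \<le> M1 * (\<eta> * (B + S)) * \<tau> + S * \<eta>"
          using M1 \<eta> \<tau> S by (intro add_mono mult_right_mono mult_left_mono) auto
        also have "\<dots> = K4 * (\<eta> * S)" by (simp add: K4_def B_def algebra_simps)
        also have "\<dots> \<le> C * (\<eta> * S)" using Cge \<eta> S by (intro mult_right_mono) auto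
        finally show ?thesis by (simp add: mult.assoc)
      qed
      show "\<exists>z'. reset_step \<tau> C \<eta> \<beta> \<gamma> J x t0 z z'"
        unfolding reset_step_def \<psi>0_def[symmetric] \<phi>0_def[symmetric] h0[symmetric] S_def[symmetric]
        by (rule exI[of _ "(\<psi>1, \<phi>1)"], unfold fst_conv snd_conv h1_def[symmetric])
          (intro conjI bound1 bound2 bound3 bound0[unfolded h_def])
    qed
  qed
qed

end

subsection \<open>Locking\<close>

lemma C_smooth_Suc_imp: "C_smooth (Suc k) f \<Longrightarrow> C_smooth k f"
proof (induction k arbitrary: f)
  case 0
  from C_smooth_continuous[OF this] show ?case by simp
next
  case (Suc k)
  have "C_smooth k (\<lambda>x. frechet_derivative f (at x) v)" for v
    using Suc.prems by (intro Suc.IH) (simp only: C_smooth.simps(2)[of "Suc k" f])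
  then show ?case using Suc.prems by simp
qed

lemma C_smooth_mono: "C_smooth k f \<Longrightarrow> j \<le> k \<Longrightarrow> C_smooth j f"
  by (induction k rule: full_nat_induct) (metis C_smooth_Suc_imp le_SucE le_zero_eq not0_implies_Suc order_refl)

context forced_torus
begin

theorem frequency_locking:
  assumes "\<epsilon> > 0" "\<epsilon>1 > 0"
  shows "\<exists>\<gamma>1>0. \<exists>\<alpha>1>0. \<exists>\<delta>>0.
    \<forall>\<alpha> \<beta> \<gamma>. \<alpha> > 0 \<longrightarrow> \<beta> > 0 \<longrightarrow> \<alpha> \<ge> \<alpha>1 \<longrightarrow> 0 \<le> \<gamma> \<longrightarrow> \<gamma> \<le> \<gamma>1 \<longrightarrow>
      \<gamma> * G1_minus g x0 p1 < \<beta> - \<beta>0 \<longrightarrow> \<beta> - \<beta>0 < \<gamma> * G1_plus g x0 p1 \<longrightarrow>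
      infdist ((\<beta> - \<beta>0) / \<gamma>) (S1 g x0 p1) \<ge> \<epsilon> \<longrightarrow>
      (\<forall>J x t0. maximal_solution (forced \<alpha> \<beta> \<gamma>) J x \<longrightarrow>
         t0 \<in> J \<longrightarrow> infdist (x t0) (torus2 A x0) < \<delta> \<longrightarrow>
         (\<exists>\<sigma> T. \<forall>t>T. t \<in> J \<and> (INF \<phi>. norm (x t - E \<phi> *v x0 (\<beta> * t + \<sigma>))) < \<epsilon>1))"
proof -
  obtain vp vm where v: "G vp = G1_plus g x0 p1" "G1_plus g x0 p1 \<in> critical_values G"
    "G vm = G1_minus g x0 p1" "G1_minus g x0 p1 \<in> critical_values G"
    using G_extremal_values by metis
  obtain M where M: "M > 0" "\<And>x. \<bar>G x\<bar> \<le> M"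
    using periodic_bounded[OF continuous_G G_periodic] by (metis real_norm_def)
  obtain \<tau> C where \<tau>: "\<tau> > 0" and C: "C > 0" and step: "\<And>\<eta>. 0 < \<eta> \<Longrightarrow> \<eta> \<le> 1 \<Longrightarrow> \<exists>r>0. \<exists>\<gamma>1>0. \<exists>\<alpha>1>0. \<forall>\<alpha> \<beta> \<gamma> J x t z.
      \<alpha> \<ge> \<alpha>1 \<longrightarrow> 0 < \<gamma> \<longrightarrow> \<gamma> \<le> \<gamma>1 \<longrightarrow> \<bar>\<beta> - \<beta>0\<bar> \<le> \<gamma> * M \<longrightarrow>
      maximal_solution (forced \<alpha> \<beta> \<gamma>) J x \<longrightarrow> t \<in> J \<longrightarrow> norm (dev (fst z) (snd z) (x t)) + \<gamma> \<le> r \<longrightarrow>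
      (\<exists>z'. reset_step \<tau> C \<eta> \<beta> \<gamma> J x t z z')"
    by (rule one_step[OF M(1)]) blast
  have "\<epsilon>1 / 2 > 0" using assms by simp
  then obtain r6 where r6: "r6 > 0" "\<And>x y. \<bar>x - y\<bar> \<le> r6 \<Longrightarrow> norm (x0 x - x0 y) \<le> \<epsilon>1 / 2"
    by (rule periodic_uniformly_continuous[OF continuous_x0 x0_periodic]) blast
  \<comment> \<open>Half of \<open>r6\<close> serves the trapping of the reset phases, half the
    drift of \<psi> - \<beta> t within one segment.\<close>
  define \<epsilon>2 where "\<epsilon>2 = r6 / 2"
  have \<epsilon>2: "\<epsilon>2 > 0" using r6 by (simp add: \<epsilon>2_def)
  obtain \<eta>0 where \<eta>0: "\<eta>0 > 0" "\<And>w a. infdist w (critical_values G) \<ge> \<epsilon> \<Longrightarrow> \<exists>v\<in>{a..a + \<epsilon>2}. \<bar>G v - w\<bar> > \<eta>0"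
    by (rule noncritical_level_gap[OF continuous_G G_periodic assms(1) \<epsilon>2]) blast
  \<comment> \<open>The cap \<epsilon> / 2 makes the extreme values of \<open>G\<close>, which are
    at least \<epsilon> away from \<open>w\<close>, exceed the tolerance strictly, so that they
    yield barriers of both kinds.\<close>
  define \<eta>b where "\<eta>b = min \<eta>0 (\<epsilon> / 2)"
  have \<eta>b: "\<eta>b > 0" "\<eta>b \<le> \<eta>0" "\<eta>b < \<epsilon>" using \<eta>0 assms by (auto simp: \<eta>b_def)
  have "\<eta>b / 2 > 0" using \<eta>b by simp
  then obtain rb where rb: "rb > 0" "\<And>x y. \<bar>x - y\<bar> \<le> rb \<Longrightarrow> \<bar>G x - G y\<bar> \<le> \<eta>b / 2"
    by (rule periodic_uniformly_continuous[OF continuous_G G_periodic]) (unfold real_norm_def, blast)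
  \<comment> \<open>A recursion with factor 3/4 and increment C \<gamma> has the limit 4 C \<gamma>.
    One \<gamma> is added for the transient and one because the estimates involve the deviation plus
    \<gamma>.\<close>
  define D where "D = 4 * C + 2"
  have D: "D > 0" using C by (simp add: D_def)
  \<comment> \<open>The bound 1 / (4 C) makes the contraction factor at most 3/4. The last bound
    keeps the sum of two errors C \<eta> D \<gamma> in the phase recursion below \<gamma> \<tau>
    \<eta>b / 2, which the barriers tolerate.\<close>
  define \<eta> where "\<eta> = min 1 (min (1 / (4 * C)) (\<eta>b * \<tau> / (4 * (C * D))))"
  have \<eta>: "0 < \<eta>" "\<eta> \<le> 1" using C D \<eta>b \<tau> by (auto simp: \<eta>_def)
  have C\<eta>: "C * \<eta> \<le> 1 / 4"
  proof -
    have "\<eta> \<le> 1 / (4 * C)" by (simp add: \<eta>_def)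
    then show ?thesis using C by (simp add: pos_le_divide_eq mult_ac)
  qed
  have CD\<eta>: "2 * (C * \<eta> * D) \<le> \<tau> * \<eta>b / 2"
  proof -
    have "\<eta> \<le> \<eta>b * \<tau> / (4 * (C * D))" by (simp add: \<eta>_def)
    then have "\<eta> * (4 * (C * D)) \<le> \<eta>b * \<tau>" using C D by (subst (asm) pos_le_divide_eq) auto
    then show ?thesis by (simp add: mult_ac)
  qed
  obtain r \<gamma>' \<alpha>1 where r: "r > 0" and \<gamma>': "\<gamma>' > 0" and \<alpha>1: "\<alpha>1 > 0" and step':
    "\<forall>\<alpha> \<beta> \<gamma> J x t z.
      \<alpha> \<ge> \<alpha>1 \<longrightarrow> 0 < \<gamma> \<longrightarrow> \<gamma> \<le> \<gamma>' \<longrightarrow> \<bar>\<beta> - \<beta>0\<bar> \<le> \<gamma> * M \<longrightarrow>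
      maximal_solution (forced \<alpha> \<beta> \<gamma>) J x \<longrightarrow> t \<in> J \<longrightarrow> norm (dev (fst z) (snd z) (x t)) + \<gamma> \<le> r \<longrightarrow>
      (\<exists>z'. reset_step \<tau> C \<eta> \<beta> \<gamma> J x t z z')"
    using step[OF \<eta>] by (elim exE conjE) (rule that)
  \<comment> \<open>The entries serve, in this order: the use of \<open>step'\<close>; deviation
    plus \<gamma> at most \<open>r\<close>; the preservation of the bound r / 2 on the deviation;
    phase jumps of at most \<open>rb\<close>; a final deviation of at most \<epsilon>1 / 4; a drift
    of at most \<open>\<epsilon>2\<close> within a segment.\<close>
  define \<gamma>1 where "\<gamma>1 = Min {\<gamma>', r / 2, r / (8 * C), rb / (\<tau> * (2 * M + \<eta>b)), \<epsilon>1 / (4 * (C * D)), \<epsilon>2 / (M * \<tau>)}"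
  have \<gamma>1_pos: "\<gamma>1 > 0"
    using \<gamma>' r C rb(1) \<tau> M(1) \<eta>b(1) assms(2) D \<epsilon>2 unfolding \<gamma>1_def by (auto simp: add_pos_pos)
  have \<gamma>1: "\<gamma>1 \<le> \<gamma>'" "\<gamma>1 \<le> r / 2" "\<gamma>1 \<le> r / (8 * C)" "\<gamma>1 \<le> rb / (\<tau> * (2 * M + \<eta>b))"
    "\<gamma>1 \<le> \<epsilon>1 / (4 * (C * D))" "\<gamma>1 \<le> \<epsilon>2 / (M * \<tau>)"
    unfolding \<gamma>1_def by (rule Min_le, simp, simp)+
  have r2: "r / 2 > 0" using r by simp
  show ?thesis
  proof (rule exI[of _ \<gamma>1], rule conjI[OF \<gamma>1_pos], rule exI[of _ \<alpha>1], rule conjI[OF \<alpha>1],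
      rule exI[of _ "r / 2"], rule conjI[OF r2], intro allI impI)
    fix \<alpha> \<beta> \<gamma> J x t0
    assume \<alpha>: "\<alpha> \<ge> \<alpha>1" and \<gamma>0: "0 \<le> \<gamma>" and \<gamma>le: "\<gamma> \<le> \<gamma>1"
      and lo: "\<gamma> * G1_minus g x0 p1 < \<beta> - \<beta>0" and hi: "\<beta> - \<beta>0 < \<gamma> * G1_plus g x0 p1"
      and crit: "infdist ((\<beta> - \<beta>0) / \<gamma>) (S1 g x0 p1) \<ge> \<epsilon>"
      and max: "maximal_solution (forced \<alpha> \<beta> \<gamma>) J x" and t0: "t0 \<in> J"
      and near: "infdist (x t0) (torus2 A x0) < r / 2"
    \<comment> \<open>For \<gamma> = 0 the two strict inequalities for \<beta> - \<beta>0 contradict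
      each other.\<close>
    have \<gamma>: "\<gamma> > 0" using \<gamma>0 lo hi by (cases "\<gamma> = 0") auto
    define w where "w = (\<beta> - \<beta>0) / \<gamma>"
    have \<gamma>w: "\<gamma> * w = \<beta> - \<beta>0" using \<gamma> by (simp add: w_def)
    have w: "G vm < w" "w < G vp" using lo hi \<gamma> unfolding \<gamma>w[symmetric] v by auto
    have wM: "\<bar>w\<bar> \<le> M" using w M(2)[of vm] M(2)[of vp] by linarith
    have \<beta>M: "\<bar>\<beta> - \<beta>0\<bar> \<le> \<gamma> * M" unfolding \<gamma>w[symmetric] using \<gamma> wM by (simp add: abs_mult)
    have crit': "infdist w (critical_values G) \<ge> \<epsilon>" using crit by (simp add: S1_eq w_def)
    have "\<epsilon> \<le> dist w (G vp)" "\<epsilon> \<le> dist w (G vm)"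
      using crit' infdist_le[OF v(2), of w] infdist_le[OF v(4), of w] v by auto
    then have up: "G vp > w + \<eta>b" and down: "G vm < w - \<eta>b" using w \<eta>b by (auto simp: dist_real_def)
    have gap: "\<exists>v\<in>{a..a + \<epsilon>2}. \<bar>G v - w\<bar> > \<eta>b" for a
      using \<eta>0(2)[OF crit', of a] \<eta>b(2) by force
    have \<gamma>b: "\<gamma> \<le> \<gamma>'" "\<gamma> \<le> r / 2" "C * \<gamma> \<le> r / 8" "\<gamma> * (\<tau> * (2 * M + \<eta>b)) \<le> rb"
      "C * D * \<gamma> \<le> \<epsilon>1 / 4" "\<gamma> * M * \<tau> \<le> \<epsilon>2"
    proof -
      show "\<gamma> \<le> \<gamma>'" "\<gamma> \<le> r / 2" using \<gamma>le \<gamma>1 by linarith+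
      have "\<gamma> \<le> r / (8 * C)" using \<gamma>le \<gamma>1 by linarith
      then show "C * \<gamma> \<le> r / 8" using C by (simp add: pos_le_divide_eq mult_ac)
      have "\<gamma> \<le> rb / (\<tau> * (2 * M + \<eta>b))" using \<gamma>le \<gamma>1 by linarith
      then show "\<gamma> * (\<tau> * (2 * M + \<eta>b)) \<le> rb" using \<tau> M(1) \<eta>b(1) by (subst (asm) pos_le_divide_eq) auto
      have "\<gamma> \<le> \<epsilon>1 / (4 * (C * D))" using \<gamma>le \<gamma>1 by linarith
      then have "\<gamma> * (4 * (C * D)) \<le> \<epsilon>1" using C D by (subst (asm) pos_le_divide_eq) auto
      then show "C * D * \<gamma> \<le> \<epsilon>1 / 4" by (simp add: mult_ac)
      have "\<gamma> \<le> \<epsilon>2 / (M * \<tau>)" using \<gamma>le \<gamma>1 by linarith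
      then have "\<gamma> * (M * \<tau>) \<le> \<epsilon>2" using M(1) \<tau> by (subst (asm) pos_le_divide_eq) auto
      then show "\<gamma> * M * \<tau> \<le> \<epsilon>2" by (simp add: mult_ac)
    qed
    define t where "t = (\<lambda>k :: nat. t0 + real k * \<tau>)"
    have t_Suc: "t (Suc k) = t k + \<tau>" for k by (simp add: t_def algebra_simps)
    define dv where "dv = (\<lambda>k (z :: real \<times> real). dev (fst z) (snd z) (x (t k)))"
    define Inv where "Inv = (\<lambda>k z. t k \<in> J \<and> norm (dv k z) \<le> r / 2)"
    define Rel where "Rel = (\<lambda>k. reset_step \<tau> C \<eta> \<beta> \<gamma> J x (t k))"
    note Rel_expand = Rel_def reset_step_def t_Suc[symmetric] dv_def[THEN fun_cong, THEN fun_cong, symmetric]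
    \<comment> \<open>The phases are obtained by dependent choice: a next pair exists only as long
      as the deviation is under control, which is why \<open>Inv\<close> is carried along.\<close>
    have "\<exists>Z. \<forall>k. Inv k (Z k) \<and> Rel k (Z k) (Z (Suc k))"
    proof (rule dependent_nat_choice)
      have "\<exists>z\<in>torus2 A x0. dist (x t0) z < r / 2"
      proof (rule ccontr)
        assume "\<not> ?thesis"
        then have ge: "\<And>z. z \<in> torus2 A x0 \<Longrightarrow> r / 2 \<le> dist (x t0) z" by force
        have ne: "torus2 A x0 \<noteq> {}" by (auto simp: torus2_def)
        have "r / 2 \<le> infdist (x t0) (torus2 A x0)"
          unfolding infdist_notempty[OF ne] by (rule cINF_greatest[OF ne ge])
        then show False using near by simp
      qed
      then obtain \<psi> \<phi> where "dist (x t0) (E \<phi> *v x0 \<psi>) < r / 2" by (auto simp: torus2_def)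
      then have "norm (dev \<psi> \<phi> (x t0)) < r / 2" by (simp only: dist_norm norm_dev)
      then show "\<exists>z. Inv 0 z" using t0 by (intro exI[of _ "(\<psi>, \<phi>)"]) (simp add: Inv_def dv_def t_def)
    next
      fix z k assume inv: "Inv k z"
      have sm: "norm (dev (fst z) (snd z) (x (t k))) + \<gamma> \<le> r"
        using inv \<gamma>b(2) by (simp add: Inv_def dv_def)
      have tk: "t k \<in> J" using inv by (simp add: Inv_def)
      obtain z' where rel: "Rel k z z'"
        using step'[rule_format, OF \<alpha> \<gamma> \<gamma>b(1) \<beta>M max tk sm] unfolding Rel_def by blast
      have "t (Suc k) \<in> J" using rel \<tau> unfolding Rel_def reset_step_def t_Suc by (meson atLeastAtMost_iff less_imp_le order_refl)
      moreover have "norm (dv (Suc k) z') \<le> r / 2"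
      proof -
        have "norm (dv (Suc k) z') \<le> (1 / 2 + C * \<eta>) * norm (dv k z) + C * \<gamma>" using rel unfolding Rel_expand by blast
        also have "\<dots> \<le> 3 / 4 * (r / 2) + r / 8"
          using C\<eta> \<gamma>b(3) inv C \<eta>(1) by (intro add_mono mult_mono) (auto simp: Inv_def)
        finally show ?thesis by simp
      qed
      ultimately show "\<exists>z'. Inv (Suc k) z' \<and> Rel k z z'" using rel by (intro exI[of _ z']) (simp add: Inv_def)
    qed
    then obtain Z where Z: "\<And>k. Inv k (Z k)" "\<And>k. Rel k (Z k) (Z (Suc k))" by blast
    define d where "d = (\<lambda>k. norm (dv k (Z k)))"
    define \<sigma> where "\<sigma> = (\<lambda>k. fst (Z k) - \<beta> * t k)"
    have dS: "d (Suc k) \<le> 3 / 4 * d k + C * \<gamma>" for k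
    proof -
      have "d (Suc k) \<le> (1 / 2 + C * \<eta>) * d k + C * \<gamma>" using Z(2)[of k] unfolding Rel_expand d_def by blast
      moreover have "(1 / 2 + C * \<eta>) * d k \<le> 3 / 4 * d k" using C\<eta> by (intro mult_right_mono) (auto simp: d_def)
      ultimately show ?thesis by linarith
    qed
    have "(\<lambda>k. (3 / 4 :: real) ^ k * d 0) \<longlonglongrightarrow> 0"
      using tendsto_mult_right[OF LIMSEQ_power_zero[of "3 / 4 :: real"], of "d 0"] by simp
    from order_tendstoD(2)[OF this \<gamma>] obtain K1 where K1: "\<And>k. k \<ge> K1 \<Longrightarrow> (3 / 4) ^ k * d 0 < \<gamma>"
      by (auto simp: eventually_sequentially)
    have d_small: "d k + \<gamma> \<le> D * \<gamma>" if "k \<ge> K1" for k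
    proof -
      have "d k \<le> (3 / 4) ^ k * d 0 + C * \<gamma> * (1 - (3 / 4) ^ k) / (1 - 3 / 4)"
        by (rule affine_recursion_bound[where a = d, OF dS]) auto
      also have "\<dots> \<le> \<gamma> + C * \<gamma> * 1 / (1 - 3 / 4)"
        using K1[OF that] C \<gamma> by (intro add_mono divide_right_mono mult_left_mono) auto
      finally show ?thesis by (simp add: D_def algebra_simps)
    qed
    have \<gamma>\<tau>: "\<gamma> * \<tau> > 0" using \<gamma> \<tau> by simp
    \<comment> \<open>The error is defined by solving the recursion for it; the content lies in
      \<open>e_small\<close>.\<close>
    define e where "e = (\<lambda>k. (\<sigma> (Suc k) - \<sigma> k) / (\<gamma> * \<tau>) - (G (\<sigma> k) - w))"
    have step_e: "\<sigma> (Suc k) - \<sigma> k = (\<gamma> * \<tau>) * (G (\<sigma> k) - w + e k)" for k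
      using \<gamma> \<tau> by (simp add: e_def)
    \<comment> \<open>The neutral component present at step k is what the reset ending step k - 1
      left over, and it is bounded by the deviation there. Hence one index more than
      \<open>K1\<close>.\<close>
    have e_small: "\<bar>e k\<bar> \<le> \<eta>b / 2" if k: "k \<ge> Suc K1" for k
    proof -
      obtain j where j: "k = Suc j" "j \<ge> K1" using k by (cases k) auto
      have "\<bar>\<sigma> (Suc k) - \<sigma> k - (\<gamma> * (\<tau> * G (\<sigma> k)) - (\<beta> - \<beta>0) * \<tau>) - p1 (fst (Z k)) \<bullet> dv k (Z k)\<bar> \<le> C * \<eta> * (d k + \<gamma>)"
        using Z(2)[of k] unfolding Rel_expand d_def \<sigma>_def by blast
      moreover have "C * \<eta> * (d k + \<gamma>) \<le> C * \<eta> * (D * \<gamma>)" using d_small[of k] k C \<eta> by (intro mult_left_mono) auto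
      moreover have "\<bar>p1 (fst (Z k)) \<bullet> dv k (Z k)\<bar> \<le> C * \<eta> * (d j + \<gamma>)"
        using Z(2)[of j] unfolding Rel_expand d_def j(1) by blast
      moreover have "C * \<eta> * (d j + \<gamma>) \<le> C * \<eta> * (D * \<gamma>)" using d_small[OF j(2)] C \<eta> by (intro mult_left_mono) auto
      moreover have "(\<gamma> * \<tau>) * e k = \<sigma> (Suc k) - \<sigma> k - (\<gamma> * (\<tau> * G (\<sigma> k)) - (\<beta> - \<beta>0) * \<tau>)"
        unfolding step_e \<gamma>w[symmetric] by (simp add: algebra_simps)
      ultimately have "\<bar>(\<gamma> * \<tau>) * e k\<bar> \<le> 2 * (C * \<eta> * (D * \<gamma>))" by linarith
      also have "\<dots> = 2 * (C * \<eta> * D) * \<gamma>" by simp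
      also have "\<dots> \<le> (\<tau> * \<eta>b / 2) * \<gamma>" using CD\<eta> \<gamma> by (intro mult_right_mono) auto
      finally have "(\<gamma> * \<tau>) * \<bar>e k\<bar> \<le> (\<gamma> * \<tau>) * (\<eta>b / 2)" using \<gamma> \<tau> by (simp add: abs_mult mult_ac)
      then show ?thesis using \<gamma>\<tau> by (simp only: mult_le_cancel_left_pos)
    qed
    have \<sigma>_small: "\<bar>\<sigma> (Suc k) - \<sigma> k\<bar> \<le> rb" if k: "k \<ge> Suc K1" for k
    proof -
      have "\<bar>G (\<sigma> k) - w + e k\<bar> \<le> 2 * M + \<eta>b" using M(2)[of "\<sigma> k"] wM e_small[OF k] \<eta>b(1) by linarith
      then have "(\<gamma> * \<tau>) * \<bar>G (\<sigma> k) - w + e k\<bar> \<le> (\<gamma> * \<tau>) * (2 * M + \<eta>b)" using \<gamma>\<tau> by (intro mult_left_mono) auto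
      then show ?thesis unfolding step_e abs_mult[of "\<gamma> * \<tau>"] using \<gamma>\<tau> \<gamma>b(4) by (simp add: mult.assoc)
    qed
    obtain s K where K: "K \<ge> Suc K1" "\<And>k. k \<ge> K \<Longrightarrow> \<bar>\<sigma> k - s\<bar> \<le> \<epsilon>2"
    proof (rule barrier_locking[where G = G and \<sigma> = \<sigma> and e = e, OF G_periodic rb(2) gap up down step_e e_small \<sigma>_small \<gamma>\<tau> \<epsilon>2])
      fix s K assume a: "Suc K1 \<le> K" and b: "\<And>k. k \<ge> K \<Longrightarrow> \<bar>\<sigma> k - s\<bar> \<le> \<epsilon>2"
      from that[OF a b] show thesis .
    qed
    show "\<exists>\<sigma> T. \<forall>t>T. t \<in> J \<and> (INF \<phi>. norm (x t - E \<phi> *v x0 (\<beta> * t + \<sigma>))) < \<epsilon>1"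
    proof (rule exI[of _ s], rule exI[of _ "t K"], intro allI impI)
      fix u assume u: "u > t K"
      define k where "k = nat \<lfloor>(u - t0) / \<tau>\<rfloor>"
      have "real K < (u - t0) / \<tau>" using u \<tau> by (simp add: t_def pos_less_divide_eq)
      then have kK: "k \<ge> K" and "real k \<le> (u - t0) / \<tau>" "(u - t0) / \<tau> < real k + 1"
        unfolding k_def by linarith+
      then have u': "real k * \<tau> \<le> u - t0" "u - t0 \<le> (real k + 1) * \<tau>"
        using \<tau> by (simp_all add: pos_le_divide_eq pos_divide_less_eq less_imp_le)
      define s' where "s' = u - t k"
      have s': "s' \<in> {0..\<tau>}" "t k + s' = u" using u' by (auto simp: s'_def t_def algebra_simps)
      define a \<phi> where "a = fst (Z k) + \<beta>0 * s'" and "\<phi> = snd (Z k) + \<alpha>0 * s'"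
      have seg: "u \<in> J" "norm (dev a \<phi> (x u)) \<le> C * (d k + \<gamma>)"
        using Z(2)[of k] s' unfolding Rel_expand d_def a_def \<phi>_def by force+
      have "C * (d k + \<gamma>) \<le> C * (D * \<gamma>)" using d_small[of k] kK K(1) C by (intro mult_left_mono) auto
      then have n1: "norm (dev a \<phi> (x u)) \<le> \<epsilon>1 / 4" using seg(2) \<gamma>b(5) by (simp add: mult.assoc)
      \<comment> \<open>Within a segment \<psi> advances with speed \<beta>0 instead of \<beta>,
        which produces the second term.\<close>
      have "a - (\<beta> * u + s) = (\<sigma> k - s) - (\<beta> - \<beta>0) * s'"
        unfolding s'(2)[symmetric] by (simp add: a_def \<sigma>_def algebra_simps)
      moreover have "\<bar>(\<beta> - \<beta>0) * s'\<bar> \<le> (\<gamma> * M) * \<tau>"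
        unfolding abs_mult using \<beta>M s' \<gamma> M(1) by (intro mult_mono) auto
      moreover have "r6 = 2 * \<epsilon>2" by (simp add: \<epsilon>2_def)
      ultimately have "\<bar>a - (\<beta> * u + s)\<bar> \<le> r6" using K(2)[OF kK] \<gamma>b(6) by linarith
      then have n2: "norm (x0 a - x0 (\<beta> * u + s)) \<le> \<epsilon>1 / 2" by (rule r6(2))
      have "x u - E \<phi> *v x0 (\<beta> * u + s) = (x u - E \<phi> *v x0 a) + E \<phi> *v (x0 a - x0 (\<beta> * u + s))"
        by (simp add: matrix_vector_mult_diff_distrib)
      then have "norm (x u - E \<phi> *v x0 (\<beta> * u + s)) \<le> norm (dev a \<phi> (x u)) + norm (x0 a - x0 (\<beta> * u + s))"
        using norm_triangle_ineq[of "x u - E \<phi> *v x0 a" "E \<phi> *v (x0 a - x0 (\<beta> * u + s))"]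
        by (simp only: norm_dev norm_mexp[OF skew])
      then have lt: "norm (x u - E \<phi> *v x0 (\<beta> * u + s)) < \<epsilon>1" using n1 n2 assms(2) by linarith
      have "(INF \<phi>. norm (x u - E \<phi> *v x0 (\<beta> * u + s))) \<le> norm (x u - E \<phi> *v x0 (\<beta> * u + s))"
        by (rule cINF_lower) (auto intro: bdd_belowI[of _ 0])
      with lt seg(1) show "u \<in> J \<and> (INF \<phi>. norm (x u - E \<phi> *v x0 (\<beta> * u + s))) < \<epsilon>1" by simp
    qed
  qed
qed

end

theorem theorem2p2:
  fixes f :: "real^'n \<Rightarrow> real^'n"
    and g :: "(real^'n) \<times> real \<times> real \<Rightarrow> real^'n"
    and A :: "real^'n^'n"
    and l :: nat
    and \<alpha>\<^sub>0 \<beta>\<^sub>0 :: real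
    and x\<^sub>0 p\<^sub>1 p\<^sub>2 :: "real \<Rightarrow> real^'n"
  assumes "l > 3" and "C_smooth l f" and "C_smooth l g"
    and "A \<noteq> 0" and "transpose A = - A" and "mexp ((2 * pi) *\<^sub>R A) = mat 1"
    and "\<And>x \<xi>. f (mexp (\<xi> *\<^sub>R A) *v x) = mexp (\<xi> *\<^sub>R A) *v f x"
    and "\<And>x \<psi> \<phi>. g (x, \<psi> + 2 * pi, \<phi>) = g (x, \<psi>, \<phi>)"
    and "\<And>x \<psi> \<phi>. g (x, \<psi>, \<phi> + 2 * pi) = g (x, \<psi>, \<phi>)"
    and "\<And>x \<psi> \<phi> \<xi>. g (mexp (\<xi> *\<^sub>R A) *v x, \<psi>, \<phi> + \<xi>) = mexp (\<xi> *\<^sub>R A) *v g (x, \<psi>, \<phi>)"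
    and "\<alpha>\<^sub>0 > 0" and "\<beta>\<^sub>0 > 0"
    and "\<And>\<psi>. x\<^sub>0 (\<psi> + 2 * pi) = x\<^sub>0 \<psi>"
    and "solution_on (\<lambda>t. f) UNIV (\<lambda>t. mexp ((\<alpha>\<^sub>0 * t) *\<^sub>R A) *v x\<^sub>0 (\<beta>\<^sub>0 * t))"
    and "\<And>\<psi> a b. a *\<^sub>R (A *v x\<^sub>0 \<psi>) + b *\<^sub>R vector_derivative x\<^sub>0 (at \<psi>) = 0 \<Longrightarrow> a = 0 \<and> b = 0"
    and "exponentially_orbitally_stable f A \<alpha>\<^sub>0 \<beta>\<^sub>0 x\<^sub>0"
    and "\<And>p \<psi>. p \<in> {p\<^sub>1, p\<^sub>2} \<Longrightarrow>
           (p has_vector_derivative adjoint_matrix f A \<alpha>\<^sub>0 \<beta>\<^sub>0 x\<^sub>0 \<psi> *v p \<psi>) (at \<psi>)"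
    and "\<And>p \<psi>. p \<in> {p\<^sub>1, p\<^sub>2} \<Longrightarrow> p (\<psi> + 2 * pi) = p \<psi>"
    and "\<And>\<psi>. p\<^sub>1 \<psi> \<bullet> vector_derivative x\<^sub>0 (at \<psi>) = 1"
    and "\<And>\<psi>. p\<^sub>1 \<psi> \<bullet> (A *v x\<^sub>0 \<psi>) = 0"
    and "\<And>\<psi>. p\<^sub>2 \<psi> \<bullet> vector_derivative x\<^sub>0 (at \<psi>) = 0"
    and "\<And>\<psi>. p\<^sub>2 \<psi> \<bullet> (A *v x\<^sub>0 \<psi>) = 1"
    and "\<And>\<psi>. deriv (G1 g x\<^sub>0 p\<^sub>1) \<psi> = 0 \<Longrightarrow> deriv (deriv (G1 g x\<^sub>0 p\<^sub>1)) \<psi> \<noteq> 0"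
  shows "\<forall>\<epsilon>>0. \<forall>\<epsilon>\<^sub>1>0. \<exists>\<gamma>\<^sub>1>0. \<exists>\<alpha>\<^sub>1>0. \<exists>\<delta>>0.
    \<forall>\<alpha> \<beta> \<gamma>. \<alpha> > 0 \<longrightarrow> \<beta> > 0 \<longrightarrow> \<alpha> \<ge> \<alpha>\<^sub>1 \<longrightarrow> 0 \<le> \<gamma> \<longrightarrow> \<gamma> \<le> \<gamma>\<^sub>1 \<longrightarrow>
      \<gamma> * G1_minus g x\<^sub>0 p\<^sub>1 < \<beta> - \<beta>\<^sub>0 \<longrightarrow> \<beta> - \<beta>\<^sub>0 < \<gamma> * G1_plus g x\<^sub>0 p\<^sub>1 \<longrightarrow>
      infdist ((\<beta> - \<beta>\<^sub>0) / \<gamma>) (S1 g x\<^sub>0 p\<^sub>1) \<ge> \<epsilon> \<longrightarrow>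
      (\<forall>J x t\<^sub>0. maximal_solution (\<lambda>t y. f y + \<gamma> *\<^sub>R g (y, \<beta> * t, \<alpha> * t)) J x \<longrightarrow>
         t\<^sub>0 \<in> J \<longrightarrow> infdist (x t\<^sub>0) (torus2 A x\<^sub>0) < \<delta> \<longrightarrow>
         (\<exists>\<sigma> T. \<forall>t>T. t \<in> J \<and>
            (INF \<phi>. norm (x t - mexp (\<phi> *\<^sub>R A) *v x\<^sub>0 (\<beta> * t + \<sigma>))) < \<epsilon>\<^sub>1))"
proof -
  have l: "1 \<le> l" using assms(1) by simp
  interpret forced_torus f g A \<alpha>\<^sub>0 \<beta>\<^sub>0 x\<^sub>0 p\<^sub>1 p\<^sub>2
    by unfold_locales (use assms(5-22) C_smooth_mono[OF assms(2) l] C_smooth_mono[OF assms(3) l] in auto)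
  show ?thesis
    using frequency_locking by (intro allI impI) assumption
qed

end
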